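(* Let $M$ be a closed, connected $C^\infty$ manifold of dimension $d\ge 2$. Let $d'\ge 0$ be an integer and $s$ a real number such that either $d'<d-1$ and $s\in[0,1]$, or $d'=d-1$ and $s\in[0,1)$. Then there exist a Hamiltonian $H\in C^{d',s}(T^*M,\mathbb{R})$ that is at least of class $C^1$, a Lagrangian graph $\Gamma\subset T^*M$ of class at least $C^1$, and a compact, connected set $\Lambda\subseteq\Gamma$ that is invariant under the Hamiltonian flow $\phi^t_H$, such that $H$ is not constant on $\Lambda$.
   Context: $T^*M$ is the cotangent bundle of $M$ with its canonical symplectic form; $X_H$ is the Hamiltonian vector field of $H$, given in canonical local coordinates $(q,p)$ by $\dot q=\partial H/\partial p$, $\dot p=-\partial H/\partial q$, and $\phi^t_H$ denotes the associated Hamiltonian flow. A set $\Lambda\subset T^*M$ is invariant under $\phi^t_H$ if $\phi^t_H(\Lambda)=\Lambda$ for all $t\in\mathbb{R}$. A Lagrangian graph of class $C^1$ is the image of a $C^1$ section $q\mapsto(q,\Gamma(q))$ of $T^*M\to M$ such that $\Gamma$ is a closed 1-form (locally the differential of a $C^2$ function). $C^{d',s}$ denotes the functions that are $d'$ times continuously differentiable and whose derivatives of order $d'$ in local charts are locally Hölder continuous with exponent $s$ (Lipschitz if $s=1$; no condition beyond continuity if $s=0$). *)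

theory Defs
  imports "HOL-Analysis.Analysis"
begin

section \<open>Functions of class \<open>C\<^sup>k\<close> and \<open>C\<^bsup>k,s\<^esup>\<close> on open sets\<close>

text \<open>Both predicates are meant for open sets \<open>U\<close>. The directions in \<open>Basis\<close> give the partial
  derivatives.\<close>

primrec Ck_on :: "nat \<Rightarrow> 'v::euclidean_space set \<Rightarrow> ('v \<Rightarrow> 'w::real_normed_vector) \<Rightarrow> bool" where
  "Ck_on 0 U f \<longleftrightarrow> continuous_on U f"
| "Ck_on (Suc k) U f \<longleftrightarrow> (\<forall>x\<in>U. f differentiable (at x)) \<and>
     (\<forall>b\<in>Basis. Ck_on k U (\<lambda>x. frechet_derivative f (at x) b))"

definition smooth_on :: "'v::euclidean_space set \<Rightarrow> ('v \<Rightarrow> 'w::real_normed_vector) \<Rightarrow> bool" where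
  "smooth_on U f \<longleftrightarrow> (\<forall>k. Ck_on k U f)"

text \<open>For \<open>s = 0\<close> the following only says that \<open>f\<close> is locally bounded, which is implied by
  continuity; for \<open>s = 1\<close> it is local Lipschitz continuity. Recall that \<open>0 powr s = 0\<close>.\<close>

definition locally_holder_on ::
    "real \<Rightarrow> 'v::euclidean_space set \<Rightarrow> ('v \<Rightarrow> 'w::real_normed_vector) \<Rightarrow> bool" where
  "locally_holder_on s U f \<longleftrightarrow>
     (\<forall>x\<in>U. \<exists>r>0. \<exists>C. \<forall>y\<in>U \<inter> ball x r. \<forall>z\<in>U \<inter> ball x r. dist (f y) (f z) \<le> C * dist y z powr s)"

primrec Ck_holder_on ::
    "nat \<Rightarrow> real \<Rightarrow> 'v::euclidean_space set \<Rightarrow> ('v \<Rightarrow> 'w::real_normed_vector) \<Rightarrow> bool" where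
  "Ck_holder_on 0 s U f \<longleftrightarrow> continuous_on U f \<and> locally_holder_on s U f"
| "Ck_holder_on (Suc k) s U f \<longleftrightarrow> (\<forall>x\<in>U. f differentiable (at x)) \<and>
     (\<forall>b\<in>Basis. Ck_holder_on k s U (\<lambda>x. frechet_derivative f (at x) b))"


section \<open>Smooth manifolds\<close>

text \<open>A chart consists of its domain and of a map that is only relevant on this domain. The dimension
  of the manifold is \<open>DIM('e)\<close>. As chart images are open in the full space \<open>'e\<close>, there is no boundary.\<close>

type_synonym ('a, 'e) chart = "'a set \<times> ('a \<Rightarrow> 'e)"

abbreviation chart_dom :: "('a, 'e) chart \<Rightarrow> 'a set" where
  "chart_dom c \<equiv> fst c"

abbreviation chart_map :: "('a, 'e) chart \<Rightarrow> 'a \<Rightarrow> 'e" where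
  "chart_map c \<equiv> snd c"

definition chart_img :: "('a, 'e) chart \<Rightarrow> 'e set" where
  "chart_img c = chart_map c ` chart_dom c"

definition chart_inv :: "('a, 'e) chart \<Rightarrow> 'e \<Rightarrow> 'a" where
  "chart_inv c = the_inv_into (chart_dom c) (chart_map c)"

definition is_chart :: "'a topology \<Rightarrow> ('a, 'e::euclidean_space) chart \<Rightarrow> bool" where
  "is_chart X c \<longleftrightarrow> openin X (chart_dom c) \<and> open (chart_img c) \<and>
     homeomorphic_map (subtopology X (chart_dom c)) (top_of_set (chart_img c)) (chart_map c)"

definition transition :: "('a, 'e) chart \<Rightarrow> ('a, 'e) chart \<Rightarrow> 'e \<Rightarrow> 'e" where
  "transition c c' = chart_map c' \<circ> chart_inv c"

definition smooth_atlas :: "'a topology \<Rightarrow> ('a, 'e::euclidean_space) chart set \<Rightarrow> bool" where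
  "smooth_atlas X A \<longleftrightarrow>
     (\<forall>c\<in>A. is_chart X c) \<and>
     (\<Union>c\<in>A. chart_dom c) = topspace X \<and>
     (\<forall>c\<in>A. \<forall>c'\<in>A. smooth_on (chart_map c ` (chart_dom c \<inter> chart_dom c')) (transition c c'))"

definition smooth_manifold :: "'a topology \<Rightarrow> ('a, 'e::euclidean_space) chart set \<Rightarrow> bool" where
  "smooth_manifold X A \<longleftrightarrow>
     topspace X \<noteq> {} \<and> Hausdorff_space X \<and>
     (\<exists>\<B>. countable \<B> \<and> (\<forall>B\<in>\<B>. openin X B) \<and>
        (\<forall>U x. openin X U \<and> x \<in> U \<longrightarrow> (\<exists>B\<in>\<B>. x \<in> B \<and> B \<subseteq> U))) \<and>
     smooth_atlas X A"

definition closed_connected_manifold ::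
    "'a topology \<Rightarrow> ('a, 'e::euclidean_space) chart set \<Rightarrow> bool" where
  "closed_connected_manifold X A \<longleftrightarrow>
     smooth_manifold X A \<and> compact_space X \<and> connected_space X"


section \<open>The cotangent bundle\<close>

text \<open>A covector at \<open>q\<close> is given by its components \<open>\<xi> c\<close> in all charts \<open>c\<close> around \<open>q\<close>, related by the
  transformation law \<open>p\<^sub>j = (\<Sum>i. p'\<^sub>i * \<partial>q'\<^sub>i / \<partial>q\<^sub>j)\<close>: the linear form represented by \<open>\<xi> c\<close> is the
  pullback of the one represented by \<open>\<xi> c'\<close> under the derivative of the change of charts. The inner
  product of \<open>'e\<close> only serves to encode component vectors of linear forms as elements of \<open>'e\<close>.
  At irrelevant indices the value is normalised to \<open>0\<close>, so that equality of covectors is equality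
  of functions.\<close>

type_synonym ('a, 'e) covec = "('a, 'e) chart \<Rightarrow> 'e"

definition covectors_at :: "('a, 'e::euclidean_space) chart set \<Rightarrow> 'a \<Rightarrow> ('a, 'e) covec set" where
  "covectors_at A q = {\<xi>.
     (\<forall>c\<in>A. \<forall>c'\<in>A. q \<in> chart_dom c \<inter> chart_dom c' \<longrightarrow>
        (\<forall>v. \<xi> c \<bullet> v = \<xi> c' \<bullet> frechet_derivative (transition c c') (at (chart_map c q)) v)) \<and>
     (\<forall>c. \<not> (c \<in> A \<and> q \<in> chart_dom c) \<longrightarrow> \<xi> c = 0)}"

definition cotangent_bundle ::
    "'a topology \<Rightarrow> ('a, 'e::euclidean_space) chart set \<Rightarrow> ('a \<times> ('a, 'e) covec) set" where
  "cotangent_bundle X A = (SIGMA q:topspace X. covectors_at A q)"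

definition cotangent_dom ::
    "'a topology \<Rightarrow> ('a, 'e::euclidean_space) chart set \<Rightarrow> ('a, 'e) chart \<Rightarrow> ('a \<times> ('a, 'e) covec) set"
  where "cotangent_dom X A c = {z \<in> cotangent_bundle X A. fst z \<in> chart_dom c}"

text \<open>The canonical coordinates \<open>(q, p)\<close> induced by a chart, and their inverse on
  \<open>chart_img c \<times> UNIV\<close>.\<close>

definition canonical_coords :: "('a, 'e) chart \<Rightarrow> 'a \<times> ('a, 'e) covec \<Rightarrow> 'e \<times> 'e" where
  "canonical_coords c z = (chart_map c (fst z), snd z c)"

definition canonical_coords_inv ::
    "'a topology \<Rightarrow> ('a, 'e::euclidean_space) chart set \<Rightarrow> ('a, 'e) chart \<Rightarrow> 'e \<times> 'e \<Rightarrow> 'a \<times> ('a, 'e) covec"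
  where "canonical_coords_inv X A c = the_inv_into (cotangent_dom X A c) (canonical_coords c)"

definition cotangent_topology ::
    "'a topology \<Rightarrow> ('a, 'e::euclidean_space) chart set \<Rightarrow> ('a \<times> ('a, 'e) covec) topology" where
  "cotangent_topology X A = topology_generated_by
     {{z \<in> cotangent_dom X A c. canonical_coords c z \<in> V} | c V. c \<in> A \<and> open V}"


section \<open>Hamiltonians and their flows\<close>

text \<open>A Hamiltonian is a function on \<open>cotangent_bundle X A\<close>; its values elsewhere are irrelevant.\<close>

definition local_rep ::
    "'a topology \<Rightarrow> ('a, 'e::euclidean_space) chart set \<Rightarrow> ('a \<times> ('a, 'e) covec \<Rightarrow> real) \<Rightarrow>
     ('a, 'e) chart \<Rightarrow> 'e \<times> 'e \<Rightarrow> real" where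
  "local_rep X A H c = H \<circ> canonical_coords_inv X A c"

definition Ck_hamiltonian ::
    "nat \<Rightarrow> 'a topology \<Rightarrow> ('a, 'e::euclidean_space) chart set \<Rightarrow>
     ('a \<times> ('a, 'e) covec \<Rightarrow> real) \<Rightarrow> bool" where
  "Ck_hamiltonian k X A H \<longleftrightarrow> (\<forall>c\<in>A. Ck_on k (chart_img c \<times> UNIV) (local_rep X A H c))"

definition Ck_holder_hamiltonian ::
    "nat \<Rightarrow> real \<Rightarrow> 'a topology \<Rightarrow> ('a, 'e::euclidean_space) chart set \<Rightarrow>
     ('a \<times> ('a, 'e) covec \<Rightarrow> real) \<Rightarrow> bool" where
  "Ck_holder_hamiltonian k s X A H \<longleftrightarrow>
     (\<forall>c\<in>A. Ck_holder_on k s (chart_img c \<times> UNIV) (local_rep X A H c))"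

text \<open>The components \<open>(\<partial>H/\<partial>p, - \<partial>H/\<partial>q)\<close> of \<open>X\<^sub>H\<close> in the canonical coordinates of the chart \<open>c\<close>.\<close>

definition hamiltonian_field ::
    "'a topology \<Rightarrow> ('a, 'e::euclidean_space) chart set \<Rightarrow> ('a \<times> ('a, 'e) covec \<Rightarrow> real) \<Rightarrow>
     ('a, 'e) chart \<Rightarrow> 'a \<times> ('a, 'e) covec \<Rightarrow> 'e \<times> 'e" where
  "hamiltonian_field X A H c z =
     (let dH = frechet_derivative (local_rep X A H c) (at (canonical_coords c z))
      in (\<Sum>b\<in>Basis. dH (0, b) *\<^sub>R b, - (\<Sum>b\<in>Basis. dH (b, 0) *\<^sub>R b)))"

text \<open>Continuity of the curve makes the derivative condition local: near each time \<open>t\<close> the curve stays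
  in the domain of the chart.\<close>

definition integral_curve_on ::
    "'a topology \<Rightarrow> ('a, 'e::euclidean_space) chart set \<Rightarrow> ('a \<times> ('a, 'e) covec \<Rightarrow> real) \<Rightarrow>
     real set \<Rightarrow> (real \<Rightarrow> 'a \<times> ('a, 'e) covec) \<Rightarrow> bool" where
  "integral_curve_on X A H I \<gamma> \<longleftrightarrow>
     continuous_map (top_of_set I) (cotangent_topology X A) \<gamma> \<and>
     (\<forall>t\<in>I. \<forall>c\<in>A. fst (\<gamma> t) \<in> chart_dom c \<longrightarrow>
        ((\<lambda>u. canonical_coords c (\<gamma> u)) has_vector_derivative hamiltonian_field X A H c (\<gamma> t)) (at t))"

text \<open>For a Hamiltonian that is merely \<open>C\<^sup>1\<close> the field is merely continuous, so that neither uniqueness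
  nor completeness of integral curves is automatic. That \<open>\<phi>\<close> is \<^emph>\<open>the\<close> flow therefore includes that
  each point lies on a unique integral curve and that this curve is defined for all times.\<close>

definition hamiltonian_flow ::
    "'a topology \<Rightarrow> ('a, 'e::euclidean_space) chart set \<Rightarrow> ('a \<times> ('a, 'e) covec \<Rightarrow> real) \<Rightarrow>
     (real \<Rightarrow> 'a \<times> ('a, 'e) covec \<Rightarrow> 'a \<times> ('a, 'e) covec) \<Rightarrow> bool" where
  "hamiltonian_flow X A H \<phi> \<longleftrightarrow>
     (\<forall>z\<in>cotangent_bundle X A.
        \<phi> 0 z = z \<and> integral_curve_on X A H UNIV (\<lambda>t. \<phi> t z) \<and>
        (\<forall>I \<gamma>. open I \<and> is_interval I \<and> 0 \<in> I \<and> integral_curve_on X A H I \<gamma> \<and> \<gamma> 0 = z \<longrightarrow>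
           (\<forall>t\<in>I. \<gamma> t = \<phi> t z)))"

definition flow_invariant ::
    "'a topology \<Rightarrow> ('a, 'e::euclidean_space) chart set \<Rightarrow> ('a \<times> ('a, 'e) covec \<Rightarrow> real) \<Rightarrow>
     ('a \<times> ('a, 'e) covec) set \<Rightarrow> bool" where
  "flow_invariant X A H \<Lambda> \<longleftrightarrow> (\<exists>\<phi>. hamiltonian_flow X A H \<phi> \<and> (\<forall>t. \<phi> t ` \<Lambda> = \<Lambda>))"


section \<open>Lagrangian graphs\<close>

definition C1_one_form ::
    "'a topology \<Rightarrow> ('a, 'e::euclidean_space) chart set \<Rightarrow> ('a \<Rightarrow> ('a, 'e) covec) \<Rightarrow> bool" where
  "C1_one_form X A \<eta> \<longleftrightarrow>
     (\<forall>q\<in>topspace X. \<eta> q \<in> covectors_at A q) \<and>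
     (\<forall>c\<in>A. Ck_on 1 (chart_img c) (\<lambda>x. \<eta> (chart_inv c x) c))"

text \<open>Closedness of a continuous 1-form: locally it is the differential of a \<open>C\<^sup>2\<close> function \<open>u\<close>.\<close>

definition closed_one_form ::
    "'a topology \<Rightarrow> ('a, 'e::euclidean_space) chart set \<Rightarrow> ('a \<Rightarrow> ('a, 'e) covec) \<Rightarrow> bool" where
  "closed_one_form X A \<eta> \<longleftrightarrow>
     (\<forall>q\<in>topspace X. \<exists>W (u :: 'a \<Rightarrow> real). openin X W \<and> q \<in> W \<and>
        (\<forall>c\<in>A. Ck_on 2 (chart_map c ` (chart_dom c \<inter> W)) (u \<circ> chart_inv c) \<and>
           (\<forall>x \<in> chart_map c ` (chart_dom c \<inter> W). \<forall>v.
              frechet_derivative (u \<circ> chart_inv c) (at x) v = \<eta> (chart_inv c x) c \<bullet> v)))"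

definition C1_lagrangian_graph ::
    "'a topology \<Rightarrow> ('a, 'e::euclidean_space) chart set \<Rightarrow> ('a \<times> ('a, 'e) covec) set \<Rightarrow> bool" where
  "C1_lagrangian_graph X A \<Gamma> \<longleftrightarrow>
     (\<exists>\<eta>. C1_one_form X A \<eta> \<and> closed_one_form X A \<eta> \<and> \<Gamma> = (\<lambda>q. (q, \<eta> q)) ` topspace X)"

end

theory Submission
  imports Defs
begin

text \<open>Let \<open>H (q, p) = h q\<close>. Then \<open>q\<close> is constant along the flow and \<open>p\<close> moves by
  \<open>- t * dh q\<close>, so that the zero section over a set of critical points of \<open>h\<close> consists of
  fixed points. It remains to find \<open>h\<close> of class \<open>C\<^bsup>d-1,s\<^esup>\<close>, \<open>s < 1\<close>, supported in one chart, that is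
  not constant on a compact connected set \<open>K\<close> of critical points, as in Whitney's example.

  A cube contains \<open>N = (2 n + 1) ^ d\<close> small copies of itself, scaled by \<open>1 / X\<close> with
  \<open>X = 4 (n + 1)\<close> and strung together by arcs; \<open>K\<close> is what remains when this replacement of the cube
  by a chain of cubes and arcs is iterated. The function is constant on each arc and, up to an additive
  constant and a sign, \<open>1 / N\<close> times itself on each small cube. The \<open>l\<close>-th step changes
  derivatives of order \<open>j\<close> by \<open>O((X ^ j / N) ^ l)\<close>, which is summable for \<open>j < d\<close>, with room for the
  Hoelder exponent \<open>s\<close> if \<open>n\<close> is large.\<close>


section \<open>Calculus of \<open>C\<^bsup>k,s\<^esup>\<close> functions\<close>

text \<open>By the Morse-Sard theorem the critical values of a \<open>C^d\<close> function of
  \<open>d\<close> variables form a null set, so the image of a connected set of critical points, an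
  interval, is a single point. The regularity of \<open>h\<close> must stay below that threshold.
  The copies of the cube are kept apart, so that \<open>X\<close> exceeds the number
  \<open>2 n + 1\<close> of copies along an edge by a factor of up to \<open>4\<close>. This costs
  at most \<open>4 ^ d\<close> when \<open>X powr (d - 1 + s)\<close> is compared with
  \<open>N\<close>, and the gain \<open>X powr (1 - s)\<close> outweighs it for large
  \<open>n\<close> because \<open>s < 1\<close>. An odd number of points per coordinate makes the
  number of rows odd. Hence the path that enters the cube at the left end leaves it at the right
  end, as a chain of self-similar pieces requires. \<open>H\<close> may be no better than
  \<open>C^1\<close> and its field no better than continuous. As \<open>H\<close> is independent of
  \<open>p\<close>, uniqueness and completeness of integral curves do not rest on a Lipschitz
  condition: first \<open>q\<close> is seen to be constant, and then \<open>p\<close> has a constant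
  derivative.\<close>

lemma Ck_holder_on_imp_Ck_on: "Ck_holder_on k s U f \<Longrightarrow> Ck_on k U f"
  by (induction k arbitrary: f) auto

lemma locally_holder_onD:
  assumes "locally_holder_on s U f" "x \<in> U"
  shows "\<exists>r>0. \<exists>C. \<forall>y\<in>U \<inter> ball x r. \<forall>z\<in>U \<inter> ball x r. dist (f y) (f z) \<le> C * dist y z powr s"
  using assms unfolding locally_holder_on_def by (rule bspec)

lemma locally_holder_on_0:
  fixes f :: "'v::euclidean_space \<Rightarrow> 'w::real_normed_vector"
  assumes "continuous_on U f"
  shows "locally_holder_on 0 U f"
  unfolding locally_holder_on_def
proof
  fix x assume "x \<in> U"
  then obtain r where r: "r > 0" "\<And>y. y \<in> U \<Longrightarrow> dist y x < r \<Longrightarrow> dist (f y) (f x) < 1"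
    using assms unfolding continuous_on_iff by (meson zero_less_one)
  have "dist (f y) (f z) \<le> 2 * dist y z powr 0"
    if "y \<in> U \<inter> ball x r" "z \<in> U \<inter> ball x r" for y z
  proof (cases "y = z")
    case False
    have "dist (f y) (f x) < 1" "dist (f z) (f x) < 1"
      using that r(2) by (auto simp: dist_commute[of _ x])
    then have "dist (f y) (f z) \<le> 2"
      using dist_triangle2[of "f y" "f z" "f x"] by linarith
    with False show ?thesis by simp
  qed simp
  with r show "\<exists>r>0. \<exists>C. \<forall>y\<in>U \<inter> ball x r. \<forall>z\<in>U \<inter> ball x r.
      dist (f y) (f z) \<le> C * dist y z powr 0"
    by blast
qed

text \<open>Lets closure properties be proved once, for \<open>Ck_holder_on\<close>, and be
  transferred to \<open>Ck_on\<close> by taking \<open>s = 0\<close>.\<close>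

lemma Ck_on_iff_Ck_holder_on_0: "Ck_on k U f \<longleftrightarrow> Ck_holder_on k 0 U f"
  by (induction k arbitrary: f) (auto simp: locally_holder_on_0)

text \<open>For functions given by different formulas on different open pieces, such as the
  extension by zero of a function on a chart.\<close>

lemma Ck_holder_on_locally:
  assumes "\<And>x. x \<in> U \<Longrightarrow> \<exists>V. open V \<and> x \<in> V \<and> Ck_holder_on k s V f"
  shows "Ck_holder_on k s U f"
  using assms
proof (induction k arbitrary: f)
  case 0
  have "continuous_on U f"
    using 0 by (metis Ck_holder_on.simps(1) continuous_at_imp_continuous_on continuous_on_eq_continuous_at)
  moreover have "locally_holder_on s U f"
    unfolding locally_holder_on_def
  proof
    fix x assume "x \<in> U"
    then obtain V where V: "open V" "x \<in> V" "locally_holder_on s V f"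
      using 0[of x] by (metis Ck_holder_on.simps(1))
    then obtain r C where r: "r > 0" "\<forall>y\<in>V \<inter> ball x r. \<forall>z\<in>V \<inter> ball x r.
        dist (f y) (f z) \<le> C * dist y z powr s"
      unfolding locally_holder_on_def by meson
    obtain r' where r': "r' > 0" "ball x r' \<subseteq> V" using V open_contains_ball by blast
    have "\<forall>y\<in>U \<inter> ball x (min r r'). \<forall>z\<in>U \<inter> ball x (min r r').
        dist (f y) (f z) \<le> C * dist y z powr s"
      using r r' by (auto simp: subset_iff)
    moreover have "min r r' > 0" using r r' by simp
    ultimately show "\<exists>r>0. \<exists>C. \<forall>y\<in>U \<inter> ball x r. \<forall>z\<in>U \<inter> ball x r.
        dist (f y) (f z) \<le> C * dist y z powr s"
      by blast
  qed
  ultimately show ?case by simp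
next
  case (Suc k)
  have "f differentiable (at x)" if "x \<in> U" for x
    using Suc.prems[OF that] unfolding Ck_holder_on.simps by blast
  moreover have "Ck_holder_on k s U (\<lambda>x. frechet_derivative f (at x) b)" if "b \<in> Basis" for b
  proof (rule Suc.IH)
    fix x assume "x \<in> U"
    then show "\<exists>V. open V \<and> x \<in> V \<and> Ck_holder_on k s V (\<lambda>x. frechet_derivative f (at x) b)"
      using Suc.prems[of x] that unfolding Ck_holder_on.simps by blast
  qed
  ultimately show ?case by auto
qed

lemma Ck_holder_on_cong:
  assumes "open U" "Ck_holder_on k s U f" "\<And>x. x \<in> U \<Longrightarrow> f x = g x"
  shows "Ck_holder_on k s U g"
  using assms(2,3)
proof (induction k arbitrary: f g)
  case 0
  have "locally_holder_on s U g"
    unfolding locally_holder_on_def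
  proof
    fix x assume "x \<in> U"
    then obtain r C where "r > 0" "\<forall>y\<in>U \<inter> ball x r. \<forall>z\<in>U \<inter> ball x r.
        dist (f y) (f z) \<le> C * dist y z powr s"
      using 0 by (auto simp: locally_holder_on_def)
    then show "\<exists>r>0. \<exists>C. \<forall>y\<in>U \<inter> ball x r. \<forall>z\<in>U \<inter> ball x r.
        dist (g y) (g z) \<le> C * dist y z powr s"
      using 0(2) by (intro exI[of _ r] conjI exI[of _ C]) auto
  qed
  then show ?case using 0 continuous_on_cong by (metis Ck_holder_on.simps(1))
next
  case (Suc k)
  have fd: "frechet_derivative f (at x) = frechet_derivative g (at x)" if "x \<in> U" for x
    using Suc.prems that assms(1) by (intro frechet_derivative_transform_within_open) auto
  have "g differentiable (at x)" if "x \<in> U" for x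
    using Suc.prems that assms(1)
    by (meson Ck_holder_on.simps(2) differentiable_def has_derivative_transform_within_open)
  moreover have "Ck_holder_on k s U (\<lambda>x. frechet_derivative g (at x) b)" if "b \<in> Basis" for b
    by (rule Suc.IH[of "\<lambda>x. frechet_derivative f (at x) b"]) (use Suc.prems that fd in auto)
  ultimately show ?case by auto
qed

lemma Ck_holder_on_const: "Ck_holder_on k s U (\<lambda>x. c)"
proof (induction k arbitrary: c)
  case 0
  have "locally_holder_on s U (\<lambda>x. c)"
    unfolding locally_holder_on_def by (intro ballI exI[of _ 1] conjI exI[of _ 0]) auto
  then show ?case by simp
qed auto

lemma bounded_linear_Ck_holder_on:
  fixes f :: "'v::euclidean_space \<Rightarrow> 'w::real_normed_vector"
  assumes "bounded_linear f"
  shows "Ck_holder_on (Suc k) s U f"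
proof -
  have "frechet_derivative f (at x) = f" for x
    using bounded_linear_imp_has_derivative[OF assms] by (rule frechet_derivative_at[symmetric])
  then show ?thesis
    using assms by (auto simp: Ck_holder_on_const bounded_linear_imp_differentiable)
qed

lemma frechet_derivative_add_at:
  assumes "f differentiable (at x)" "g differentiable (at x)"
  shows "frechet_derivative (\<lambda>x. f x + g x) (at x)
    = (\<lambda>v. frechet_derivative f (at x) v + frechet_derivative g (at x) v)"
  using assms by (intro frechet_derivative_at[symmetric] has_derivative_add)
    (auto simp: frechet_derivative_works[symmetric])

lemma frechet_derivative_mult_at:
  fixes f g :: "'v::real_normed_vector \<Rightarrow> real"
  assumes "f differentiable (at x)" "g differentiable (at x)"
  shows "frechet_derivative (\<lambda>x. f x * g x) (at x)
    = (\<lambda>v. f x * frechet_derivative g (at x) v + frechet_derivative f (at x) v * g x)"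
  using assms by (intro frechet_derivative_at[symmetric] has_derivative_mult)
    (auto simp: frechet_derivative_works[symmetric])

lemma Ck_holder_on_add:
  assumes "open U" "Ck_holder_on k s U f" "Ck_holder_on k s U g"
  shows "Ck_holder_on k s U (\<lambda>x. f x + g x)"
  using assms(2,3)
proof (induction k arbitrary: f g)
  case 0
  have "locally_holder_on s U (\<lambda>x. f x + g x)"
    unfolding locally_holder_on_def
  proof
    fix x assume "x \<in> U"
    then obtain r C r' C' where r: "r > 0" "\<forall>y\<in>U \<inter> ball x r. \<forall>z\<in>U \<inter> ball x r.
        dist (f y) (f z) \<le> C * dist y z powr s"
      and r': "r' > 0" "\<forall>y\<in>U \<inter> ball x r'. \<forall>z\<in>U \<inter> ball x r'.
        dist (g y) (g z) \<le> C' * dist y z powr s"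
      using locally_holder_onD[of s U f x] locally_holder_onD[of s U g x] 0 by auto
    have "dist (f y + g y) (f z + g z) \<le> (C + C') * dist y z powr s"
      if "y \<in> U \<inter> ball x (min r r')" "z \<in> U \<inter> ball x (min r r')" for y z
    proof -
      have "dist (f y) (f z) \<le> C * dist y z powr s" "dist (g y) (g z) \<le> C' * dist y z powr s"
        using r r' that by auto
      then show ?thesis using dist_triangle_add[of "f y" "g y" "f z" "g z"]
        by (simp add: algebra_simps)
    qed
    moreover have "min r r' > 0" using r r' by simp
    ultimately show "\<exists>r>0. \<exists>C. \<forall>y\<in>U \<inter> ball x r. \<forall>z\<in>U \<inter> ball x r.
        dist (f y + g y) (f z + g z) \<le> C * dist y z powr s"
      by blast
  qed
  then show ?case using 0 by (auto intro: continuous_on_add)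
next
  case (Suc k)
  have "Ck_holder_on k s U (\<lambda>x. frechet_derivative (\<lambda>x. f x + g x) (at x) b)" if "b \<in> Basis" for b
    by (rule Ck_holder_on_cong[OF assms(1) Suc.IH[of "\<lambda>x. frechet_derivative f (at x) b"
            "\<lambda>x. frechet_derivative g (at x) b"]])
      (use Suc.prems that in \<open>auto simp: frechet_derivative_add_at\<close>)
  then show ?case using Suc.prems by auto
qed

text \<open>Turns bounds on partial derivatives, in terms of which all classes here are defined,
  into the operator norm bounds that the mean value inequality asks for.\<close>

lemma norm_linear_le_Basis:
  fixes h :: "'v::euclidean_space \<Rightarrow> 'w::real_normed_vector"
  assumes "bounded_linear h" "\<And>b. b \<in> Basis \<Longrightarrow> norm (h b) \<le> B"
  shows "norm (h v) \<le> real DIM('v) * B * norm v"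
proof -
  interpret bounded_linear h by fact
  have "h v = (\<Sum>b\<in>Basis. (v \<bullet> b) *\<^sub>R h b)"
    using arg_cong[OF euclidean_representation[of v], of h] by (simp add: sum scale)
  also have "norm \<dots> \<le> (\<Sum>b\<in>(Basis::'v set). B * norm v)"
  proof (rule sum_norm_le)
    fix b :: 'v assume b: "b \<in> Basis"
    have "\<bar>v \<bullet> b\<bar> * norm (h b) \<le> norm v * B"
      using Basis_le_norm[OF b, of v] assms(2)[OF b] by (intro mult_mono) auto
    then show "norm ((v \<bullet> b) *\<^sub>R h b) \<le> B * norm v" by (simp add: mult.commute)
  qed
  finally show ?thesis by simp
qed

text \<open>The partial derivatives are bounded on a small compact ball, and the mean value
  inequality applies because balls are convex.\<close>

lemma locally_lipschitz_Ck_on_1: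
  fixes f :: "'v::euclidean_space \<Rightarrow> 'w::real_normed_vector"
  assumes U: "open U" and f: "Ck_on 1 U f" and x: "x \<in> U"
  shows "\<exists>r>0. \<exists>C\<ge>0. ball x r \<subseteq> U \<and> (\<forall>y\<in>ball x r. \<forall>z\<in>ball x r. dist (f y) (f z) \<le> C * dist y z)"
proof -
  obtain r where r: "r > 0" "cball x r \<subseteq> U" using U x open_contains_cball by blast
  have "\<exists>B. \<forall>y\<in>cball x r. norm (frechet_derivative f (at y) b) \<le> B" if "b \<in> Basis" for b
  proof -
    have "continuous_on (cball x r) (\<lambda>x. frechet_derivative f (at x) b)"
      using f that r by (auto intro: continuous_on_subset)
    then have "bounded ((\<lambda>x. frechet_derivative f (at x) b) ` cball x r)"
      by (intro compact_imp_bounded compact_continuous_image compact_cball)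
    then show ?thesis by (auto simp: bounded_iff)
  qed
  then obtain B where B: "\<And>b y. b \<in> Basis \<Longrightarrow> y \<in> cball x r \<Longrightarrow> norm (frechet_derivative f (at y) b) \<le> B b"
    by metis
  have der: "(f has_derivative frechet_derivative f (at y)) (at y)" if "y \<in> cball x r" for y
    using f that r by (auto simp: frechet_derivative_works[symmetric])
  define B' where "B' = (\<Sum>b\<in>Basis. \<bar>B b\<bar>)"
  have B': "B b \<le> B'" if "b \<in> Basis" for b
    using member_le_sum[OF that, of "\<lambda>b. \<bar>B b\<bar>"] by (simp add: B'_def)
  define C where "C = real DIM('v) * B'"
  have on: "onorm (frechet_derivative f (at y)) \<le> C" if y: "y \<in> cball x r" for y
    unfolding C_def
    by (intro onorm_le norm_linear_le_Basis has_derivative_bounded_linear[OF der[OF y]])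
      (use B[OF _ y] B' in \<open>auto intro: order_trans\<close>)
  have "dist (f y) (f z) \<le> C * dist y z" if "y \<in> ball x r" "z \<in> ball x r" for y z
    unfolding dist_norm
    by (rule differentiable_bound[of "ball x r" f "\<lambda>y. frechet_derivative f (at y)"])
      (use that der on in \<open>auto intro: has_derivative_at_withinI\<close>)
  moreover have "C \<ge> 0" by (auto simp: C_def B'_def intro: sum_nonneg)
  moreover have "ball x r \<subseteq> U" using r by auto
  ultimately show ?thesis using r by blast
qed

lemma Ck_on_Suc_continuous_on: "Ck_on (Suc k) U f \<Longrightarrow> continuous_on U f"
  by (auto intro!: continuous_at_imp_continuous_on differentiable_imp_continuous_within)

lemma Ck_on_Suc_imp_Ck_holder_on:
  fixes f :: "'v::euclidean_space \<Rightarrow> 'w::real_normed_vector"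
  assumes U: "open U" and s: "0 \<le> s" "s \<le> 1" and f: "Ck_on (Suc k) U f"
  shows "Ck_holder_on k s U f"
  using f
proof (induction k arbitrary: f)
  case 0
  have "locally_holder_on s U f"
    unfolding locally_holder_on_def
  proof
    fix x assume "x \<in> U"
    then obtain r C where r: "r > 0" "C \<ge> 0"
      "\<forall>y\<in>ball x r. \<forall>z\<in>ball x r. dist (f y) (f z) \<le> C * dist y z"
      using locally_lipschitz_Ck_on_1[OF U _ \<open>x \<in> U\<close>] 0 by (metis One_nat_def)
    \<comment> \<open>Within a ball of radius \<open>1/2\<close> distances are at most
      \<open>1\<close>, and there the power with exponent \<open>1\<close> is below the power with
      exponent \<open>s\<close>.\<close>
    define r' where "r' = min r (1/2)"
    have "dist (f y) (f z) \<le> C * dist y z powr s" if "y \<in> ball x r'" "z \<in> ball x r'" for y z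
    proof -
      have "dist y z \<le> 1"
        using that dist_triangle2[of y z x] by (auto simp: r'_def dist_commute)
      then have "dist y z powr 1 \<le> dist y z powr s"
        using s powr_mono'[of s 1 "dist y z"] by auto
      then have "C * dist y z \<le> C * dist y z powr s"
        using r(2) by (intro mult_left_mono) auto
      moreover have "dist (f y) (f z) \<le> C * dist y z" using r(3) that by (auto simp: r'_def)
      ultimately show ?thesis by linarith
    qed
    moreover have "r' > 0" using r by (simp add: r'_def)
    ultimately show "\<exists>r>0. \<exists>C. \<forall>y\<in>U \<inter> ball x r. \<forall>z\<in>U \<inter> ball x r.
        dist (f y) (f z) \<le> C * dist y z powr s"
      by blast
  qed
  then show ?case using Ck_on_Suc_continuous_on[OF 0] by simp
next
  case (Suc k)
  then show ?case by auto
qed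

lemma Ck_on_Suc_imp_Ck_on:
  fixes f :: "'v::euclidean_space \<Rightarrow> 'w::real_normed_vector"
  shows "Ck_on (Suc k) U f \<Longrightarrow> Ck_on k U f"
proof (induction k arbitrary: f)
  case 0
  then show ?case using Ck_on_Suc_continuous_on[OF 0] by simp
qed auto

lemma Ck_on_mono:
  assumes "k \<le> l" "Ck_on l U f"
  shows "Ck_on k U f"
  using assms by (induction rule: dec_induct) (blast dest: Ck_on_Suc_imp_Ck_on)+

text \<open>The two exponents are unrelated: one derivative given up yields local Lipschitz
  continuity and with it every exponent in \<open>[0, 1]\<close>.\<close>

lemma Ck_holder_on_Suc_imp_Ck_holder_on:
  fixes f :: "'v::euclidean_space \<Rightarrow> 'w::real_normed_vector"
  assumes "open U" "0 \<le> s" "s \<le> 1" "Ck_holder_on (Suc k) s' U f"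
  shows "Ck_holder_on k s U f"
  using assms Ck_on_Suc_imp_Ck_holder_on Ck_holder_on_imp_Ck_on by blast

lemma Ck_holder_on_mult:
  fixes f g :: "'v::euclidean_space \<Rightarrow> real"
  assumes "open U" and s: "0 \<le> s" "s \<le> 1" and "Ck_holder_on k s U f" "Ck_holder_on k s U g"
  shows "Ck_holder_on k s U (\<lambda>x. f x * g x)"
  using assms(4,5)
proof (induction k arbitrary: f g)
  case 0
  have bdd: "\<exists>r>0. \<forall>y\<in>U \<inter> ball x r. \<bar>h y\<bar> \<le> \<bar>h x\<bar> + 1" if h: "continuous_on U h" and x: "x \<in> U" for h :: "'v \<Rightarrow> real" and x
  proof -
    obtain r where "r > 0" "\<And>y. y \<in> U \<Longrightarrow> dist y x < r \<Longrightarrow> dist (h y) (h x) < 1"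
      using h[unfolded continuous_on_iff, rule_format, OF x, of 1] by auto
    then show ?thesis
      by (intro exI[of _ r]) (force simp: dist_real_def dist_commute)
  qed
  have "locally_holder_on s U (\<lambda>x. f x * g x)"
    unfolding locally_holder_on_def
  proof
    fix x assume x: "x \<in> U"
    obtain r1 C1 where r1: "r1 > 0" "\<forall>y\<in>U \<inter> ball x r1. \<forall>z\<in>U \<inter> ball x r1.
        dist (f y) (f z) \<le> C1 * dist y z powr s"
      using locally_holder_onD[of s U f x] 0 x by auto
    obtain r2 C2 where r2: "r2 > 0" "\<forall>y\<in>U \<inter> ball x r2. \<forall>z\<in>U \<inter> ball x r2.
        dist (g y) (g z) \<le> C2 * dist y z powr s"
      using locally_holder_onD[of s U g x] 0 x by auto
    obtain r3 where r3: "r3 > 0" "\<forall>y\<in>U \<inter> ball x r3. \<bar>f y\<bar> \<le> \<bar>f x\<bar> + 1" using bdd[of f x] 0 x by auto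
    obtain r4 where r4: "r4 > 0" "\<forall>y\<in>U \<inter> ball x r4. \<bar>g y\<bar> \<le> \<bar>g x\<bar> + 1" using bdd[of g x] 0 x by auto
    define r where "r = min (min r1 r2) (min r3 r4)"
    have "dist (f y * g y) (f z * g z)
        \<le> ((\<bar>f x\<bar> + 1) * C2 + C1 * (\<bar>g x\<bar> + 1)) * dist y z powr s"
      if yz: "y \<in> U \<inter> ball x r" "z \<in> U \<inter> ball x r" for y z
    proof -
      have "f y * g y - f z * g z = f y * (g y - g z) + (f y - f z) * g z" by (simp add: algebra_simps)
      then have "\<bar>f y * g y - f z * g z\<bar> \<le> \<bar>f y\<bar> * \<bar>g y - g z\<bar> + \<bar>f y - f z\<bar> * \<bar>g z\<bar>"
        by (metis abs_mult abs_triangle_ineq)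
      also have "\<bar>f y\<bar> * \<bar>g y - g z\<bar> \<le> (\<bar>f x\<bar> + 1) * (C2 * dist y z powr s)"
        using yz r2 r3 by (intro mult_mono) (auto simp: r_def dist_real_def)
      also have "\<bar>f y - f z\<bar> * \<bar>g z\<bar> \<le> (C1 * dist y z powr s) * (\<bar>g x\<bar> + 1)"
      proof (intro mult_mono)
        show "\<bar>f y - f z\<bar> \<le> C1 * dist y z powr s" using yz r1 by (auto simp: r_def dist_real_def)
        then show "0 \<le> C1 * dist y z powr s" by linarith
      qed (use yz r4 in \<open>auto simp: r_def\<close>)
      finally show ?thesis by (simp add: dist_real_def algebra_simps)
    qed
    moreover have "r > 0" using r1 r2 r3 r4 by (simp add: r_def)
    ultimately show "\<exists>r>0. \<exists>C. \<forall>y\<in>U \<inter> ball x r. \<forall>z\<in>U \<inter> ball x r.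
        dist (f y * g y) (f z * g z) \<le> C * dist y z powr s"
      by blast
  qed
  then show ?case using 0 by (auto intro: continuous_on_mult)
next
  case (Suc k)
  \<comment> \<open>The product rule leaves one factor undifferentiated, so \<open>f\<close> and
    \<open>g\<close> themselves have to enter the induction hypothesis one order lower.\<close>
  have fg: "Ck_holder_on k s U f" "Ck_holder_on k s U g"
    using Suc.prems assms Ck_holder_on_Suc_imp_Ck_holder_on by blast+
  have "Ck_holder_on k s U (\<lambda>x. frechet_derivative (\<lambda>x. f x * g x) (at x) b)" if b: "b \<in> Basis" for b
  proof (rule Ck_holder_on_cong[OF assms(1)])
    show "Ck_holder_on k s U (\<lambda>x. f x * frechet_derivative g (at x) b
        + frechet_derivative f (at x) b * g x)"
      using Suc.prems b fg by (intro Ck_holder_on_add[OF assms(1)] Suc.IH) auto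
  qed (use Suc.prems in \<open>auto simp: frechet_derivative_mult_at\<close>)
  then show ?case using Suc.prems by auto
qed

lemma Ck_holder_on_sum:
  assumes "open U" "finite I" "\<And>i. i \<in> I \<Longrightarrow> Ck_holder_on k s U (f i)"
  shows "Ck_holder_on k s U (\<lambda>x. \<Sum>i\<in>I. f i x)"
  using assms(2,3) by (induction rule: finite_induct)
    (auto simp: Ck_holder_on_const intro!: Ck_holder_on_add[OF assms(1)])

lemma Ck_holder_on_prod:
  fixes f :: "'i \<Rightarrow> 'v::euclidean_space \<Rightarrow> real"
  assumes "open U" "0 \<le> s" "s \<le> 1" "finite I" "\<And>i. i \<in> I \<Longrightarrow> Ck_holder_on k s U (f i)"
  shows "Ck_holder_on k s U (\<lambda>x. \<Prod>i\<in>I. f i x)"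
  using assms(4,5) by (induction rule: finite_induct)
    (auto simp: Ck_holder_on_const intro!: Ck_holder_on_mult[OF assms(1-3)])

lemma Ck_on_bounded_linear_comp:
  fixes f :: "'v::euclidean_space \<Rightarrow> 'w::real_normed_vector"
  assumes U: "open U" and h: "bounded_linear h" and f: "Ck_on k U f"
  shows "Ck_on k U (\<lambda>x. h (f x))"
  using f
proof (induction k arbitrary: f)
  case 0
  then show ?case
    using bounded_linear.continuous_on[OF h] by simp
next
  case (Suc k)
  have der: "((\<lambda>x. h (f x)) has_derivative (\<lambda>v. h (frechet_derivative f (at x) v))) (at x)" if "x \<in> U" for x
    using Suc.prems that
    by (intro bounded_linear.has_derivative[OF h]) (auto simp: frechet_derivative_works[symmetric])
  have "Ck_on k U (\<lambda>x. frechet_derivative (\<lambda>x. h (f x)) (at x) b)" if "b \<in> Basis" for b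
    unfolding Ck_on_iff_Ck_holder_on_0
    by (rule Ck_holder_on_cong[OF U, of _ _ "\<lambda>x. h (frechet_derivative f (at x) b)"],
        unfold Ck_on_iff_Ck_holder_on_0[symmetric])
      (use Suc that in \<open>auto simp: frechet_derivative_at[OF der, symmetric]\<close>)
  then show ?case using der by (auto simp: differentiable_def)
qed

text \<open>The inner map has one derivative more than \<open>f\<close>: the chain rule multiplies
  by first derivatives of \<open>\<phi>\<close>, which must again be of class
  \<open>C^{k,s}\<close>, and at order \<open>0\<close> a Hoelder bound survives composition with a
  locally Lipschitz map.\<close>

lemma Ck_holder_on_compose:
  fixes f :: "'w::euclidean_space \<Rightarrow> real" and \<phi> :: "'v::euclidean_space \<Rightarrow> 'w"
  assumes U: "open U" and V: "open V" and s: "0 \<le> s" "s \<le> 1" and im: "\<phi> ` V \<subseteq> U"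
    and f: "Ck_holder_on k s U f" and \<phi>: "Ck_on (Suc k) V \<phi>"
  shows "Ck_holder_on k s V (\<lambda>x. f (\<phi> x))"
  using f \<phi>
proof (induction k arbitrary: f)
  case 0
  have "locally_holder_on s V (\<lambda>x. f (\<phi> x))"
    unfolding locally_holder_on_def
  proof
    fix x assume x: "x \<in> V"
    then obtain r C where r: "r > 0" "\<forall>y\<in>U \<inter> ball (\<phi> x) r. \<forall>z\<in>U \<inter> ball (\<phi> x) r.
        dist (f y) (f z) \<le> C * dist y z powr s"
      using locally_holder_onD[of s U f "\<phi> x"] 0(1) im by auto
    obtain q L where q: "q > 0" "L \<ge> 0" "ball x q \<subseteq> V"
      "\<forall>y\<in>ball x q. \<forall>z\<in>ball x q. dist (\<phi> y) (\<phi> z) \<le> L * dist y z"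
      using locally_lipschitz_Ck_on_1[OF V _ x, of \<phi>] 0 by (metis One_nat_def)
    \<comment> \<open>Makes \<open>\<phi>\<close> map the ball of radius \<open>q'\<close> into the
      ball of radius \<open>r\<close>; \<open>L + 1\<close> replaces \<open>L\<close> because
      \<open>L\<close> may be \<open>0\<close>.\<close>
    define q' where "q' = min q (r / (L + 1))"
    have q': "q' > 0" using r q by (simp add: q'_def)
    have b: "\<phi> y \<in> U \<inter> ball (\<phi> x) r" if "y \<in> ball x q'" for y
    proof -
      have "dist (\<phi> x) (\<phi> y) \<le> L * dist x y" using q that by (auto simp: q'_def)
      also have "\<dots> \<le> (L + 1) * dist x y" by (simp add: algebra_simps)
      also have "\<dots> < (L + 1) * (r / (L + 1))"
        using that q by (intro mult_strict_left_mono) (auto simp: q'_def)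
      also have "\<dots> = r" using q by simp
      finally have "\<phi> y \<in> ball (\<phi> x) r" by simp
      moreover have "y \<in> V" using that q by (auto simp: q'_def subset_iff)
      ultimately show ?thesis using im by blast
    qed
    have "dist (f (\<phi> y)) (f (\<phi> z)) \<le> (\<bar>C\<bar> * L powr s) * dist y z powr s"
      if "y \<in> V \<inter> ball x q'" "z \<in> V \<inter> ball x q'" for y z
    proof -
      have "dist (f (\<phi> y)) (f (\<phi> z)) \<le> C * dist (\<phi> y) (\<phi> z) powr s"
        using b that r by auto
      also have "\<dots> \<le> \<bar>C\<bar> * (L * dist y z) powr s"
        using that q s by (intro mult_mono powr_mono2) (auto simp: q'_def)
      finally show ?thesis using q by (simp add: powr_mult)
    qed
    with q' show "\<exists>r>0. \<exists>C. \<forall>y\<in>V \<inter> ball x r. \<forall>z\<in>V \<inter> ball x r.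
        dist (f (\<phi> y)) (f (\<phi> z)) \<le> C * dist y z powr s"
      by blast
  qed
  moreover have "continuous_on V (\<lambda>x. f (\<phi> x))"
    using 0 im Ck_on_Suc_continuous_on[of 0 V \<phi>]
    by (auto intro: continuous_on_compose2[of U f V \<phi>])
  ultimately show ?case by simp
next
  case (Suc k)
  have d\<phi>: "(\<phi> has_derivative frechet_derivative \<phi> (at x)) (at x)" if "x \<in> V" for x
    using Suc.prems that by (auto simp: frechet_derivative_works[symmetric])
  have df: "(f has_derivative frechet_derivative f (at (\<phi> x))) (at (\<phi> x))" if "x \<in> V" for x
    using Suc.prems that im by (auto simp: frechet_derivative_works[symmetric])
  have der: "((\<lambda>x. f (\<phi> x)) has_derivative
      (\<lambda>v. frechet_derivative f (at (\<phi> x)) (frechet_derivative \<phi> (at x) v))) (at x)" if "x \<in> V" for x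
    using has_derivative_compose[OF d\<phi> df] that by blast
  have "Ck_holder_on k s V (\<lambda>x. frechet_derivative (\<lambda>x. f (\<phi> x)) (at x) b)" if b: "b \<in> Basis" for b
  proof (rule Ck_holder_on_cong[OF V])
    show "Ck_holder_on k s V (\<lambda>x. \<Sum>c\<in>Basis. (frechet_derivative \<phi> (at x) b \<bullet> c)
        * frechet_derivative f (at (\<phi> x)) c)"
    proof (intro Ck_holder_on_sum Ck_holder_on_mult V s)
      fix c :: 'w assume c: "c \<in> Basis"
      have "Ck_on (Suc k) V (\<lambda>x. frechet_derivative \<phi> (at x) b)" using Suc.prems b by simp
      then have "Ck_on (Suc k) V (\<lambda>x. frechet_derivative \<phi> (at x) b \<bullet> c)"
        by (rule Ck_on_bounded_linear_comp[OF V bounded_linear_inner_left])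
      then show "Ck_holder_on k s V (\<lambda>x. frechet_derivative \<phi> (at x) b \<bullet> c)"
        by (rule Ck_on_Suc_imp_Ck_holder_on[OF V s])
      show "Ck_holder_on k s V (\<lambda>x. frechet_derivative f (at (\<phi> x)) c)"
        using Suc.prems(1) c Ck_on_Suc_imp_Ck_on[OF Suc.prems(2)] by (intro Suc.IH) auto
    qed simp
    fix x assume x: "x \<in> V"
    interpret bounded_linear "frechet_derivative f (at (\<phi> x))"
      using df[OF x] has_derivative_bounded_linear by blast
    show "(\<Sum>c\<in>Basis. (frechet_derivative \<phi> (at x) b \<bullet> c) * frechet_derivative f (at (\<phi> x)) c)
       = frechet_derivative (\<lambda>x. f (\<phi> x)) (at x) b"
      using arg_cong[OF euclidean_representation[of "frechet_derivative \<phi> (at x) b"],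
          of "frechet_derivative f (at (\<phi> x))"]
      by (simp add: sum scale frechet_derivative_at[OF der[OF x], symmetric])
  qed
  then show ?case using der by (auto simp: differentiable_def)
qed

lemma Ck_on_inverse:
  fixes f :: "'v::euclidean_space \<Rightarrow> real"
  assumes U: "open U" and nz: "\<And>x. x \<in> U \<Longrightarrow> f x \<noteq> 0" and f: "Ck_on k U f"
  shows "Ck_on k U (\<lambda>x. inverse (f x))"
  using f
proof (induction k)
  case 0
  then show ?case using nz by (auto intro: continuous_on_inverse)
next
  case (Suc k)
  have inv: "Ck_holder_on k 0 U (\<lambda>x. inverse (f x))"
    using Suc Ck_on_Suc_imp_Ck_on Ck_on_iff_Ck_holder_on_0 by blast
  have der: "((\<lambda>x. inverse (f x)) has_derivative
      (\<lambda>v. - (inverse (f x) * frechet_derivative f (at x) v * inverse (f x)))) (at x)" if "x \<in> U" for x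
    using Suc.prems that nz
    by (intro Deriv.has_derivative_inverse) (auto simp: frechet_derivative_works[symmetric])
  have "Ck_on k U (\<lambda>x. frechet_derivative (\<lambda>x. inverse (f x)) (at x) b)" if b: "b \<in> Basis" for b
    unfolding Ck_on_iff_Ck_holder_on_0
  proof (rule Ck_holder_on_cong[OF U])
    show "Ck_holder_on k 0 U (\<lambda>x. (-1) * (inverse (f x) * frechet_derivative f (at x) b * inverse (f x)))"
      using Suc.prems b
      by (intro Ck_holder_on_mult Ck_holder_on_const U inv) (auto simp: Ck_on_iff_Ck_holder_on_0)
  qed (simp add: frechet_derivative_at[OF der, symmetric])
  then show ?case using der by (auto simp: differentiable_def)
qed

section \<open>Series of rescaled functions\<close>

text \<open>Derivatives of order \<open>j\<close> are bounded by \<open>A * \<mu> ^ j\<close>. This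
  shape is kept by the two operations that generate the series: multiplication by a constant changes
  only \<open>A\<close>, dilation of the argument only \<open>\<mu>\<close>.\<close>

primrec Ck_bounded_on :: "nat \<Rightarrow> real \<Rightarrow> real \<Rightarrow> 'v::euclidean_space set \<Rightarrow> ('v \<Rightarrow> real) \<Rightarrow> bool" where
  "Ck_bounded_on 0 A \<mu> U f \<longleftrightarrow> (\<forall>x\<in>U. \<bar>f x\<bar> \<le> A)"
| "Ck_bounded_on (Suc k) A \<mu> U f \<longleftrightarrow> (\<forall>x\<in>U. \<bar>f x\<bar> \<le> A) \<and> (\<forall>x\<in>U. f differentiable (at x)) \<and>
     (\<forall>b\<in>Basis. Ck_bounded_on k (A * \<mu>) \<mu> U (\<lambda>x. frechet_derivative f (at x) b))"

lemma Ck_bounded_on_bound: "Ck_bounded_on k A \<mu> U f \<Longrightarrow> x \<in> U \<Longrightarrow> \<bar>f x\<bar> \<le> A"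
  by (cases k) auto

text \<open>Allows a sum of copies with separated supports to be estimated by a single copy near
  each point.\<close>

lemma Ck_bounded_on_locally:
  assumes "\<And>x. x \<in> U \<Longrightarrow> \<exists>V. open V \<and> x \<in> V \<and> Ck_bounded_on k A \<mu> V f"
  shows "Ck_bounded_on k A \<mu> U f"
  using assms
proof (induction k arbitrary: f A)
  case 0
  then show ?case unfolding Ck_bounded_on.simps by blast
next
  case (Suc k)
  have "\<bar>f x\<bar> \<le> A" "f differentiable (at x)" if "x \<in> U" for x
    using Suc.prems[OF that] unfolding Ck_bounded_on.simps by blast+
  moreover have "Ck_bounded_on k (A * \<mu>) \<mu> U (\<lambda>x. frechet_derivative f (at x) b)" if "b \<in> Basis" for b
  proof (rule Suc.IH)
    fix x assume "x \<in> U"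
    then show "\<exists>V. open V \<and> x \<in> V \<and> Ck_bounded_on k (A * \<mu>) \<mu> V (\<lambda>x. frechet_derivative f (at x) b)"
      using Suc.prems[of x] that unfolding Ck_bounded_on.simps by blast
  qed
  ultimately show ?case by auto
qed

lemma Ck_bounded_on_subset:
  assumes "Ck_bounded_on k A \<mu> U f" "V \<subseteq> U"
  shows "Ck_bounded_on k A \<mu> V f"
  using assms by (induction k arbitrary: f A) (auto simp: subset_iff)

lemma Ck_bounded_on_cong:
  assumes "open U" "Ck_bounded_on k A \<mu> U f" "\<And>x. x \<in> U \<Longrightarrow> f x = g x"
  shows "Ck_bounded_on k A \<mu> U g"
  using assms(2,3)
proof (induction k arbitrary: f g A)
  case (Suc k)
  have fd: "frechet_derivative f (at x) = frechet_derivative g (at x)" if "x \<in> U" for x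
    using Suc.prems that assms(1) by (intro frechet_derivative_transform_within_open) auto
  have "g differentiable (at x)" if "x \<in> U" for x
    using Suc.prems that assms(1)
    by (meson Ck_bounded_on.simps(2) differentiable_def has_derivative_transform_within_open)
  moreover have "Ck_bounded_on k (A * \<mu>) \<mu> U (\<lambda>x. frechet_derivative g (at x) b)" if "b \<in> Basis" for b
    by (rule Suc.IH[of _ "\<lambda>x. frechet_derivative f (at x) b"]) (use Suc.prems that fd in auto)
  moreover have "\<bar>g x\<bar> \<le> A" if "x \<in> U" for x
    using Suc.prems that by force
  ultimately show ?case by auto
qed auto

lemma Ck_bounded_on_mono:
  assumes "Ck_bounded_on k A \<mu> U f" "A \<le> B" "0 \<le> \<mu>"
  shows "Ck_bounded_on k B \<mu> U f"
  using assms(1,2)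
proof (induction k arbitrary: f A B)
  case (Suc k)
  have "A * \<mu> \<le> B * \<mu>" using Suc.prems(2) assms(3) by (rule mult_right_mono)
  then have "Ck_bounded_on k (B * \<mu>) \<mu> U (\<lambda>x. frechet_derivative f (at x) b)" if "b \<in> Basis" for b
    using Suc.prems(1) Suc.IH that by auto
  then show ?case using Suc.prems by (auto intro: order_trans)
qed (auto intro: order_trans)

lemma Ck_bounded_on_scale:
  assumes U: "open U" and "Ck_bounded_on k A \<mu> U f"
  shows "Ck_bounded_on k (\<bar>c\<bar> * A) \<mu> U (\<lambda>x. c * f x)"
  using assms(2)
proof (induction k arbitrary: f A)
  case 0
  then show ?case by (auto simp: abs_mult intro: mult_left_mono)
next
  case (Suc k)
  have der: "((\<lambda>x. c * f x) has_derivative (\<lambda>v. c * frechet_derivative f (at x) v)) (at x)" if "x \<in> U" for x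
    using Suc.prems that
    by (intro has_derivative_mult_right) (auto simp: frechet_derivative_works[symmetric])
  have "Ck_bounded_on k (\<bar>c\<bar> * A * \<mu>) \<mu> U (\<lambda>x. frechet_derivative (\<lambda>x. c * f x) (at x) b)"
    if b: "b \<in> Basis" for b
  proof (rule Ck_bounded_on_cong[OF U])
    show "Ck_bounded_on k (\<bar>c\<bar> * A * \<mu>) \<mu> U (\<lambda>x. c * frechet_derivative f (at x) b)"
      using Suc.IH[of "A * \<mu>" "\<lambda>x. frechet_derivative f (at x) b"] Suc.prems b
      by (simp add: mult.assoc)
  qed (simp add: frechet_derivative_at[OF der, symmetric])
  moreover have "\<bar>c * f x\<bar> \<le> \<bar>c\<bar> * A" if "x \<in> U" for x
    using Suc.prems that by (auto simp: abs_mult intro: mult_left_mono)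
  ultimately show ?case using der by (auto simp: differentiable_def)
qed

lemma Ck_bounded_on_dilation:
  fixes f :: "'v::euclidean_space \<Rightarrow> real"
  assumes a: "a > 0" and "Ck_bounded_on k A \<mu> UNIV f"
  shows "Ck_bounded_on k A (a * \<mu>) UNIV (\<lambda>x. f (a *\<^sub>R (x - p)))"
  using assms(2)
proof (induction k arbitrary: f A)
  case (Suc k)
  have der: "((\<lambda>x. f (a *\<^sub>R (x - p))) has_derivative
      (\<lambda>v. frechet_derivative f (at (a *\<^sub>R (x - p))) (a *\<^sub>R v))) (at x)" for x
  proof -
    have 1: "((\<lambda>x. a *\<^sub>R (x - p)) has_derivative (\<lambda>v. a *\<^sub>R v)) (at x)"
      by (auto intro!: derivative_eq_intros)
    have 2: "(f has_derivative frechet_derivative f (at (a *\<^sub>R (x - p)))) (at (a *\<^sub>R (x - p)))"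
      using Suc.prems by (auto simp: frechet_derivative_works[symmetric])
    show ?thesis by (rule has_derivative_compose[OF 1 2])
  qed
  have "Ck_bounded_on k (A * (a * \<mu>)) (a * \<mu>) UNIV
      (\<lambda>x. frechet_derivative (\<lambda>x. f (a *\<^sub>R (x - p))) (at x) b)"
    if b: "b \<in> Basis" for b
  proof (rule Ck_bounded_on_cong[OF open_UNIV])
    have "Ck_bounded_on k (A * \<mu>) (a * \<mu>) UNIV (\<lambda>x. frechet_derivative f (at (a *\<^sub>R (x - p))) b)"
      using Suc.prems b by (intro Suc.IH[of _ "\<lambda>x. frechet_derivative f (at x) b"]) auto
    from Ck_bounded_on_scale[OF open_UNIV this, of a] a
    show "Ck_bounded_on k (A * (a * \<mu>)) (a * \<mu>) UNIV
        (\<lambda>x. a * frechet_derivative f (at (a *\<^sub>R (x - p))) b)"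
      by (simp add: mult_ac)
    fix x
    interpret bounded_linear "frechet_derivative f (at (a *\<^sub>R (x - p)))"
      using Suc.prems by (auto simp: frechet_derivative_works intro: has_derivative_bounded_linear)
    show "a * frechet_derivative f (at (a *\<^sub>R (x - p))) b
        = frechet_derivative (\<lambda>x. f (a *\<^sub>R (x - p))) (at x) b"
      by (simp add: frechet_derivative_at[OF der, symmetric] scale)
  qed
  then show ?case using der Suc.prems by (auto simp: differentiable_def)
qed simp

text \<open>The derivatives vanish outside the same ball, so each is bounded; with
  \<open>\<mu> = 1\<close> all these bounds merge into one constant.\<close>

lemma Ck_bounded_on_compact_support:
  fixes f :: "'v::euclidean_space \<Rightarrow> real"
  assumes "Ck_on k UNIV f" "\<And>x. norm x > r \<Longrightarrow> f x = 0"
  shows "\<exists>A\<ge>0. Ck_bounded_on k A 1 UNIV f"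
  using assms
proof (induction k arbitrary: f)
  have bdd: "\<exists>A\<ge>0. \<forall>x. \<bar>f x\<bar> \<le> A" if "continuous_on UNIV f" "\<And>x. norm x > r \<Longrightarrow> f x = 0" for f :: "'v \<Rightarrow> real"
  proof -
    have "bounded (f ` cball 0 r)"
      using that by (intro compact_imp_bounded compact_continuous_image compact_cball)
        (auto intro: continuous_on_subset)
    then obtain A where "\<forall>x\<in>cball 0 r. \<bar>f x\<bar> \<le> A" by (auto simp: bounded_iff)
    then have "\<bar>f x\<bar> \<le> max A 0" for x
      using that(2)[of x] by (cases "norm x > r") (auto simp: le_max_iff_disj)
    then show ?thesis by (intro exI[of _ "max A 0"]) auto
  qed
  {
    case 0
    then show ?case using bdd[of f] by auto
  next
    case (Suc k)
    obtain A where A: "A \<ge> 0" "\<And>x. \<bar>f x\<bar> \<le> A"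
      using bdd[OF Ck_on_Suc_continuous_on[OF Suc.prems(1)] Suc.prems(2)] by auto
    have "\<exists>A\<ge>0. Ck_bounded_on k A 1 UNIV (\<lambda>x. frechet_derivative f (at x) b)" if b: "b \<in> Basis" for b
    proof (rule Suc.IH)
      fix x :: 'v assume x: "norm x > r"
      have "frechet_derivative (\<lambda>x. 0) (at x) = frechet_derivative f (at x)"
        by (rule frechet_derivative_transform_within_open[of _ _ "- cball 0 r"])
          (use x Suc.prems in \<open>auto simp: open_Compl\<close>)
      then show "frechet_derivative f (at x) b = 0" by (metis frechet_derivative_const)
    qed (use Suc.prems b in auto)
    then obtain B where B: "\<And>b. b \<in> Basis \<Longrightarrow> B b \<ge> 0"
      "\<And>b. b \<in> Basis \<Longrightarrow> Ck_bounded_on k (B b) 1 UNIV (\<lambda>x. frechet_derivative f (at x) b)"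
      by metis
    define C where "C = A + (\<Sum>b\<in>Basis. B b)"
    have "B b \<le> C" if "b \<in> Basis" for b
      using member_le_sum[of b Basis B] that A B by (auto simp: C_def)
    then have "Ck_bounded_on k C 1 UNIV (\<lambda>x. frechet_derivative f (at x) b)" if "b \<in> Basis" for b
      using B that Ck_bounded_on_mono by (metis zero_le_one)
    moreover have "A \<le> C" using B by (auto simp: C_def intro: sum_nonneg)
    ultimately have "Ck_bounded_on (Suc k) C 1 UNIV f" "C \<ge> 0"
      using A Suc.prems by (auto intro: order_trans)
    then show ?case by blast
  }
qed

text \<open>The order of differentiability lost here pays for the Hoelder estimate, by interpolating
  between the bounds for the terms and for their gradients.\<close>

lemma Ck_holder_on_suminf:
  fixes T :: "nat \<Rightarrow> 'v::euclidean_space \<Rightarrow> real"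
  assumes "\<And>n. Ck_bounded_on (Suc k) (A * \<theta> ^ n) (\<mu> ^ n) UNIV (T n)"
    and "0 \<le> A" "0 \<le> \<theta>" "1 \<le> \<mu>" "0 \<le> s" "s \<le> 1" "\<theta> * \<mu> powr (real k + s) < 1"
  shows "Ck_holder_on k s UNIV (\<lambda>x. \<Sum>n. T n x)"
  using assms(1,3,7)
proof (induction k arbitrary: T \<theta>)
  case (0 T \<theta>)
  define D where "D = real DIM('v) * A"
  have D: "D \<ge> A" "D \<ge> 0"
    using \<open>0 \<le> A\<close> DIM_positive[where 'a='v] mult_right_mono[of 1 "real DIM('v)" A] by (auto simp: D_def Suc_le_eq)
  have \<theta>: "\<theta> * \<mu> powr s < 1" using 0 by simp
  have "1 \<le> \<mu> powr s" using \<open>1 \<le> \<mu>\<close> \<open>0 \<le> s\<close> ge_one_powr_ge_zero by blast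
  then have "\<theta> * 1 \<le> \<theta> * \<mu> powr s" using 0 by (intro mult_left_mono) auto
  then have "\<theta> < 1" using \<theta> by simp
  have bd: "\<bar>T n x\<bar> \<le> A * \<theta> ^ n" for n x using 0(1)[of n] by auto
  have sT: "summable (\<lambda>n. T n x)" for x
    by (rule summable_comparison_test'[of "\<lambda>n. A * \<theta> ^ n" 0])
      (use bd \<open>\<theta> < 1\<close> 0 in \<open>auto intro!: summable_mult summable_geometric\<close>)
  have lip: "\<bar>T n x - T n y\<bar> \<le> D * \<theta> ^ n * (\<mu> ^ n * dist x y)" for n x y
  proof -
    have "norm (T n x - T n y) \<le> (D * \<theta> ^ n * \<mu> ^ n) * norm (x - y)"
    proof (rule differentiable_bound[of UNIV "T n" "\<lambda>x. frechet_derivative (T n) (at x)"])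
      fix x
      have Td: "(T n has_derivative frechet_derivative (T n) (at x)) (at x)"
        using 0(1)[of n] by (auto simp: frechet_derivative_works[symmetric])
      then show "(T n has_derivative frechet_derivative (T n) (at x)) (at x within UNIV)" by simp
      have "norm (frechet_derivative (T n) (at x) v) \<le> real DIM('v) * (A * \<theta> ^ n * \<mu> ^ n) * norm v" for v
        using norm_linear_le_Basis[OF has_derivative_bounded_linear[OF Td], of "A * \<theta> ^ n * \<mu> ^ n" v] 0(1)[of n]
        by simp
      then show "onorm (frechet_derivative (T n) (at x)) \<le> D * \<theta> ^ n * \<mu> ^ n"
        by (intro onorm_le) (simp add: D_def mult_ac)
    qed auto
    then show ?thesis by (simp add: dist_norm mult_ac)
  qed
  have hol: "\<bar>T n x - T n y\<bar> \<le> 2 * D * dist x y powr s * (\<theta> * \<mu> powr s) ^ n" for n x y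
  proof (cases "x = y")
    case False
    \<comment> \<open>The distance in units of the length \<open>1 / \<mu> ^ n\<close> on which
      \<open>T n\<close> varies. The gradient bound serves for \<open>h \<le> 1\<close> and the
      bound on the values for \<open>h > 1\<close>; in either case the outcome is dominated by
      \<open>h powr s\<close>.\<close>
    define h where "h = \<mu> ^ n * dist x y"
    have h: "h > 0" using False \<open>1 \<le> \<mu>\<close> by (simp add: h_def)
    have nn: "0 \<le> D * \<theta> ^ n" using D 0 by simp
    have "\<bar>T n x - T n y\<bar> \<le> 2 * (D * \<theta> ^ n) * h powr s"
    proof (cases "h \<le> 1")
      case True
      then have "h powr 1 \<le> h powr s" using h \<open>s \<le> 1\<close> by (intro powr_mono') auto
      then have "D * \<theta> ^ n * h \<le> D * \<theta> ^ n * h powr s" using nn h by (intro mult_left_mono) auto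
      moreover have "\<bar>T n x - T n y\<bar> \<le> D * \<theta> ^ n * h" using lip[of n x y] by (simp add: h_def)
      moreover have "0 \<le> D * \<theta> ^ n * h powr s" using nn by simp
      ultimately show ?thesis by linarith
    next
      case False
      then have "1 \<le> h powr s" using \<open>0 \<le> s\<close> by (intro ge_one_powr_ge_zero) auto
      then have "2 * (D * \<theta> ^ n) * 1 \<le> 2 * (D * \<theta> ^ n) * h powr s" using nn by (intro mult_left_mono) auto
      moreover have "A * \<theta> ^ n \<le> D * \<theta> ^ n" using D 0 by (intro mult_right_mono) auto
      ultimately show ?thesis using bd[of n x] bd[of n y] by linarith
    qed
    also have "h powr s = (\<mu> powr s) ^ n * dist x y powr s"
    proof -
      have "(\<mu> ^ n) powr s = \<mu> powr (real n * s)"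
        using \<open>1 \<le> \<mu>\<close> powr_realpow[of \<mu> n] powr_powr[of \<mu> "real n" s] by simp
      also have "\<dots> = (\<mu> powr s) ^ n"
        using \<open>1 \<le> \<mu>\<close> powr_realpow[of "\<mu> powr s" n] powr_powr[of \<mu> s "real n"] by (simp add: mult.commute)
      finally show ?thesis using \<open>1 \<le> \<mu>\<close> by (simp add: h_def powr_mult)
    qed
    finally show ?thesis by (simp add: power_mult_distrib mult_ac)
  qed simp
  define C where "C = 2 * D * (\<Sum>n. (\<theta> * \<mu> powr s) ^ n)"
  have geo: "summable (\<lambda>n. (\<theta> * \<mu> powr s) ^ n)" using \<theta> 0 by (intro summable_geometric) simp
  have "dist (\<Sum>n. T n x) (\<Sum>n. T n y) \<le> C * dist x y powr s" for x y
  proof -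
    have "(\<Sum>n. T n x) - (\<Sum>n. T n y) = (\<Sum>n. T n x - T n y)" using sT suminf_diff by metis
    also have "norm \<dots> \<le> (\<Sum>n. 2 * D * dist x y powr s * (\<theta> * \<mu> powr s) ^ n)"
      by (rule norm_suminf_le) (use hol geo in \<open>auto intro: summable_mult\<close>) 
    also have "\<dots> = C * dist x y powr s"
      using suminf_mult[OF geo, of "2 * D * dist x y powr s"] by (simp add: C_def mult_ac)
    finally show ?thesis by (simp add: dist_norm)
  qed
  then have "locally_holder_on s UNIV (\<lambda>x. \<Sum>n. T n x)"
    unfolding locally_holder_on_def by (intro ballI exI[of _ 1] conjI exI[of _ C]) auto
  moreover have "continuous_on UNIV (\<lambda>x. \<Sum>n. T n x)"
  proof (rule uniform_limit_theorem[OF _ Weierstrass_m_test[of _ T "\<lambda>n. A * \<theta> ^ n"]])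
    have "continuous_on UNIV (T n)" for n
      using 0(1)[of n] by (auto intro!: continuous_at_imp_continuous_on differentiable_imp_continuous_within)
    then show "\<forall>\<^sub>F n in sequentially. continuous_on UNIV (\<lambda>x. \<Sum>i<n. T i x)"
      by (intro always_eventually allI continuous_on_sum) auto
    show "summable (\<lambda>n. A * \<theta> ^ n)"
      using \<open>\<theta> < 1\<close> 0 by (intro summable_mult summable_geometric) auto
  qed (use bd in auto)
  ultimately show ?case by simp
next
  case (Suc k T \<theta>)
  \<comment> \<open>The differentiated terms have size \<open>A * \<theta>' ^ n\<close>, and
    \<open>\<theta>' * \<mu> powr (k + s)\<close> equals the quantity assumed less than
    \<open>1\<close> for \<open>Suc k\<close>. So the induction trades one order of
    differentiability for one factor \<open>\<mu>\<close>.\<close>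
  define \<theta>' where "\<theta>' = \<theta> * \<mu>"
  have \<theta>': "0 \<le> \<theta>'" "\<theta>' * \<mu> powr (real k + s) < 1"
  proof -
    have "\<mu> powr (real (Suc k) + s) = \<mu> * \<mu> powr (real k + s)"
      using \<open>1 \<le> \<mu>\<close> powr_add[of \<mu> 1 "real k + s"] by (simp add: add_ac)
    then show "\<theta>' * \<mu> powr (real k + s) < 1" using Suc.prems by (simp add: \<theta>'_def mult_ac)
  qed (use Suc.prems \<open>1 \<le> \<mu>\<close> in \<open>simp add: \<theta>'_def\<close>)
  have "1 \<le> \<mu> powr (real k + s)" using \<open>1 \<le> \<mu>\<close> \<open>0 \<le> s\<close> by (intro ge_one_powr_ge_zero) auto
  then have "\<theta>' * 1 \<le> \<theta>' * \<mu> powr (real k + s)" using \<theta>' by (intro mult_left_mono) auto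
  then have "\<theta>' < 1" using \<theta>' by simp
  have "\<theta> * 1 \<le> \<theta>'" unfolding \<theta>'_def using Suc.prems \<open>1 \<le> \<mu>\<close> by (intro mult_left_mono) auto
  then have "\<theta> < 1" using \<open>\<theta>' < 1\<close> by simp
  have bd: "\<bar>T n x\<bar> \<le> A * \<theta> ^ n" for n x
    using Ck_bounded_on_bound[OF Suc.prems(1)] by auto
  have sT: "summable (\<lambda>n. T n x)" for x
    by (rule summable_comparison_test'[of "\<lambda>n. A * \<theta> ^ n" 0])
      (use bd \<open>\<theta> < 1\<close> Suc.prems in \<open>auto intro!: summable_mult summable_geometric\<close>)
  have Tder: "(T n has_derivative frechet_derivative (T n) (at x)) (at x)" for n x
    using Suc.prems(1)[of n] by (auto simp: frechet_derivative_works[symmetric])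
  have bdb: "Ck_bounded_on (Suc k) (A * \<theta>' ^ n) (\<mu> ^ n) UNIV (\<lambda>x. frechet_derivative (T n) (at x) b)"
    if "b \<in> Basis" for b n
    using Suc.prems(1)[of n] that by (simp add: \<theta>'_def power_mult_distrib mult.assoc)
  define M where "M n = real DIM('v) * A * \<theta>' ^ n" for n
  have sM: "summable M"
    using \<open>\<theta>' < 1\<close> \<theta>' unfolding M_def by (intro summable_mult summable_geometric) auto
  have bdv: "norm (frechet_derivative (T n) (at x) v) \<le> M n * norm v" for n x v
    using norm_linear_le_Basis[OF has_derivative_bounded_linear[OF Tder[of n x]], of "A * \<theta>' ^ n" v]
      Ck_bounded_on_bound[OF bdb] by (simp add: M_def mult.assoc)
  define G where "G x v = (\<Sum>n. frechet_derivative (T n) (at x) v)" for x v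
  have sumv: "summable (\<lambda>n. frechet_derivative (T n) (at x) v)" for x v
    by (rule summable_comparison_test'[of "\<lambda>n. M n * norm v" 0])
      (use bdv sM in \<open>auto intro: summable_mult2\<close>)
  have "\<exists>g. \<forall>x\<in>UNIV. (\<lambda>n. T n x) sums g x \<and> (g has_derivative G x) (at x within UNIV)"
  proof (rule has_derivative_series[of UNIV T "\<lambda>n x. frechet_derivative (T n) (at x)"])
    fix e :: real assume e: "e > 0"
    \<comment> \<open>The tail of the majorant series bounds the operator norm of the remainder of
      the derivatives uniformly in \<open>x\<close>, which justifies termwise
      differentiation.\<close>
    have "(\<lambda>n. suminf M - sum M {..<n}) \<longlonglongrightarrow> suminf M - suminf M"
      by (intro tendsto_diff tendsto_const summable_LIMSEQ sM)
    then have "\<forall>\<^sub>F n in sequentially. suminf M - sum M {..<n} < e"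
      using e by (auto dest: order_tendstoD(2))
    then show "\<forall>\<^sub>F n in sequentially. \<forall>x\<in>UNIV. \<forall>h.
        norm ((\<Sum>i<n. frechet_derivative (T i) (at x) h) - G x h) \<le> e * norm h"
    proof (eventually_elim, intro ballI allI)
      fix n x h assume n: "suminf M - sum M {..<n} < e"
      have sM': "summable (\<lambda>i. M (i + n))" using sM by (simp add: summable_iff_shift)
      have "norm ((\<Sum>i<n. frechet_derivative (T i) (at x) h) - G x h)
          = norm (\<Sum>i. frechet_derivative (T (i + n)) (at x) h)"
        using suminf_minus_initial_segment[OF sumv[of x h], of n] by (simp add: G_def norm_minus_commute)
      also have "\<dots> \<le> (\<Sum>i. M (i + n) * norm h)"
        by (rule norm_suminf_le) (use bdv sM' in \<open>auto intro: summable_mult2\<close>)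
      also have "\<dots> = (suminf M - sum M {..<n}) * norm h"
        using suminf_mult2[OF sM', of "norm h"] suminf_minus_initial_segment[OF sM, of n] by simp
      also have "\<dots> \<le> e * norm h" using n by (intro mult_right_mono) auto
      finally show "norm ((\<Sum>i<n. frechet_derivative (T i) (at x) h) - G x h) \<le> e * norm h" .
    qed
  qed (use Tder sT[of 0] summable_sums in auto)
  then obtain g where g: "\<And>x. (\<lambda>n. T n x) sums g x" "\<And>x. (g has_derivative G x) (at x)" by auto
  have "g = (\<lambda>x. \<Sum>n. T n x)" using g(1) sums_unique by blast
  then have der: "((\<lambda>x. \<Sum>n. T n x) has_derivative G x) (at x)" for x using g by simp
  have "Ck_holder_on k s UNIV (\<lambda>x. frechet_derivative (\<lambda>x. \<Sum>n. T n x) (at x) b)" if "b \<in> Basis" for b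
    unfolding frechet_derivative_at[OF der, symmetric] G_def
    by (rule Suc.IH[OF bdb[OF that] \<theta>'])
  then show ?case using der by (auto simp: differentiable_def)
qed

section \<open>Smooth steps and grid paths\<close>

text \<open>Cutoffs of one finite class suffice here, so powers of the positive part take the place
  of the flat exponential. Differentiation lowers the exponent by one, which drives the
  induction.\<close>

lemma Ck_on_pos_part_power: "Ck_on k UNIV (\<lambda>t::real. max 0 t ^ Suc k)"
proof (induction k)
  case 0
  then show ?case by (auto intro!: continuous_intros)
next
  case (Suc k)
  have der: "((\<lambda>t::real. max 0 t ^ Suc (Suc k)) has_derivative (\<lambda>h. h * (real (Suc (Suc k)) * max 0 t ^ Suc k))) (at t)" for t
  proof -
    consider "t < 0" | "t > 0" | "t = 0" by linarith
    then show ?thesis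
    proof cases
      case 1
      show ?thesis
        by (rule has_derivative_transform_within_open[where f = "\<lambda>_. 0" and s = "{..<0}"])
          (use 1 in auto)
    next
      case 2
      have "((\<lambda>t. t ^ Suc (Suc k)) has_derivative (\<lambda>h. h * (real (Suc (Suc k)) * max 0 t ^ Suc k))) (at t)"
        using DERIV_pow[of "Suc (Suc k)" t] 2
        by (simp add: has_field_derivative_def mult_commute_abs del: power_Suc)
      then show ?thesis
        by (rule has_derivative_transform_within_open[where f = "\<lambda>t. t ^ Suc (Suc k)" and s = "{0<..}"])
          (use 2 in auto)
    next
      case 3
      \<comment> \<open>At the corner the difference quotient is squeezed between \<open>0\<close>
        and a positive power of \<open>\<bar>h\<bar>\<close>.\<close>
      have "((\<lambda>h::real. \<bar>max 0 h ^ Suc (Suc k) / h\<bar>) \<longlongrightarrow> 0) (at 0)"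
      proof (rule tendsto_sandwich[OF always_eventually always_eventually])
        show "\<forall>h::real. 0 \<le> \<bar>max 0 h ^ Suc (Suc k) / h\<bar>" by simp
        show "\<forall>h::real. \<bar>max 0 h ^ Suc (Suc k) / h\<bar> \<le> \<bar>h\<bar> ^ Suc k"
        proof
          fix h :: real
          show "\<bar>max 0 h ^ Suc (Suc k) / h\<bar> \<le> \<bar>h\<bar> ^ Suc k"
            by (cases "h > 0") (simp add: max_def, simp add: max.absorb1 del: zero_le_power_abs power_Suc)
        qed
        have "((\<lambda>h::real. \<bar>h\<bar> ^ Suc k) \<longlongrightarrow> \<bar>0\<bar> ^ Suc k) (at 0)"
          by (intro tendsto_intros)
        then show "((\<lambda>h::real. \<bar>h\<bar> ^ Suc k) \<longlongrightarrow> 0) (at 0)" by simp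
      qed simp
      then have "((\<lambda>h::real. max 0 h ^ Suc (Suc k) / h) \<longlongrightarrow> 0) (at 0)"
        by (rule tendsto_rabs_zero_cancel)
      then have "((\<lambda>t::real. max 0 t ^ Suc (Suc k)) has_field_derivative 0) (at 0)"
        by (simp add: DERIV_def)
      then show ?thesis using 3 by (simp add: has_field_derivative_def lambda_zero)
    qed
  qed
  have "Ck_on k UNIV (\<lambda>t::real. real (Suc (Suc k)) * max 0 t ^ Suc k)"
    by (rule Ck_on_bounded_linear_comp[OF open_UNIV bounded_linear_mult_right Suc.IH])
  then show ?case
    using der by (auto simp: differentiable_def frechet_derivative_at[OF der, symmetric] simp del: power_Suc)
qed

text \<open>The quotient \<open>a / (a + b)\<close>, where \<open>a\<close> vanishes to the left of
  \<open>-\<delta>\<close>, \<open>b\<close> to the right of \<open>\<delta>\<close>, and never both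
  at once.\<close>

lemma ex_Ck_step:
  assumes "\<delta> > 0"
  shows "\<exists>\<sigma>::real \<Rightarrow> real. Ck_on k UNIV \<sigma> \<and> (\<forall>t\<le>-\<delta>. \<sigma> t = 0) \<and> (\<forall>t\<ge>\<delta>. \<sigma> t = 1)"
proof -
  define a where "a t = max 0 (t + \<delta>) ^ Suc k" for t
  define b where "b t = max 0 (\<delta> - t) ^ Suc k" for t
  define \<sigma> where "\<sigma> t = a t * inverse (a t + b t)" for t
  have lin: "Ck_on (Suc k) UNIV (\<lambda>t::real. t + \<delta>)" "Ck_on (Suc k) UNIV (\<lambda>t::real. \<delta> - t)"
  proof -
    have "Ck_on (Suc k) UNIV (\<lambda>t::real. c * t + \<delta>)" for c
      unfolding Ck_on_iff_Ck_holder_on_0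
      by (intro Ck_holder_on_add bounded_linear_Ck_holder_on bounded_linear_mult_right Ck_holder_on_const open_UNIV)
    from this[of 1] this[of "-1"]
    show "Ck_on (Suc k) UNIV (\<lambda>t::real. t + \<delta>)" "Ck_on (Suc k) UNIV (\<lambda>t::real. \<delta> - t)"
      by (simp_all del: Ck_on.simps add: algebra_simps)
  qed
  have ab: "Ck_holder_on k 0 UNIV a" "Ck_holder_on k 0 UNIV b"
    unfolding a_def b_def using Ck_on_pos_part_power[of k] lin
    by (auto intro!: Ck_holder_on_compose[where f = "\<lambda>t. max 0 t ^ Suc k" and U = UNIV]
        simp del: Ck_on.simps(2) power_Suc simp: Ck_on_iff_Ck_holder_on_0[of k])
  have pos: "a t + b t > 0" for t
  proof -
    have "a t \<ge> 0" "b t \<ge> 0" by (simp_all add: a_def b_def)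
    moreover have "a t > 0 \<or> b t > 0"
      using assms by (cases "t + \<delta> > 0") (auto simp: a_def b_def simp del: power_Suc intro!: zero_less_power)
    ultimately show ?thesis by linarith
  qed
  have "Ck_on k UNIV (\<lambda>t. inverse (a t + b t))"
    using ab pos by (intro Ck_on_inverse) (auto simp: Ck_on_iff_Ck_holder_on_0 less_imp_neq[symmetric] intro!: Ck_holder_on_add)
  then have "Ck_on k UNIV \<sigma>"
    unfolding \<sigma>_def Ck_on_iff_Ck_holder_on_0 using ab by (intro Ck_holder_on_mult) auto
  moreover have "\<sigma> t = 0" if "t \<le> -\<delta>" for t
    using that by (simp add: \<sigma>_def a_def)
  moreover have "\<sigma> t = 1" if "t \<ge> \<delta>" for t
    using that pos[of t] by (simp add: \<sigma>_def b_def)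
  ultimately show ?thesis by blast
qed

text \<open>The boustrophedon order on the integer points of a cube: each new coordinate runs once through
  its range while the old order is traversed alternately forwards and backwards.\<close>

lemma ex_grid_path:
  fixes B :: "'v::euclidean_space set"
  assumes "finite B" "B \<subseteq> Basis"
  shows "\<exists>y::nat \<Rightarrow> 'v.
    (\<forall>r<(2*n+1) ^ card B. (\<forall>b\<in>B. y r \<bullet> b \<in> \<int> \<and> \<bar>y r \<bullet> b\<bar> \<le> real n) \<and> (\<forall>b\<in>Basis-B. y r \<bullet> b = 0)) \<and>
    inj_on y {..<(2*n+1) ^ card B} \<and>
    (\<forall>r. Suc r < (2*n+1) ^ card B \<longrightarrow> (\<exists>b\<in>B. y (Suc r) = y r + b \<or> y (Suc r) = y r - b))"
  using assms
proof (induction rule: finite_induct)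
  case empty
  then show ?case by (intro exI[of _ "\<lambda>_. 0"]) (auto simp: inj_on_def)
next
  case (insert c B)
  define P where "P = (2*n+1) ^ card B"
  have P: "P > 0" by (simp add: P_def)
  have cB: "c \<in> Basis" "c \<notin> B" "B \<subseteq> Basis" using insert by auto
  obtain y where y: "\<And>r b. r < P \<Longrightarrow> b \<in> B \<Longrightarrow> y r \<bullet> b \<in> \<int> \<and> \<bar>y r \<bullet> b\<bar> \<le> real n"
      "\<And>r b. r < P \<Longrightarrow> b \<in> Basis - B \<Longrightarrow> y r \<bullet> b = 0"
    and inj: "inj_on y {..<P}"
    and adj: "\<And>r. Suc r < P \<Longrightarrow> \<exists>b\<in>B. y (Suc r) = y r + b \<or> y (Suc r) = y r - b"
    using insert.IH[OF cB(3)] unfolding P_def by auto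
  define f where "f i = (if even (i div P) then i mod P else P - 1 - i mod P)" for i
  define z where "z i = y (f i) + (real (i div P) - real n) *\<^sub>R c" for i
  have f: "f i < P" for i using P by (simp add: f_def)
  have card: "(2*n+1) ^ card (insert c B) = (2*n+1) * P" using insert by (simp add: P_def)
  have q: "i div P \<le> 2 * n" if "i < (2*n+1) * P" for i
    using that P by (simp add: div_less_iff_less_mult less_Suc_eq_le[symmetric] mult.commute)
  have zc: "z i \<bullet> c = real (i div P) - real n" for i
    using y(2)[OF f, of c i] cB by (simp add: z_def inner_add_left)
  have zb: "z i \<bullet> b = y (f i) \<bullet> b" if "b \<in> Basis" "b \<noteq> c" for i b
    using that cB by (simp add: z_def inner_add_left inner_not_same_Basis)
  have "\<forall>r<(2*n+1) * P. (\<forall>b\<in>insert c B. z r \<bullet> b \<in> \<int> \<and> \<bar>z r \<bullet> b\<bar> \<le> real n) \<and>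
      (\<forall>b\<in>Basis - insert c B. z r \<bullet> b = 0)"
  proof (intro allI impI conjI ballI)
    fix r b assume r: "r < (2*n+1) * P" and b: "b \<in> insert c B"
    show "z r \<bullet> b \<in> \<int>"
      using b y(1)[OF f] zb cB by (cases "b = c") (auto simp: zc)
    have "real (r div P) \<le> 2 * real n" using q[OF r] by linarith
    then show "\<bar>z r \<bullet> b\<bar> \<le> real n"
      using b y(1)[OF f] zb cB by (cases "b = c") (auto simp: zc abs_le_iff)
  qed (use zb y(2)[OF f] in auto)
  moreover have "inj_on z {..<(2*n+1) * P}"
  proof (rule inj_onI)
    fix i j assume eq: "z i = z j"
    have d: "i div P = j div P" using arg_cong[OF eq, of "\<lambda>v. v \<bullet> c"] by (simp add: zc)
    then have "y (f i) = y (f j)" using eq by (simp add: z_def)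
    then have "f i = f j" using inj f by (auto simp: inj_on_def)
    moreover have "i mod P < P" "j mod P < P" using P by auto
    ultimately have "i mod P = j mod P"
      unfolding f_def d
    proof (cases "even (j div P)")
      case False
      assume "(if even (j div P) then i mod P else P - 1 - i mod P)
          = (if even (j div P) then j mod P else P - 1 - j mod P)" "i mod P < P" "j mod P < P"
      then show ?thesis using False by (simp only: if_False)
    qed (simp only: if_True)
    then show "i = j" using d by (metis div_mult_mod_eq)
  qed
  moreover have "\<exists>b\<in>insert c B. z (Suc i) = z i + b \<or> z (Suc i) = z i - b" for i
  proof (cases "Suc (i mod P) = P")
    case True
    then have m: "Suc i mod P = 0" "Suc i div P = Suc (i div P)" 
      by (simp_all add: mod_Suc div_Suc)
    \<comment> \<open>At the end of a pass the direction is reversed, so the old index stays put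
      while the new coordinate advances by one.\<close>
    then have "f (Suc i) = f i" using True P by (auto simp: f_def)
    then have "z (Suc i) = z i + c" using m by (simp add: z_def algebra_simps)
    then show ?thesis by blast
  next
    case False
    then have m: "Suc i mod P = Suc (i mod P)" "Suc i div P = i div P" 
      by (simp_all add: mod_Suc div_Suc)
    have lt: "Suc (i mod P) < P" using False P by (meson Suc_lessI mod_less_divisor)
    show ?thesis
    proof (cases "even (i div P)")
      case True
      then have "f i = i mod P" "f (Suc i) = Suc (i mod P)" using m by (simp_all add: f_def)
      then show ?thesis using adj[OF lt] m by (auto simp: z_def)
    next
      case odd: False
      \<comment> \<open>On a reversed pass a forward step of \<open>z\<close> is a backward step of
        \<open>y\<close>, so adjacency is used at the smaller index
        \<open>f (Suc i)\<close>.\<close>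
      then have ff: "f i = Suc (f (Suc i))" using m lt by (auto simp: f_def)
      then have "Suc (f (Suc i)) < P" using f[of i] by simp
      from adj[OF this] obtain b where "b \<in> B" "y (f i) = y (f (Suc i)) + b \<or> y (f i) = y (f (Suc i)) - b"
        using ff by auto
      then show ?thesis using m by (intro bexI[of _ b]) (auto simp: z_def)
    qed
  qed
  ultimately show ?case unfolding card by blast
qed

section \<open>A function of Whitney type\<close>

lemma Ck_holder_on_inner_left: "Ck_holder_on (Suc k) s U (\<lambda>x. x \<bullet> b)"
  by (rule bounded_linear_Ck_holder_on[OF bounded_linear_inner_left])

lemma Ck_holder_on_diff:
  fixes f g :: "'v::euclidean_space \<Rightarrow> real"
  assumes "open U" "0 \<le> s" "s \<le> 1" "Ck_holder_on k s U f" "Ck_holder_on k s U g"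
  shows "Ck_holder_on k s U (\<lambda>x. f x - g x)"
  using Ck_holder_on_add[OF assms(1,4) Ck_holder_on_mult[OF assms(1-3) Ck_holder_on_const[of _ _ _ "-1"] assms(5)]]
  by simp

lemma Ints_diff_ge_1:
  fixes a b :: real
  assumes "a \<in> \<int>" "b \<in> \<int>" "a \<noteq> b"
  shows "1 \<le> \<bar>a - b\<bar>"
  using assms Ints_nonzero_abs_ge1[of "a - b"] by auto

text \<open>The centres \<open>p i\<close> of the small cubes form \<open>R\<close> rows in the direction \<open>e\<close>; the starting points
  \<open>y r\<close> of consecutive rows are adjacent, and the rows are run through in alternating directions.\<close>

locale whitney =
  fixes e :: "'e::euclidean_space" and n k R :: nat and s :: real
    and \<sigma> :: "real \<Rightarrow> real" and y :: "nat \<Rightarrow> 'e"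
  assumes e: "e \<in> Basis"
    and Ck_\<sigma>: "Ck_on (Suc k) UNIV \<sigma>"
    and \<sigma>_0: "\<And>t. t \<le> - 1/8 \<Longrightarrow> \<sigma> t = 0"
    and \<sigma>_1: "\<And>t. t \<ge> 1/8 \<Longrightarrow> \<sigma> t = 1"
    and odd_R: "odd R"
    and y_Ints: "\<And>r b. r < R \<Longrightarrow> b \<in> Basis \<Longrightarrow> y r \<bullet> b \<in> \<int>"
    and y_le: "\<And>r b. r < R \<Longrightarrow> b \<in> Basis \<Longrightarrow> \<bar>y r \<bullet> b\<bar> \<le> real n"
    and y_e: "\<And>r. r < R \<Longrightarrow> y r \<bullet> e = 0"
    and inj_y: "inj_on y {..<R}"
    and y_adj: "\<And>r. Suc r < R \<Longrightarrow> \<exists>b\<in>Basis-{e}. y (Suc r) = y r + b \<or> y (Suc r) = y r - b"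
    and s: "0 \<le> s" "s \<le> 1"
    and k: "1 \<le> k"
    and size: "(4 * (real n + 1)) powr (real k + s) < real R * (2 * real n + 1)"
begin

text \<open>Along row \<open>r\<close> the first approximation \<open>g\<close> climbs or descends a staircase \<open>\<eta>\<close> from \<open>wL r\<close> to
  \<open>wR r\<close>, one step per cube. Row ends that are to be joined carry the same weight, and since \<open>\<tau>\<close> and
  its integer translates form a partition of unity, \<open>interp\<close> is constant around the segment between
  two adjacent points of equal weight. The cutoff \<open>\<psi>\<close> blends \<open>g\<close> into \<open>u\<close>, whose
  rescaled copies are the single steps of \<open>\<eta>\<close>; this makes the terms \<open>T\<close> compactly supported.\<close>

definition m :: real where "m = 2 * real n + 1"
definition X :: real where "X = 4 * (real n + 1)"
definition \<tau> :: "real \<Rightarrow> real" where "\<tau> t = \<sigma> (t + 1/2) - \<sigma> (t - 1/2)"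
definition bump :: "nat \<Rightarrow> 'e \<Rightarrow> real" where
  "bump r x = (\<Prod>b\<in>Basis-{e}. \<tau> (x \<bullet> b - y r \<bullet> b))"
definition interp :: "(nat \<Rightarrow> real) \<Rightarrow> 'e \<Rightarrow> real" where
  "interp w x = (\<Sum>r<R. w r * bump r x)"
text \<open>Row \<open>r\<close> accounts for the values between \<open>r / R\<close> and
  \<open>(r + 1) / R\<close>; odd rows are run through from right to left, so there the two ends
  change places.\<close>

definition wL :: "nat \<Rightarrow> real" where "wL r = (if even r then real r else real r + 1) / real R"
definition wR :: "nat \<Rightarrow> real" where "wR r = (if even r then real r + 1 else real r) / real R"
definition \<eta> :: "real \<Rightarrow> real" where
  "\<eta> t = (1 / m) * (\<Sum>j\<in>{- int n..int n}. \<sigma> (X * (t - real_of_int j)))"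
definition g :: "'e \<Rightarrow> real" where
  "g x = interp wL x + (interp wR x - interp wL x) * \<eta> (x \<bullet> e)"
definition u :: "'e \<Rightarrow> real" where "u x = \<sigma> (x \<bullet> e)"
definition \<psi> :: "'e \<Rightarrow> real" where
  "\<psi> x = (\<Prod>b\<in>Basis. \<sigma> (x \<bullet> b + (real n + 3/4)) - \<sigma> (x \<bullet> b - (real n + 3/4)))"
definition v :: "'e \<Rightarrow> real" where "v x = \<psi> x * (g x - u x)"
definition I :: "(nat \<times> int) set" where "I = {..<R} \<times> {- int n..int n}"
definition p :: "nat \<times> int \<Rightarrow> 'e" where "p i = y (fst i) + real_of_int (snd i) *\<^sub>R e"
definition sg :: "nat \<times> int \<Rightarrow> real" where
  "sg i = (if even (fst i) then 1 else -1) / (real R * m)"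
text \<open>The difference of two successive approximations: \<open>T l\<close> is the correction
  \<open>v\<close> inserted into all cubes of generation \<open>l\<close>, with the signs and
  weights collected on the way down.\<close>

primrec T :: "nat \<Rightarrow> 'e \<Rightarrow> real" where
  "T 0 = v"
| "T (Suc l) = (\<lambda>x. \<Sum>i\<in>I. sg i * T l (X *\<^sub>R (x - p i)))"
definition F :: "'e \<Rightarrow> real" where "F x = u x + (\<Sum>l. T l x)"

lemma R_pos: "R > 0" using odd_R by (simp add: odd_pos)

lemma X_pos: "X > 0" "X \<ge> 4" by (simp_all add: X_def)

lemma m_pos: "m > 0" by (simp add: m_def add_nonneg_pos)

lemma finite_I: "finite I" by (simp add: I_def)

lemma Ck_\<sigma>_comp:
  assumes "Ck_holder_on (Suc (Suc k)) 0 UNIV f"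
  shows "Ck_holder_on (Suc k) 0 UNIV (\<lambda>x. \<sigma> (f x))"
  by (rule Ck_holder_on_compose[where f = \<sigma> and U = UNIV and \<phi> = f])
    (use Ck_\<sigma> assms in \<open>auto simp: Ck_on_iff_Ck_holder_on_0 simp del: Ck_on.simps Ck_holder_on.simps\<close>)

lemmas Ck_intros = Ck_\<sigma>_comp Ck_holder_on_add Ck_holder_on_diff Ck_holder_on_mult Ck_holder_on_const
  Ck_holder_on_inner_left Ck_holder_on_sum Ck_holder_on_prod open_UNIV order_refl zero_le_one

lemma Ck_u: "Ck_holder_on (Suc k) 0 UNIV u"
  unfolding u_def by (intro Ck_intros)

text \<open>The order is \<open>Suc k\<close>, one more than what \<open>F\<close> will have,
  because the convergence theorem for the series uses up one order.\<close>

lemma Ck_v: "Ck_holder_on (Suc k) 0 UNIV v"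
  unfolding v_def \<psi>_def g_def u_def interp_def bump_def \<tau>_def \<eta>_def
  by (intro Ck_intros) auto

section \<open>Interpolation between the rows\<close>

lemma \<tau>_1: "\<bar>t\<bar> \<le> 3/8 \<Longrightarrow> \<tau> t = 1"
  by (simp add: \<tau>_def \<sigma>_0 \<sigma>_1 abs_le_iff)

lemma \<tau>_0: "\<bar>t\<bar> \<ge> 5/8 \<Longrightarrow> \<tau> t = 0"
  by (cases "t \<ge> 0") (simp_all add: \<tau>_def \<sigma>_0 \<sigma>_1)

text \<open>The sum telescopes to \<open>\<sigma> (t + 1/2) - \<sigma> (t - 3/2)\<close>, and on the
  given interval the first step is complete and the second has not begun.\<close>

lemma \<tau>_add: "-3/8 \<le> t \<Longrightarrow> t \<le> 11/8 \<Longrightarrow> \<tau> t + \<tau> (t - 1) = 1"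
  using \<sigma>_1[of "t + 1/2"] \<sigma>_0[of "t - 3/2"] by (simp add: \<tau>_def)

lemma bump_eq_0: "b \<in> Basis - {e} \<Longrightarrow> \<bar>x \<bullet> b - y r \<bullet> b\<bar> \<ge> 5/8 \<Longrightarrow> bump r x = 0"
  unfolding bump_def by (rule prod_zero) (auto intro!: bexI[of _ b] \<tau>_0)

lemma y_distinct:
  assumes "r < R" "r' < R" "r \<noteq> r'"
  shows "\<exists>b\<in>Basis-{e}. 1 \<le> \<bar>y r \<bullet> b - y r' \<bullet> b\<bar>"
proof -
  have "y r \<noteq> y r'" using assms inj_y by (auto simp: inj_on_def)
  then obtain b where b: "b \<in> Basis" "y r \<bullet> b \<noteq> y r' \<bullet> b" using euclidean_eqI by blast
  then have "b \<noteq> e" using y_e assms by auto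
  then show ?thesis using b assms y_Ints Ints_diff_ge_1 by (intro bexI[of _ b]) auto
qed

text \<open>Every other row is at distance at least \<open>1\<close> in some coordinate across
  \<open>e\<close>, and \<open>1 - 3/8 = 5/8\<close> puts \<open>x\<close> outside the support of
  its bump.\<close>

lemma interp_at:
  assumes r: "r < R" and x: "\<And>b. b \<in> Basis - {e} \<Longrightarrow> \<bar>x \<bullet> b - y r \<bullet> b\<bar> \<le> 3/8"
  shows "interp w x = w r"
proof -
  have "bump r' x = 0" if "r' < R" "r' \<noteq> r" for r'
  proof -
    obtain b where b: "b \<in> Basis - {e}" "1 \<le> \<bar>y r' \<bullet> b - y r \<bullet> b\<bar>"
      using y_distinct \<open>r' < R\<close> r \<open>r' \<noteq> r\<close> by blast
    have "\<bar>x \<bullet> b - y r' \<bullet> b\<bar> \<ge> 5/8" using b(2) x[OF b(1)] by linarith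
    then show ?thesis by (rule bump_eq_0[OF b(1)])
  qed
  then have "interp w x = (\<Sum>r'\<in>{r}. w r' * bump r' x)"
    unfolding interp_def using r by (intro sum.mono_neutral_right) auto
  also have "bump r x = 1" unfolding bump_def by (intro prod.neutral ballI \<tau>_1 x)
  then have "(\<Sum>r'\<in>{r}. w r' * bump r' x) = w r" by simp
  finally show ?thesis .
qed

text \<open>A third bump that is nonzero at \<open>x\<close> would belong to a lattice point that
  agrees with both rows in the coordinates other than \<open>b\<close>, hence differs from both by
  at least \<open>1\<close> in the coordinate \<open>b\<close>; that is too far from
  \<open>x\<close>. The two remaining bumps reduce to functions of the coordinate \<open>b\<close>
  and add up to \<open>1\<close> by \<open>\<tau>_add\<close>. The sign \<open>c\<close> treats
  steps in both directions together.\<close>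

lemma interp_between:
  assumes r: "Suc r < R" and w: "w (Suc r) = w r" and c: "c = 1 \<or> c = -1"
    and b: "b \<in> Basis - {e}" and yb: "y (Suc r) = y r + c *\<^sub>R b"
    and x: "\<And>b'. b' \<in> Basis - {e, b} \<Longrightarrow> \<bar>x \<bullet> b' - y r \<bullet> b'\<bar> \<le> 3/8"
    and xb: "- 3/8 \<le> c * (x \<bullet> b - y r \<bullet> b)" "c * (x \<bullet> b - y r \<bullet> b) \<le> 11/8"
  shows "interp w x = w r"
proof -
  have y': "y (Suc r) \<bullet> b' = (if b' = b then y r \<bullet> b + c else y r \<bullet> b')" if "b' \<in> Basis" for b'
    using b that by (simp add: yb inner_add_left inner_Basis)
  have "bump r' x = 0" if r': "r' < R" "r' \<noteq> r" "r' \<noteq> Suc r" for r'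
  proof (rule ccontr)
    assume "bump r' x \<noteq> 0"
    then have lt: "\<bar>x \<bullet> b' - y r' \<bullet> b'\<bar> < 5/8" if "b' \<in> Basis - {e}" for b'
      using bump_eq_0 that by (meson not_le)
    have eq: "y r' \<bullet> b' = y r \<bullet> b'" if "b' \<in> Basis - {e, b}" for b'
    proof (rule ccontr)
      assume "y r' \<bullet> b' \<noteq> y r \<bullet> b'"
      then have "1 \<le> \<bar>y r' \<bullet> b' - y r \<bullet> b'\<bar>"
        using that r r' y_Ints by (intro Ints_diff_ge_1) auto
      moreover have "\<bar>x \<bullet> b' - y r' \<bullet> b'\<bar> < 5/8" using lt that by blast
      ultimately show False using x[OF that] by linarith
    qed
    have "y r' \<bullet> b \<noteq> y r \<bullet> b"
      using y_distinct[OF r'(1) _ r'(2)] r eq by (metis Diff_insert Diff_iff Suc_lessD abs_zero diff_self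
          insert_iff not_one_le_zero)
    then have 1: "1 \<le> \<bar>y r' \<bullet> b - y r \<bullet> b\<bar>"
      using b r r' y_Ints by (intro Ints_diff_ge_1) auto
    have "y r' \<bullet> b \<noteq> y (Suc r) \<bullet> b"
    proof
      assume *: "y r' \<bullet> b = y (Suc r) \<bullet> b"
      have "y r' \<bullet> b' = y (Suc r) \<bullet> b'" if "b' \<in> Basis - {e}" for b'
        using * eq[of b'] y'[of b'] that by (cases "b' = b") auto
      then show False using y_distinct[OF r'(1) r r'(3)] by auto
    qed
    then have 2: "1 \<le> \<bar>y r' \<bullet> b - (y r \<bullet> b + c)\<bar>"
      using b r r' y_Ints[of r' b] y_Ints[of "Suc r" b] y'[of b] by (intro Ints_diff_ge_1) auto
    show False using c lt[OF b] xb 1 2 by (auto simp: abs_if split: if_splits)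
  qed
  then have "interp w x = (\<Sum>r'\<in>{r, Suc r}. w r' * bump r' x)"
    unfolding interp_def using r by (intro sum.mono_neutral_right) auto
  also have "\<dots> = w r * (bump r x + bump (Suc r) x)" using w by (simp add: algebra_simps)
  also have "bump r x = \<tau> (x \<bullet> b - y r \<bullet> b)"
  proof -
    have "(\<Prod>b'\<in>Basis - {e} - {b}. \<tau> (x \<bullet> b' - y r \<bullet> b')) = 1"
      by (intro prod.neutral ballI \<tau>_1 x) auto
    then show ?thesis
      unfolding bump_def using b prod.remove[of "Basis - {e}" b "\<lambda>b. \<tau> (x \<bullet> b - y r \<bullet> b)"] by simp
  qed
  also have "bump (Suc r) x = \<tau> (x \<bullet> b - y r \<bullet> b - c)"
  proof -
    have "(\<Prod>b'\<in>Basis - {e} - {b}. \<tau> (x \<bullet> b' - y (Suc r) \<bullet> b')) = 1"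
      using x by (intro prod.neutral ballI \<tau>_1) (simp add: y')
    then show ?thesis
      unfolding bump_def using b prod.remove[of "Basis - {e}" b "\<lambda>b. \<tau> (x \<bullet> b - y (Suc r) \<bullet> b)"]
      by (simp add: y' algebra_simps)
  qed
  also have "\<tau> (x \<bullet> b - y r \<bullet> b) + \<tau> (x \<bullet> b - y r \<bullet> b - c) = 1"
    using c
  proof
    assume "c = 1"
    then show ?thesis using \<tau>_add xb by simp
  next
    assume "c = -1"
    then show ?thesis using \<tau>_add[of "x \<bullet> b - y r \<bullet> b + 1"] xb by (simp add: add.commute)
  qed
  finally show ?thesis by simp
qed

section \<open>The staircase along a row\<close>

lemma \<eta>_0:
  assumes "t \<le> - real n - 3/8"
  shows "\<eta> t = 0"
proof -
  have "\<sigma> (X * (t - real_of_int j)) = 0" if "j \<in> {- int n..int n}" for j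
  proof (rule \<sigma>_0)
    have "real_of_int j \<ge> - real n" using that by (simp add: of_int_le_iff[symmetric, where 'a = real] del: of_int_le_iff)
    then have "X * (t - real_of_int j) \<le> X * (- 3/8)"
      using assms X_pos by (intro mult_left_mono) auto
    then show "X * (t - real_of_int j) \<le> - 1/8" using X_pos by simp
  qed
  then show ?thesis by (simp add: \<eta>_def)
qed

lemma \<eta>_1:
  assumes "t \<ge> real n + 3/8"
  shows "\<eta> t = 1"
proof -
  have "\<sigma> (X * (t - real_of_int j)) = 1" if "j \<in> {- int n..int n}" for j
  proof (rule \<sigma>_1)
    have "real_of_int j \<le> real n" using that by auto
    then have "X * (3/8) \<le> X * (t - real_of_int j)"
      using assms X_pos by (intro mult_left_mono) auto
    then show "1/8 \<le> X * (t - real_of_int j)" using X_pos by linarith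
  qed
  then show ?thesis using m_pos by (simp add: \<eta>_def m_def)
qed

text \<open>All other steps are at distance at least \<open>1 - 5/8 = 3/8\<close> from
  \<open>t\<close>, which magnified by \<open>X \<ge> 4\<close> lies beyond the transition zone of
  \<open>\<sigma>\<close>: those to the left count \<open>1\<close> each, those to the right
  \<open>0\<close>.\<close>

lemma \<eta>_step:
  assumes j: "j \<in> {- int n..int n}" and t: "\<bar>t - real_of_int j\<bar> \<le> 5/8"
  shows "\<eta> t = (1 / m) * (real_of_int j + real n + \<sigma> (X * (t - real_of_int j)))"
proof -
  have lo: "\<sigma> (X * (t - real_of_int i)) = 1" if "i < j" for i
  proof (rule \<sigma>_1)
    have "real_of_int i \<le> real_of_int j - 1" using that by linarith
    then have "X * (3/8) \<le> X * (t - real_of_int i)"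
      using t X_pos by (intro mult_left_mono) linarith+
    then show "1/8 \<le> X * (t - real_of_int i)" using X_pos by linarith
  qed
  have hi: "\<sigma> (X * (t - real_of_int i)) = 0" if "i > j" for i
  proof (rule \<sigma>_0)
    have "real_of_int i \<ge> real_of_int j + 1" using that by linarith
    then have "X * (t - real_of_int i) \<le> X * (- 3/8)"
      using t X_pos by (intro mult_left_mono) linarith+
    then show "X * (t - real_of_int i) \<le> - 1/8" using X_pos by simp
  qed
  have "{- int n..int n} = {- int n..<j} \<union> {j} \<union> {j<..int n}" using j by auto
  then have "(\<Sum>i\<in>{- int n..int n}. \<sigma> (X * (t - real_of_int i)))
      = (\<Sum>i\<in>{- int n..<j} \<union> {j} \<union> {j<..int n}. \<sigma> (X * (t - real_of_int i)))" by simp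
  also have "\<dots> = (\<Sum>i\<in>{- int n..<j}. \<sigma> (X * (t - real_of_int i))) + \<sigma> (X * (t - real_of_int j))
      + (\<Sum>i\<in>{j<..int n}. \<sigma> (X * (t - real_of_int i)))"
    by (subst sum.union_disjoint; (subst sum.union_disjoint)?) auto
  also have "\<dots> = real_of_int j + real n + \<sigma> (X * (t - real_of_int j))"
    using j by (simp add: lo hi)
  finally show ?thesis by (simp add: \<eta>_def)
qed

section \<open>Centres, cutoff and supports\<close>

lemma p_inner_e: "i \<in> I \<Longrightarrow> p i \<bullet> e = real_of_int (snd i)"
  using e y_e by (auto simp: p_def I_def inner_add_left)

lemma p_inner: "b \<in> Basis - {e} \<Longrightarrow> p i \<bullet> b = y (fst i) \<bullet> b"
  using e by (auto simp: p_def inner_add_left inner_Basis)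

lemma p_le:
  assumes "i \<in> I" "b \<in> Basis"
  shows "\<bar>p i \<bullet> b\<bar> \<le> real n"
proof (cases "b = e")
  case True
  have "\<bar>snd i\<bar> \<le> int n" using assms by (auto simp: I_def)
  then have "\<bar>real_of_int (snd i)\<bar> \<le> real n" by linarith
  then show ?thesis using True assms by (simp add: p_inner_e)
next
  case False
  then show ?thesis using assms p_inner[of b i] y_le by (auto simp: I_def)
qed

lemma p_distinct:
  assumes "i \<in> I" "i' \<in> I" "i \<noteq> i'"
  shows "\<exists>b\<in>Basis. 1 \<le> \<bar>p i \<bullet> b - p i' \<bullet> b\<bar>"
proof (cases "fst i = fst i'")
  case True
  then have "snd i \<noteq> snd i'" using assms by (simp add: prod_eq_iff)
  then have "1 \<le> \<bar>real_of_int (snd i) - real_of_int (snd i')\<bar>" by linarith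
  then show ?thesis using e p_inner_e assms by (intro bexI[of _ e]) auto
next
  case False
  then obtain b where "b \<in> Basis - {e}" "1 \<le> \<bar>y (fst i) \<bullet> b - y (fst i') \<bullet> b\<bar>"
    using y_distinct[of "fst i" "fst i'"] assms unfolding I_def mem_Times_iff lessThan_iff by blast
  then show ?thesis using p_inner by (intro bexI[of _ b]) auto
qed

text \<open>The margin \<open>5/8\<close> covers the places where \<open>F\<close> has to follow
  \<open>g\<close>: neighbourhoods of the small cubes and of the turns between rows.\<close>

lemma \<psi>_1:
  assumes "\<And>b. b \<in> Basis \<Longrightarrow> \<bar>x \<bullet> b\<bar> \<le> real n + 5/8"
  shows "\<psi> x = 1"
  unfolding \<psi>_def
proof (rule prod.neutral, intro ballI)
  fix b :: 'e assume "b \<in> Basis"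
  then show "\<sigma> (x \<bullet> b + (real n + 3/4)) - \<sigma> (x \<bullet> b - (real n + 3/4)) = 1"
    using assms[of b] by (subst \<sigma>_1, force, subst \<sigma>_0) auto
qed

lemma v_0:
  assumes "b \<in> Basis" "\<bar>x \<bullet> b\<bar> \<ge> real n + 7/8"
  shows "v x = 0"
proof -
  have "\<sigma> (x \<bullet> b + (real n + 3/4)) - \<sigma> (x \<bullet> b - (real n + 3/4)) = 0"
    using assms(2) by (cases "x \<bullet> b \<ge> 0") (simp_all add: \<sigma>_1 \<sigma>_0)
  then have "\<psi> x = 0" unfolding \<psi>_def using assms(1) by (intro prod_zero) auto
  then show ?thesis by (simp add: v_def)
qed

text \<open>The factor \<open>4\<close> in \<open>X\<close> is used here: shrunk supports reach less
  than \<open>1/4\<close> from their centres, while distinct centres differ by at least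
  \<open>1\<close> in some coordinate.\<close>

lemma scaled_support:
  assumes "\<bar>X * t\<bar> < real n + 7/8"
  shows "\<bar>t\<bar> < 1/4"
proof -
  have "X * \<bar>t\<bar> < real n + 7/8" using assms X_pos by (simp add: abs_mult)
  also have "\<dots> < X * (1/4)" by (simp add: X_def)
  finally have "X * \<bar>t\<bar> < X * (1/4)" .
  then show ?thesis using X_pos by (simp only: mult_less_cancel_left_pos)
qed

lemma T_support:
  assumes "T l x \<noteq> 0" "b \<in> Basis"
  shows "\<bar>x \<bullet> b\<bar> < real n + 7/8"
  using assms
proof (induction l arbitrary: x)
  case 0
  then show ?case using v_0 by (metis T.simps(1) not_le)
next
  case (Suc l)
  then obtain i where i: "i \<in> I" "T l (X *\<^sub>R (x - p i)) \<noteq> 0"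
    by (metis (no_types, lifting) T.simps(2) mult_zero_right sum.neutral)
  then have "\<bar>X * (x \<bullet> b - p i \<bullet> b)\<bar> < real n + 7/8"
    using Suc.IH[of "X *\<^sub>R (x - p i)"] Suc.prems(2) by (simp add: inner_diff_left)
  then have "\<bar>x \<bullet> b - p i \<bullet> b\<bar> < 1/4" by (rule scaled_support)
  then show ?case using p_le[OF i(1) Suc.prems(2)] by linarith
qed

lemma T_scaled_support:
  assumes "T l (X *\<^sub>R (x - p i)) \<noteq> 0" "b \<in> Basis"
  shows "\<bar>x \<bullet> b - p i \<bullet> b\<bar> < 1/4"
  using T_support[OF assms] by (intro scaled_support) (simp add: inner_diff_left)

end

lemma open_Collect_ball_finite:
  assumes "finite B" "\<And>b. b \<in> B \<Longrightarrow> open {x. P b x}"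
  shows "open {x. \<forall>b\<in>B. P b x}"
proof -
  have "{x. \<forall>b\<in>B. P b x} = (\<Inter>b\<in>B. {x. P b x})" by auto
  then show ?thesis using assms by auto
qed

context whitney
begin

section \<open>Estimates for the series and regularity of \<open>F\<close>\<close>

definition \<epsilon> :: real where "\<epsilon> = 1 / (real R * m)"

lemma \<epsilon>_pos: "\<epsilon> > 0" using R_pos m_pos by (simp add: \<epsilon>_def)

lemma abs_sg: "\<bar>sg i\<bar> = \<epsilon>"
  using R_pos m_pos by (simp add: sg_def \<epsilon>_def)

lemma \<epsilon>_X_powr: "\<epsilon> * X powr (real k + s) < 1"
  using size R_pos m_pos by (simp add: \<epsilon>_def X_def m_def divide_less_eq mult.commute)

lemma \<epsilon>_X: "\<epsilon> * X < 1"
proof -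
  have "X powr 1 \<le> X powr (real k + s)" using X_pos k s by (intro powr_mono) auto
  then have "\<epsilon> * X \<le> \<epsilon> * X powr (real k + s)" using \<epsilon>_pos X_pos by (intro mult_left_mono) auto
  then show ?thesis using \<epsilon>_X_powr by linarith
qed

lemma \<epsilon>_lt_1: "\<epsilon> < 1"
proof -
  have "\<epsilon> * 1 \<le> \<epsilon> * X" using \<epsilon>_pos X_pos by (intro mult_left_mono) auto
  then show ?thesis using \<epsilon>_X by linarith
qed

text \<open>The distance \<open>3/4\<close> and the radius \<open>1/4\<close> of the supports add up
  to \<open>1\<close>, the least separation of two centres in some coordinate, so no other copy is
  seen from \<open>x\<close>.\<close>

lemma T_Suc_near:
  assumes "i \<in> I" "\<And>b. b \<in> Basis \<Longrightarrow> \<bar>x \<bullet> b - p i \<bullet> b\<bar> < 3/4"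
  shows "T (Suc l) x = sg i * T l (X *\<^sub>R (x - p i))"
proof -
  have "T l (X *\<^sub>R (x - p i')) = 0" if i': "i' \<in> I" "i' \<noteq> i" for i'
  proof (rule ccontr)
    assume nz: "T l (X *\<^sub>R (x - p i')) \<noteq> 0"
    obtain b where b: "b \<in> Basis" "1 \<le> \<bar>p i' \<bullet> b - p i \<bullet> b\<bar>"
      using p_distinct[OF i'(1) assms(1) i'(2)] by auto
    show False using T_scaled_support[OF nz b(1)] assms(2)[OF b(1)] b(2) by linarith
  qed
  then have "T (Suc l) x = (\<Sum>i\<in>{i}. sg i * T l (X *\<^sub>R (x - p i)))"
    using assms(1) finite_I by (simp only: T.simps) (intro sum.mono_neutral_right, auto)
  then show ?thesis by simp
qed

lemma T_Suc_far:
  assumes "\<And>i. i \<in> I \<Longrightarrow> \<exists>b\<in>Basis. \<bar>x \<bullet> b - p i \<bullet> b\<bar> \<ge> 1/4"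
  shows "T (Suc l) x = 0"
proof -
  have "T l (X *\<^sub>R (x - p i)) = 0" if "i \<in> I" for i
    using assms[OF that] T_scaled_support[of l x i] by (meson not_le)
  then show ?thesis by simp
qed

text \<open>The number of copies does not enter the bound: near each point \<open>T (Suc l)\<close>
  is a single copy or zero. Passing to that copy multiplies the size by \<open>\<epsilon>\<close>
  and each derivative by a further \<open>X\<close>.\<close>

lemma T_bounded:
  assumes "0 \<le> A" "Ck_bounded_on (Suc k) A 1 UNIV v"
  shows "Ck_bounded_on (Suc k) (A * \<epsilon> ^ l) (X ^ l) UNIV (T l)"
proof (induction l)
  case 0
  then show ?case using assms by simp
next
  case (Suc l)
  have S: "Ck_bounded_on (Suc k) (A * \<epsilon> ^ Suc l) (X ^ Suc l) UNIV (\<lambda>x. sg i * T l (X *\<^sub>R (x - p i)))" for i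
    using Ck_bounded_on_scale[OF open_UNIV Ck_bounded_on_dilation[OF X_pos(1) Suc.IH], of "sg i" "p i"]
    by (simp add: abs_sg mult_ac del: Ck_bounded_on.simps)
  show ?case
  proof (rule Ck_bounded_on_locally)
    fix x :: 'e
    show "\<exists>V. open V \<and> x \<in> V \<and> Ck_bounded_on (Suc k) (A * \<epsilon> ^ Suc l) (X ^ Suc l) V (T (Suc l))"
    proof (cases "\<exists>i\<in>I. \<forall>b\<in>Basis. \<bar>x \<bullet> b - p i \<bullet> b\<bar> \<le> 1/4")
      case True
      then obtain i where i: "i \<in> I" "\<And>b. b \<in> Basis \<Longrightarrow> \<bar>x \<bullet> b - p i \<bullet> b\<bar> \<le> 1/4" by auto
      define V where "V = {x. \<forall>b\<in>Basis. \<bar>x \<bullet> b - p i \<bullet> b\<bar> < 3/4}"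
      have V: "open V" unfolding V_def
        by (intro open_Collect_ball_finite open_Collect_less continuous_intros) simp
      have "Ck_bounded_on (Suc k) (A * \<epsilon> ^ Suc l) (X ^ Suc l) V (T (Suc l))"
        by (rule Ck_bounded_on_cong[OF V Ck_bounded_on_subset[OF S[of i] subset_UNIV]])
          (use T_Suc_near[OF i(1), of _ l] in \<open>simp add: V_def del: T.simps\<close>)
      moreover have "x \<in> V" using i(2) by (force simp: V_def)
      ultimately show ?thesis using V by blast
    next
      case False
      define V where "V = {x. \<forall>i\<in>I. \<exists>b\<in>Basis. \<bar>x \<bullet> b - p i \<bullet> b\<bar> > 1/4}"
      have Veq: "V = (\<Inter>i\<in>I. \<Union>b\<in>Basis. {x. \<bar>x \<bullet> b - p i \<bullet> b\<bar> > 1/4})" by (auto simp: V_def)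
      have V: "open V" unfolding Veq
        by (intro open_INT finite_I ballI open_UN open_Collect_less continuous_intros)
      \<comment> \<open>A bound for the zero function, read off as \<open>0\<close> times a bounded
        one; on \<open>V\<close> all copies vanish.\<close>
      have "Ck_bounded_on (Suc k) 0 (X ^ Suc l) V (\<lambda>x. 0)"
        using Ck_bounded_on_scale[OF V Ck_bounded_on_subset[OF S subset_UNIV], of 0]
        by (simp del: Ck_bounded_on.simps power_Suc)
      then have "Ck_bounded_on (Suc k) (A * \<epsilon> ^ Suc l) (X ^ Suc l) V (\<lambda>x. 0)"
        by (rule Ck_bounded_on_mono) (use assms(1) \<epsilon>_pos X_pos in auto)
      then have "Ck_bounded_on (Suc k) (A * \<epsilon> ^ Suc l) (X ^ Suc l) V (T (Suc l))"
        by (rule Ck_bounded_on_cong[OF V])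
          (use T_Suc_far[of _ l] in \<open>force simp: V_def simp del: T.simps\<close>)
      moreover have "x \<in> V" using False by (auto simp: V_def not_le)
      ultimately show ?thesis using V by blast
    qed
  qed
qed

lemma v_bounded: "\<exists>A\<ge>0. Ck_bounded_on (Suc k) A 1 UNIV v"
proof (rule Ck_bounded_on_compact_support)
  show "Ck_on (Suc k) UNIV v" using Ck_v by (rule Ck_holder_on_imp_Ck_on)
  fix x :: 'e assume x: "norm x > real DIM('e) * (real n + 7/8)"
  show "v x = 0"
  proof (rule ccontr)
    assume "v x \<noteq> 0"
    then have "\<bar>x \<bullet> b\<bar> \<le> real n + 7/8" if "b \<in> Basis" for b
      using v_0[OF that, of x] by linarith
    then have "(\<Sum>b\<in>Basis. \<bar>x \<bullet> b\<bar>) \<le> (\<Sum>b\<in>(Basis::'e set). real n + 7/8)" by (rule sum_mono)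
    also have "\<dots> = real DIM('e) * (real n + 7/8)" by simp
    finally show False using x norm_le_l1[of x] by linarith
  qed
qed

lemma summable_T: "summable (\<lambda>l. T l x)"
proof -
  obtain A where A: "0 \<le> A" "Ck_bounded_on (Suc k) A 1 UNIV v" using v_bounded by auto
  have "\<bar>T l x\<bar> \<le> A * \<epsilon> ^ l" for l
    using Ck_bounded_on_bound[OF T_bounded[OF A]] by auto
  then show ?thesis
    using \<epsilon>_lt_1 \<epsilon>_pos
    by - (rule summable_comparison_test'[of "\<lambda>l. A * \<epsilon> ^ l" 0], auto intro!: summable_mult summable_geometric)
qed

lemma suminf_T: "(\<Sum>l. T l x) = v x + (\<Sum>l. T (Suc l) x)"
  using suminf_split_head[OF summable_T, of x] by (simp del: T.simps(2))

lemma Ck_holder_F: "Ck_holder_on k s UNIV F"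
proof -
  obtain A where A: "0 \<le> A" "Ck_bounded_on (Suc k) A 1 UNIV v" using v_bounded by auto
  have "Ck_holder_on k s UNIV (\<lambda>x. \<Sum>l. T l x)"
    using \<epsilon>_pos X_pos s \<epsilon>_X_powr by (intro Ck_holder_on_suminf[OF T_bounded[OF A] A(1)]) auto
  moreover have "Ck_holder_on k s UNIV u"
    by (rule Ck_holder_on_Suc_imp_Ck_holder_on[OF open_UNIV s Ck_u])
  ultimately show ?thesis
    using Ck_holder_on_add[OF open_UNIV, of k s u "\<lambda>x. \<Sum>l. T l x"] by (simp add: F_def[abs_def])
qed

section \<open>Self-similarity of \<open>F\<close>\<close>

definition base :: "nat \<times> int \<Rightarrow> real" where
  "base i = wL (fst i) + (wR (fst i) - wL (fst i)) * (real_of_int (snd i) + real n) / m"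

lemma wR_minus_wL: "wR r - wL r = (if even r then 1 else -1) / real R"
  using R_pos by (simp add: wR_def wL_def diff_divide_distrib[symmetric])

text \<open>Near \<open>p i\<close> the cutoff is \<open>1\<close>, \<open>interp\<close> is
  constant and \<open>\<eta>\<close> makes a single step, so \<open>g\<close> is an affine image of
  the rescaled \<open>u\<close>; and \<open>T (Suc l)\<close> is \<open>sg i\<close> times the
  rescaled \<open>T l\<close>. The series for \<open>F\<close> at the two scales therefore match
  term by term. \<open>base i\<close> is the value at the left end of the small copy, where the
  rescaled \<open>F\<close> is \<open>0\<close>. The bounds leave an open margin around the box
  \<open>stage 0\<close>, so that derivatives can be compared as well.\<close>

lemma F_self_similar:
  assumes i: "i \<in> I" and x: "\<And>b. b \<in> Basis - {e} \<Longrightarrow> \<bar>x \<bullet> b\<bar> < 3/2 * (real n + 1)"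
    and xe: "\<bar>x \<bullet> e\<bar> < 5/2 * (real n + 1)"
  shows "F (p i + (1 / X) *\<^sub>R x) = base i + sg i * F x"
proof -
  define z where "z = p i + (1 / X) *\<^sub>R x"
  have zb: "z \<bullet> b - p i \<bullet> b = x \<bullet> b / X" for b by (simp add: z_def inner_add_left)
  have Xz: "X *\<^sub>R (z - p i) = x" using X_pos by (simp add: z_def)
  have X38: "3/8 * X = 3/2 * (real n + 1)" "5/8 * X = 5/2 * (real n + 1)" by (simp_all add: X_def)
  have near: "\<bar>z \<bullet> b - p i \<bullet> b\<bar> < 3/8" if "b \<in> Basis - {e}" for b
    using x[OF that] X_pos unfolding zb X38[symmetric] by (simp add: abs_divide divide_less_eq)
  have nears: "\<bar>z \<bullet> e - p i \<bullet> e\<bar> < 5/8"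
    using xe X_pos unfolding zb X38[symmetric] by (simp add: abs_divide divide_less_eq)
  have near': "\<bar>z \<bullet> b - p i \<bullet> b\<bar> < 5/8" if "b \<in> Basis" for b
    using near[of b] nears that by (cases "b = e") auto
  obtain r j where ij: "i = (r, j)" by fastforce
  have r: "r < R" and j: "j \<in> {- int n..int n}" using i by (auto simp: ij I_def)
  have gz: "interp w z = w r" for w
    using near p_inner[of _ i] by (intro interp_at[OF r] less_imp_le) (simp add: ij)
  have "z \<bullet> e - real_of_int j = x \<bullet> e / X" using zb[of e] p_inner_e[OF i] by (simp add: ij)
  moreover have "\<bar>z \<bullet> e - real_of_int j\<bar> \<le> 5/8" using nears p_inner_e[OF i] by (simp add: ij)
  ultimately have "\<eta> (z \<bullet> e) = (1 / m) * (real_of_int j + real n + u x)"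
    using \<eta>_step[OF j, of "z \<bullet> e"] X_pos by (simp add: u_def)
  then have g: "g z = base i + sg i * u x"
    unfolding g_def gz base_def ij fst_conv snd_conv sg_def wR_minus_wL
    by (simp add: algebra_simps add_divide_distrib)
  have "\<psi> z = 1"
  proof (rule \<psi>_1)
    fix b :: 'e assume "b \<in> Basis"
    then show "\<bar>z \<bullet> b\<bar> \<le> real n + 5/8" using near'[of b] p_le[OF i, of b] by linarith
  qed
  then have "v z = g z - u z" by (simp add: v_def)
  moreover have "T (Suc l) z = sg i * T l x" for l
  proof -
    have "\<bar>z \<bullet> b - p i \<bullet> b\<bar> < 3/4" if "b \<in> Basis" for b using near'[OF that] by linarith
    from T_Suc_near[OF i this, of l] show ?thesis by (simp only: Xz)
  qed
  ultimately have "F z = g z + (\<Sum>l. sg i * T l x)" unfolding F_def[of z] suminf_T by simp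
  also have "\<dots> = base i + sg i * F x"
    using suminf_mult[OF summable_T, of "sg i" x] by (simp add: g F_def algebra_simps)
  finally show ?thesis by (simp add: z_def)
qed

text \<open>All corrections after the first live within \<open>1/4\<close> of the centres, whose
  coordinate along \<open>e\<close> is at most \<open>n\<close> in absolute value.\<close>

lemma F_far:
  assumes "real n + 3/8 \<le> \<bar>z \<bullet> e\<bar>"
  shows "F z = u z + v z"
proof -
  have "T (Suc l) z = 0" for l
  proof (rule T_Suc_far, intro bexI[OF _ e])
    fix i assume "i \<in> I"
    from p_le[OF this e] show "1/4 \<le> \<bar>z \<bullet> e - p i \<bullet> e\<bar>" using assms by linarith
  qed
  then show ?thesis unfolding F_def suminf_T by simp
qed

section \<open>The arcs and local constancy of \<open>F\<close> on them\<close>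

definition dir :: "nat \<Rightarrow> real" where "dir r = (if even r then 1 else -1)"

text \<open>Row \<open>r\<close> is left at distance \<open>1/2\<close> past its last centre, which
  is where its last small copy ends.\<close>

definition turn :: "nat \<Rightarrow> 'e set" where
  "turn r = closed_segment (y r + (dir r * (real n + 1/2)) *\<^sub>R e)
                           (y (Suc r) + (dir r * (real n + 1/2)) *\<^sub>R e)"

text \<open>Joins an end of the box to the outer end of the first row (\<open>c = -1\<close>) or of
  the last row (\<open>c = 1\<close>). The slanted piece stays where \<open>F\<close> is already
  \<open>0\<close> or \<open>1\<close>; only the piece parallel to \<open>e\<close> comes near the
  cubes.\<close>

definition tail :: "real \<Rightarrow> nat \<Rightarrow> 'e set" where
  "tail c r = closed_segment ((c * (2 * (real n + 1))) *\<^sub>R e) (y r + (c * (real n + 1)) *\<^sub>R e) \<union>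
              closed_segment (y r + (c * (real n + 1)) *\<^sub>R e) (y r + (c * (real n + 1/2)) *\<^sub>R e)"

definition E :: "'e set" where
  "E = tail (-1) 0 \<union> tail 1 (R - 1) \<union> (\<Union>r\<in>{r. Suc r < R}. turn r)"

definition flat_at :: "'e \<Rightarrow> bool" where
  "flat_at x \<longleftrightarrow> (\<exists>V c. open V \<and> x \<in> V \<and> (\<forall>z\<in>V. F z = c))"

text \<open>Beyond the end of a row \<open>\<eta>\<close> has reached \<open>0\<close> or
  \<open>1\<close>, so that \<open>g\<close> is the interpolation of one weight, the one shared by
  the two rows; \<open>interp_between\<close> makes this constant, and here \<open>F\<close> equals
  \<open>g\<close>.\<close>

lemma flat_turn:
  assumes r: "Suc r < R" and x: "x \<in> turn r"
  shows "flat_at x"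
proof -
  obtain b c where b: "b \<in> Basis - {e}" and c: "c = 1 \<or> c = -1" and yb: "y (Suc r) = y r + c *\<^sub>R b"
    using y_adj[OF r] by (metis scaleR_one scaleR_minus1_left diff_conv_add_uminus)
  obtain t where t: "0 \<le> t" "t \<le> 1" "x = y r + (dir r * (real n + 1/2)) *\<^sub>R e + (t * c) *\<^sub>R b"
  proof -
    define a where "a = y r + (dir r * (real n + 1/2)) *\<^sub>R e"
    have "x \<in> closed_segment a (a + c *\<^sub>R b)"
      using x by (simp add: turn_def yb a_def ac_simps)
    then obtain t where "0 \<le> t" "t \<le> 1" "x = (1 - t) *\<^sub>R a + t *\<^sub>R (a + c *\<^sub>R b)"
      unfolding in_segment by auto
    moreover from this have "x = a + (t * c) *\<^sub>R b" by (simp add: algebra_simps)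
    ultimately show ?thesis using that by (simp add: a_def)
  qed
  \<comment> \<open>The width \<open>1/8\<close> keeps \<open>\<bar>z \<bullet> e\<bar>\<close>
    between \<open>n + 3/8\<close>, from where \<open>F_far\<close> holds and \<open>\<eta>\<close>
    is saturated, and \<open>n + 5/8\<close>, up to where the cutoff is \<open>1\<close>.\<close>
  define V where "V = {z. \<bar>z \<bullet> e - dir r * (real n + 1/2)\<bar> < 1/8 \<and>
    (\<forall>b'\<in>Basis - {e, b}. \<bar>z \<bullet> b' - y r \<bullet> b'\<bar> < 3/8) \<and>
    - 3/8 < c * (z \<bullet> b - y r \<bullet> b) \<and> c * (z \<bullet> b - y r \<bullet> b) < 11/8}"
  have "open V" unfolding V_def
    by (intro open_Collect_conj open_Collect_ball_finite open_Collect_less continuous_intros) simp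
  moreover have "x \<in> V"
    using b c t e y_e r by (auto simp: V_def inner_add_left inner_Basis)
  moreover have "F z = (if even r then wR r else wL r)" if z: "z \<in> V" for z
  proof -
    have ze: "\<bar>z \<bullet> e - dir r * (real n + 1/2)\<bar> < 1/8" using z by (simp add: V_def)
    have ze_even: "real n + 3/8 < z \<bullet> e" "z \<bullet> e < real n + 5/8" if "even r"
    proof -
      have "\<bar>z \<bullet> e - (real n + 1/2)\<bar> < 1/8" using ze that by (simp add: dir_def)
      then show "real n + 3/8 < z \<bullet> e" "z \<bullet> e < real n + 5/8" unfolding abs_less_iff by linarith+
    qed
    have ze_odd: "z \<bullet> e < - real n - 3/8" "- real n - 5/8 < z \<bullet> e" if "odd r"
    proof -
      have "\<bar>z \<bullet> e + (real n + 1/2)\<bar> < 1/8" using ze that by (simp add: dir_def algebra_simps)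
      then show "z \<bullet> e < - real n - 3/8" "- real n - 5/8 < z \<bullet> e" unfolding abs_less_iff by linarith+
    qed
    have abs_ze: "\<bar>z \<bullet> e\<bar> \<le> real n + 5/8" "real n + 3/8 \<le> \<bar>z \<bullet> e\<bar>"
      using ze_even ze_odd by (cases "even r"; fastforce simp: abs_if)+
    have zb': "\<bar>z \<bullet> b' - y r \<bullet> b'\<bar> \<le> 3/8" if "b' \<in> Basis - {e, b}" for b'
      using bspec[OF z[unfolded V_def mem_Collect_eq, THEN conjunct2, THEN conjunct1] that]
      by (rule less_imp_le)
    have zb: "- 3/8 \<le> c * (z \<bullet> b - y r \<bullet> b)" "c * (z \<bullet> b - y r \<bullet> b) \<le> 11/8"
      using z by (simp_all add: V_def)
    have w: "interp w z = w r" if "w (Suc r) = w r" for w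
      by (rule interp_between[OF r that c b yb zb' zb])
    have "\<psi> z = 1"
    proof (rule \<psi>_1)
      fix b' :: 'e assume b': "b' \<in> Basis"
      consider "b' = e" | "b' = b" | "b' \<in> Basis - {e, b}" using b' by auto
      then show "\<bar>z \<bullet> b'\<bar> \<le> real n + 5/8"
      proof cases
        case 1
        then show ?thesis using abs_ze by simp
      next
        case 2
        have le: "\<bar>y r \<bullet> b\<bar> \<le> real n" "\<bar>y r \<bullet> b + c\<bar> \<le> real n"
          using y_le[of r b] y_le[of "Suc r" b] r b by (simp_all add: yb inner_add_left)
        from c have "\<bar>z \<bullet> b\<bar> \<le> real n + 5/8"
        proof
          assume "c = 1"
          then show ?thesis using le zb unfolding \<open>c = 1\<close> mult_1 by linarith
        next
          assume "c = -1"
          then show ?thesis using le zb unfolding \<open>c = -1\<close> mult_minus1 by linarith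
        qed
        then show ?thesis by (simp only: 2)
      next
        case 3
        then show ?thesis using zb'[OF 3] y_le[of r b'] r b' by linarith
      qed
    qed
    then have Fz: "F z = g z"
      using F_far[OF abs_ze(2)] by (simp add: v_def)
    show ?thesis
    proof (cases "even r")
      case True
      then have "\<eta> (z \<bullet> e) = 1" using ze_even by (intro \<eta>_1) simp
      moreover have "wR (Suc r) = wR r" using True by (simp add: wR_def)
      ultimately show ?thesis using True w[of wR] Fz by (simp add: g_def)
    next
      case False
      then have "\<eta> (z \<bullet> e) = 0" using ze_odd by (intro \<eta>_0) simp
      moreover have "wL (Suc r) = wL r" using False by (simp add: wL_def)
      ultimately show ?thesis using False w[of wL] Fz by (simp add: g_def)
    qed
  qed
  ultimately show ?thesis unfolding flat_at_def by blast
qed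

lemma F_left:
  assumes "x \<bullet> e \<le> - real n - 7/8"
  shows "F x = 0"
  using F_far[of x] v_0[OF e, of x] \<sigma>_0[of "x \<bullet> e"] assms by (simp add: u_def)

lemma F_right:
  assumes "x \<bullet> e \<ge> real n + 7/8"
  shows "F x = 1"
  using F_far[of x] v_0[OF e, of x] \<sigma>_1[of "x \<bullet> e"] assms by (simp add: u_def)

text \<open>Far out \<open>F\<close> is \<open>0\<close> or \<open>1\<close> by
  \<open>F_left\<close> and \<open>F_right\<close>. On the rest, parallel to \<open>e\<close> over
  the line of the row, \<open>g\<close> and \<open>u\<close> have the same constant value, so the
  cutoff blends two equal functions and \<open>v\<close> vanishes whatever \<open>\<psi>\<close>
  is.\<close>

lemma flat_tail:
  assumes c: "c = -1 \<and> r = 0 \<or> c = 1 \<and> r = R - 1" and x: "x \<in> tail c r"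
  shows "flat_at x"
proof -
  have r: "r < R" using c R_pos by auto
  have cc: "c * c = 1" using c by auto
  show ?thesis
  proof (cases "c * (x \<bullet> e) > real n + 7/8")
    case True
    define V where "V = {z. c * (z \<bullet> e) > real n + 7/8}"
    have "open V" unfolding V_def by (intro open_Collect_less continuous_intros)
    moreover have "F z = (if c = 1 then 1 else 0)" if "z \<in> V" for z
      using that c F_left[of z] F_right[of z] by (auto simp: V_def)
    ultimately show ?thesis using True unfolding flat_at_def V_def by blast
  next
    case False
    have "x \<notin> closed_segment ((c * (2 * (real n + 1))) *\<^sub>R e) (y r + (c * (real n + 1)) *\<^sub>R e)"
    proof
      assume "x \<in> closed_segment ((c * (2 * (real n + 1))) *\<^sub>R e) (y r + (c * (real n + 1)) *\<^sub>R e)"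
      then obtain t where t: "0 \<le> t" "t \<le> 1"
        "x = (1 - t) *\<^sub>R ((c * (2 * (real n + 1))) *\<^sub>R e) + t *\<^sub>R (y r + (c * (real n + 1)) *\<^sub>R e)"
        unfolding in_segment by auto
      have "x \<bullet> e = c * ((1 - t) * (2 * (real n + 1)) + t * (real n + 1))"
        using e y_e[OF r] by (simp add: t(3) inner_add_left algebra_simps)
      then have "c * (x \<bullet> e) = (2 - t) * (real n + 1)"
        using cc by (simp add: mult.assoc[symmetric]) (simp add: algebra_simps)
      also have "\<dots> \<ge> 1 * (real n + 1)" using t by (intro mult_right_mono) auto
      finally show False using False by simp
    qed
    then have "x \<in> closed_segment (y r + (c * (real n + 1)) *\<^sub>R e) (y r + (c * (real n + 1/2)) *\<^sub>R e)"
      using x by (simp add: tail_def)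
    then obtain t where t: "0 \<le> t" "t \<le> 1"
      "x = (1 - t) *\<^sub>R (y r + (c * (real n + 1)) *\<^sub>R e) + t *\<^sub>R (y r + (c * (real n + 1/2)) *\<^sub>R e)"
      unfolding in_segment by auto
    have lin: "(1 - t) *\<^sub>R (a + q *\<^sub>R e) + t *\<^sub>R (a + q' *\<^sub>R e) = a + ((1 - t) * q + t * q') *\<^sub>R e"
      for a q q' by (simp add: algebra_simps)
    have "(1 - t) * (c * (real n + 1)) + t * (c * (real n + 1/2)) = c * (real n + 1 - t / 2)"
      by (simp add: algebra_simps)
    then have xt: "x = y r + (c * (real n + 1 - t / 2)) *\<^sub>R e" unfolding t(3) lin by simp
    define V where "V = {z. c * (z \<bullet> e) > real n + 3/8 \<and> (\<forall>b\<in>Basis - {e}. \<bar>z \<bullet> b - y r \<bullet> b\<bar> < 3/8)}"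
    have "open V" unfolding V_def
      by (intro open_Collect_conj open_Collect_ball_finite open_Collect_less continuous_intros) simp
    moreover have "x \<in> V"
    proof -
      have "x \<bullet> e = c * (real n + 1 - t / 2)" using e y_e[OF r] by (simp add: xt inner_add_left)
      then have "c * (x \<bullet> e) = real n + 1 - t / 2" using cc by (simp add: mult.assoc[symmetric])
      moreover have "x \<bullet> b = y r \<bullet> b" if "b \<in> Basis - {e}" for b
        using e that by (auto simp: xt inner_add_left inner_Basis)
      ultimately show ?thesis using t by (simp add: V_def)
    qed
    moreover have "F z = (if c = 1 then 1 else 0)" if z: "z \<in> V" for z
    proof -
      have w: "interp w z = w r" for w
        using z by (intro interp_at[OF r] less_imp_le) (auto simp: V_def)
      have ze: "c * (z \<bullet> e) > real n + 3/8" using z by (simp add: V_def)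
      from c show ?thesis
      proof
        assume c: "c = -1 \<and> r = 0"
        then have ze': "z \<bullet> e < - real n - 3/8" using ze by simp
        have "\<eta> (z \<bullet> e) = 0" using ze' by (intro \<eta>_0) linarith
        then have "g z = 0" using c by (simp add: g_def w wL_def)
        moreover have "u z = 0" using ze' unfolding u_def by (intro \<sigma>_0) linarith
        moreover have "F z = u z + v z" using ze' by (intro F_far) linarith
        ultimately show ?thesis using c by (simp add: v_def)
      next
        assume c: "c = 1 \<and> r = R - 1"
        then have ze': "z \<bullet> e > real n + 3/8" using ze by simp
        \<comment> \<open>As \<open>R\<close> is odd, the last index \<open>R - 1\<close> is even;
          the last row thus runs to the right and ends with the full weight
          \<open>R / R\<close>.\<close>
        have "wR r = 1" using c odd_R R_pos by (simp add: wR_def of_nat_diff)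
        moreover have "\<eta> (z \<bullet> e) = 1" using ze' by (intro \<eta>_1) linarith
        ultimately have "g z = 1" by (simp add: g_def w)
        moreover have "u z = 1" using ze' unfolding u_def by (intro \<sigma>_1) linarith
        moreover have "F z = u z + v z" using ze' by (intro F_far) linarith
        ultimately show ?thesis using c by (simp add: v_def)
      qed
    qed
    ultimately show ?thesis unfolding flat_at_def by blast
  qed
qed

lemma flat_E: "x \<in> E \<Longrightarrow> flat_at x"
  by (auto simp: E_def intro: flat_turn flat_tail[of "-1" 0] flat_tail[of 1 "R - 1"])

end

section \<open>The compact connected set \<open>K\<close>\<close>

lemma connected_UN_chain:
  fixes X :: "nat \<Rightarrow> 'v::topological_space set"
  assumes "\<And>i. i \<le> N \<Longrightarrow> connected (X i)" "\<And>i. i < N \<Longrightarrow> X i \<inter> X (Suc i) \<noteq> {}"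
  shows "connected (\<Union>i\<le>N. X i)"
  using assms
proof (induction N)
  case (Suc N)
  have "connected ((\<Union>i\<le>N. X i) \<union> X (Suc N))"
  proof (rule connected_Un)
    show "connected (\<Union>i\<le>N. X i)" using Suc by auto
    show "connected (X (Suc N))" using Suc.prems by auto
    show "(\<Union>i\<le>N. X i) \<inter> X (Suc N) \<noteq> {}" using Suc.prems(2)[of N] by auto
  qed
  then show ?case by (simp add: atMost_Suc Un_commute)
qed simp

context whitney
begin

text \<open>The box is twice as long along \<open>e\<close> as across. Divided by \<open>X\<close>
  its half-length becomes \<open>1/2\<close> and its half-width \<open>1/4\<close>, so copies at
  neighbouring points of a row touch at their ends and rows are linked by arcs alone.\<close>

definition corner :: 'e where
  "corner = (\<Sum>b\<in>Basis. (if b = e then 2 * (real n + 1) else real n + 1) *\<^sub>R b)"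

definition S :: "nat \<times> int \<Rightarrow> 'e \<Rightarrow> 'e" where "S i x = p i + (1 / X) *\<^sub>R x"

primrec stage :: "nat \<Rightarrow> 'e set" where
  "stage 0 = cbox (- corner) corner"
| "stage (Suc l) = E \<union> (\<Union>i\<in>I. S i ` stage l)"

text \<open>The invariant set of the contractions \<open>S i\<close> with condensation set
  \<open>E\<close>. Approximating it from outside lets compactness and connectedness pass to the
  nested intersection.\<close>

definition K :: "'e set" where "K = (\<Inter>l. stage l)"

lemma corner_inner: "b \<in> Basis \<Longrightarrow> corner \<bullet> b = (if b = e then 2 * (real n + 1) else real n + 1)"
  unfolding corner_def by (rule inner_sum_left_Basis)

lemma mem_stage_0:
  "x \<in> stage 0 \<longleftrightarrow> \<bar>x \<bullet> e\<bar> \<le> 2 * (real n + 1) \<and> (\<forall>b\<in>Basis-{e}. \<bar>x \<bullet> b\<bar> \<le> real n + 1)"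
proof -
  have "x \<in> stage 0 \<longleftrightarrow> (\<forall>b\<in>Basis. \<bar>x \<bullet> b\<bar> \<le> corner \<bullet> b)"
    by (auto simp: mem_box abs_le_iff minus_le_iff)
  also have "\<dots> \<longleftrightarrow> \<bar>x \<bullet> e\<bar> \<le> 2 * (real n + 1) \<and> (\<forall>b\<in>Basis-{e}. \<bar>x \<bullet> b\<bar> \<le> real n + 1)"
    using e by (auto simp: corner_inner)
  finally show ?thesis .
qed

lemma y_in_stage_0:
  assumes "r < R" "\<bar>c\<bar> \<le> 2 * (real n + 1)"
  shows "y r + c *\<^sub>R e \<in> stage 0"
  using assms e y_e[OF assms(1)] y_le[OF assms(1)]
  by (force simp: mem_stage_0 inner_add_left inner_Basis simp del: stage.simps)

lemma segment_in_stage_0: "a \<in> stage 0 \<Longrightarrow> b \<in> stage 0 \<Longrightarrow> closed_segment a b \<subseteq> stage 0"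
  by (simp add: closed_segment_subset)

lemma e_in_stage_0: "\<bar>c\<bar> \<le> 2 * (real n + 1) \<Longrightarrow> c *\<^sub>R e \<in> stage 0"
  using e by (force simp: mem_stage_0 inner_Basis simp del: stage.simps)

lemma E_subset: "E \<subseteq> stage 0"
proof -
  have 1: "tail c r \<subseteq> stage 0" if "\<bar>c\<bar> = 1" "r < R" for c r
    unfolding tail_def using that
    by (intro Un_least segment_in_stage_0 y_in_stage_0 e_in_stage_0) (auto simp: abs_mult)
  have 2: "turn r \<subseteq> stage 0" if "Suc r < R" for r
    unfolding turn_def using that
    by (intro segment_in_stage_0 y_in_stage_0) (auto simp: abs_mult dir_def)
  show ?thesis unfolding E_def using R_pos by (intro Un_least UN_least 1 2) auto
qed

lemma stage_Suc_subset: "stage (Suc l) \<subseteq> stage l"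
proof (induction l)
  case 0
  have "S i x \<in> stage 0" if i: "i \<in> I" and x: "x \<in> stage 0" for i x
  proof -
    have half: "\<bar>x \<bullet> b\<bar> / X \<le> 1/2" if b: "b \<in> Basis" for b
    proof -
      have "\<bar>x \<bullet> b\<bar> \<le> 2 * (real n + 1)" using x b unfolding mem_stage_0 by (cases "b = e") force+
      then show ?thesis using X_pos by (simp add: X_def divide_le_eq)
    qed
    have 1: "\<bar>S i x \<bullet> b\<bar> \<le> real n + 1/2" if b: "b \<in> Basis" for b
    proof -
      have "\<bar>x \<bullet> b / X\<bar> \<le> 1/2" using half[OF b] X_pos by simp
      moreover have "S i x \<bullet> b = p i \<bullet> b + x \<bullet> b / X" by (simp add: S_def inner_add_left)
      ultimately show ?thesis using p_le[OF i b] by linarith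
    qed
    show ?thesis
      unfolding mem_stage_0 using e by (force intro: order_trans[OF 1])
  qed
  then show ?case using E_subset by (auto simp del: stage.simps(1))
next
  case (Suc l)
  have "(\<Union>i\<in>I. S i ` stage (Suc l)) \<subseteq> (\<Union>i\<in>I. S i ` stage l)"
    by (intro UN_mono order_refl image_mono Suc)
  then have "E \<union> (\<Union>i\<in>I. S i ` stage (Suc l)) \<subseteq> E \<union> (\<Union>i\<in>I. S i ` stage l)" by blast
  then show ?case by (simp only: stage.simps(2))
qed

lemma stage_antimono: "l \<le> l' \<Longrightarrow> stage l' \<subseteq> stage l"
  using lift_Suc_antimono_le[of stage, OF stage_Suc_subset] by blast

lemma compact_stage: "compact (stage l)"
proof (induction l)
  case (Suc l)
  have "finite {r. Suc r < R}" by (rule finite_subset[of _ "{..<R}"]) auto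
  then have "compact E" unfolding E_def tail_def turn_def by (intro compact_Un compact_UN compact_segment) auto
  moreover have "compact (S i ` stage l)" for i
    unfolding S_def by (intro compact_continuous_image Suc continuous_intros)
  ultimately show ?case unfolding stage.simps by (intro compact_Un compact_UN finite_I)
qed simp

definition end_pt :: 'e where "end_pt = (2 * (real n + 1)) *\<^sub>R e"

lemma end_pt_in: "end_pt \<in> stage l" "- end_pt \<in> stage l"
proof -
  have "(c * (2 * (real n + 1))) *\<^sub>R e \<in> tail c r" for c r
    unfolding tail_def by (intro UnI1 ends_in_segment)
  from this[of 1 "R - 1"] this[of "-1" 0]
  have "end_pt \<in> tail 1 (R - 1)" "- end_pt \<in> tail (- 1) 0"
    by (simp_all only: end_pt_def mult_1 mult_minus1 scaleR_minus_left)
  then have "end_pt \<in> E" "- end_pt \<in> E" unfolding E_def by blast+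
  moreover have "end_pt \<in> stage 0" "- end_pt \<in> stage 0"
    using e_in_stage_0[of "2 * (real n + 1)"] e_in_stage_0[of "- (2 * (real n + 1))"]
    unfolding end_pt_def scaleR_minus_left by simp_all
  ultimately show "end_pt \<in> stage l" "- end_pt \<in> stage l" by (cases l; auto)+
qed

lemma S_end_pt:
  "S i end_pt = p i + (1/2) *\<^sub>R e" "S i (- end_pt) = p i - (1/2) *\<^sub>R e"
proof -
  have "(1 / X) * (2 * (real n + 1)) = 1/2" by (simp add: X_def field_simps)
  then show "S i end_pt = p i + (1/2) *\<^sub>R e" "S i (- end_pt) = p i - (1/2) *\<^sub>R e"
    unfolding S_def end_pt_def scaleR_minus_right scaleR_scaleR by simp_all
qed

definition row :: "nat \<Rightarrow> nat \<Rightarrow> 'e set" where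
  "row l r = (\<Union>j\<le>2*n. S (r, int j - int n) ` stage l)"

text \<open>Consecutive copies share the midpoint of their centres, the right end of one and the
  left end of the next. The sign \<open>dir q\<close> is left free because a turn meets the row it
  leaves and the row it enters on the same side.\<close>

lemma row_props:
  assumes "connected (stage l)"
  shows "connected (row l r)" "y r + (dir q * (real n + 1/2)) *\<^sub>R e \<in> row l r"
    "y r + (- (real n + 1/2)) *\<^sub>R e \<in> row l r" "y r + (real n + 1/2) *\<^sub>R e \<in> row l r"
proof -
  show "connected (row l r)"
    unfolding row_def
  proof (rule connected_UN_chain)
    show "connected (S (r, int j - int n) ` stage l)" for j
      unfolding S_def by (intro connected_continuous_image assms continuous_intros)
    fix j
    have "S (r, int j - int n) end_pt = S (r, int (Suc j) - int n) (- end_pt)"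
      by (simp add: S_end_pt p_def algebra_simps flip: scaleR_add_left)
    then show "S (r, int j - int n) ` stage l \<inter> S (r, int (Suc j) - int n) ` stage l \<noteq> {}"
      using end_pt_in by blast
  qed
  have "S (r, int (2*n) - int n) end_pt \<in> row l r" "S (r, int 0 - int n) (- end_pt) \<in> row l r"
    unfolding row_def using end_pt_in by blast+
  then show 1: "y r + (- (real n + 1/2)) *\<^sub>R e \<in> row l r" "y r + (real n + 1/2) *\<^sub>R e \<in> row l r"
    by (simp_all add: S_end_pt p_def algebra_simps)
  then show "y r + (dir q * (real n + 1/2)) *\<^sub>R e \<in> row l r"
    by (auto simp: dir_def)
qed

text \<open>Groups each row with the turn that leaves it, in the order of the path, so that
  connectedness follows along a chain of sets indexed by \<open>r\<close>.\<close>

lemma stage_Suc_eq: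
  "stage (Suc l) = tail (-1) 0 \<union> (\<Union>r\<le>R-1. row l r \<union> (if Suc r < R then turn r else {})) \<union> tail 1 (R - 1)"
proof -
  have 1: "(\<Union>i\<in>I. S i ` stage l) = (\<Union>r\<in>{..<R}. \<Union>j\<in>{- int n..int n}. S (r, j) ` stage l)"
    by (auto simp: I_def)
  have "(\<lambda>j. int j - int n) ` {..2*n} = {- int n..int n}"
  proof
    show "{- int n..int n} \<subseteq> (\<lambda>j. int j - int n) ` {..2*n}"
    proof
      fix j assume "j \<in> {- int n..int n}"
      then have "j = int (nat (j + int n)) - int n" "nat (j + int n) \<in> {..2*n}" by auto
      then show "j \<in> (\<lambda>j. int j - int n) ` {..2*n}" by blast
    qed
  qed auto
  then have 2: "(\<Union>j\<in>{- int n..int n}. S (r, j) ` stage l) = row l r" for r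
    unfolding row_def by (simp only: image_image flip: \<open>(\<lambda>j. int j - int n) ` {..2*n} = {- int n..int n}\<close>)
  have 3: "{..<R} = {..R-1}" using R_pos by auto
  have 4: "(\<Union>r\<in>{r. Suc r < R}. turn r) = (\<Union>r\<in>{..<R}. if Suc r < R then turn r else {})"
    by (auto simp: Bex_def intro: Suc_lessD)
  show ?thesis unfolding stage.simps E_def 4 1 2 3 UN_Un_distrib by blast
qed

lemma connected_stage: "connected (stage l)"
proof (induction l)
  case (Suc l)
  have turn: "y r + (dir r * (real n + 1/2)) *\<^sub>R e \<in> turn r"
    "y (Suc r) + (dir r * (real n + 1/2)) *\<^sub>R e \<in> turn r" "connected (turn r)" for r
    by (simp_all add: turn_def connected_segment)
  have tail: "connected (tail c r)" "y r + (c * (real n + 1/2)) *\<^sub>R e \<in> tail c r" for c r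
    unfolding tail_def by (intro connected_Un connected_segment) auto
  have "connected (\<Union>r\<le>R-1. row l r \<union> (if Suc r < R then turn r else {}))"
  proof (rule connected_UN_chain)
    fix r
    show "connected (row l r \<union> (if Suc r < R then turn r else {}))"
      using turn(1,3)[of r] row_props(1)[OF Suc, of r] row_props(2)[OF Suc, of r r]
      by (auto intro!: connected_Un)
    assume "r < R - 1"
    then have "Suc r < R" by simp
    \<comment> \<open>The far end of \<open>turn r\<close> is an end point of row
      \<open>Suc r\<close>, on the side given by \<open>dir r\<close>.\<close>
    then have "y (Suc r) + (dir r * (real n + 1/2)) *\<^sub>R e
        \<in> row l r \<union> (if Suc r < R then turn r else {})"
      "y (Suc r) + (dir r * (real n + 1/2)) *\<^sub>R e
        \<in> row l (Suc r) \<union> (if Suc (Suc r) < R then turn (Suc r) else {})"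
      using turn(2)[of r] row_props(2)[OF Suc, of "Suc r" r] by auto
    then show "(row l r \<union> (if Suc r < R then turn r else {})) \<inter>
        (row l (Suc r) \<union> (if Suc (Suc r) < R then turn (Suc r) else {})) \<noteq> {}"
      by blast
  qed
  moreover have "y 0 + (-1 * (real n + 1/2)) *\<^sub>R e \<in> row l 0" "y (R-1) + (1 * (real n + 1/2)) *\<^sub>R e \<in> row l (R-1)"
    using row_props(3,4)[OF Suc] by simp_all
  then have "y 0 + (-1 * (real n + 1/2)) *\<^sub>R e \<in> (\<Union>r\<le>R-1. row l r \<union> (if Suc r < R then turn r else {}))"
    "y (R-1) + (1 * (real n + 1/2)) *\<^sub>R e \<in> (\<Union>r\<le>R-1. row l r \<union> (if Suc r < R then turn r else {}))"
    by blast+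
  ultimately show ?case
    unfolding stage_Suc_eq using tail(1) tail(2)[of 0 "-1"] tail(2)[of "R-1" 1]
    by (intro connected_Un) blast+
qed (simp add: convex_connected)

lemma compact_K: "compact K"
  unfolding K_def using compact_stage by (intro compact_Inter) auto

lemma connected_K: "connected K"
  unfolding K_def by (rule connected_nest[OF compact_stage connected_stage stage_antimono])

lemma end_pt_in_K: "end_pt \<in> K" "- end_pt \<in> K"
  using end_pt_in by (auto simp: K_def)

text \<open>One half of the fixed point equation of \<open>K\<close>. If every rescaled point failed
  at some stage, all would fail at one common later stage, since \<open>I\<close> is finite and the
  stages decrease.\<close>

lemma mem_K_cases:
  assumes "x \<in> K"
  obtains "x \<in> E" | i x' where "i \<in> I" "x' \<in> K" "x = S i x'"
proof (cases "x \<in> E")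
  case False
  define g where "g i = X *\<^sub>R (x - p i)" for i
  have Sg: "S i (g i) = x" for i using X_pos by (simp add: S_def g_def)
  have gS: "z = g i" if "x = S i z" for i z using X_pos that by (simp add: S_def g_def)
  have "\<exists>i\<in>I. g i \<in> K"
  proof (rule ccontr)
    assume "\<not> (\<exists>i\<in>I. g i \<in> K)"
    then obtain l where l: "\<And>i. i \<in> I \<Longrightarrow> g i \<notin> stage (l i)" unfolding K_def by auto metis
    define l' where "l' = Max (l ` I)"
    have "x \<in> stage (Suc l')" using assms by (auto simp: K_def simp del: stage.simps)
    then obtain i where i: "i \<in> I" "g i \<in> stage l'" using False gS by auto
    have "l i \<le> l'" using finite_I i(1) by (simp add: l'_def)
    then show False using stage_antimono l[OF i(1)] i(2) by blast
  qed
  then show ?thesis using that Sg by metis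
qed

section \<open>Vanishing of the gradient on \<open>K\<close>\<close>

lemma F_differentiable: "F differentiable (at x)"
  using Ck_holder_F k by (cases k) auto

lemma continuous_dF: "b \<in> Basis \<Longrightarrow> continuous_on UNIV (\<lambda>x. frechet_derivative F (at x) b)"
  using Ck_holder_on_imp_Ck_on[OF Ck_holder_F] k Ck_on_mono[of 1 k UNIV F] by simp

text \<open>Self-similarity contracts the gradient by the factor \<open>\<epsilon> * X < 1\<close>, so its maximum
  on \<open>K\<close> can only be \<open>0\<close>.\<close>

lemma critical_K:
  assumes "x \<in> K" "b \<in> Basis"
  shows "frechet_derivative F (at x) b = 0"
proof -
  have der: "(F has_derivative frechet_derivative F (at x)) (at x)" for x
    using F_differentiable by (simp add: frechet_derivative_works)
  define N where "N x = (\<Sum>b\<in>Basis. \<bar>frechet_derivative F (at x) b\<bar>)" for x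
  have "continuous_on UNIV N"
    unfolding N_def by (intro continuous_intros continuous_dF)
  then have "continuous_on K N" by (rule continuous_on_subset) simp
  then obtain x0 where x0: "x0 \<in> K" "\<And>x. x \<in> K \<Longrightarrow> N x \<le> N x0"
    using continuous_attains_sup[OF compact_K] end_pt_in_K by blast
  have N_nonneg: "0 \<le> N x" for x by (simp add: N_def sum_nonneg)
  from x0(1) have "N x0 \<le> 0"
  proof (cases rule: mem_K_cases)
    case 1
    then obtain V c where V: "open V" "x0 \<in> V" "\<forall>z\<in>V. F z = c"
      using flat_E unfolding flat_at_def by blast
    have "frechet_derivative (\<lambda>z. c) (at x0) = frechet_derivative F (at x0)"
      by (rule frechet_derivative_transform_within_open[OF _ V(1,2)]) (use V(3) in auto)
    then have "frechet_derivative F (at x0) b = 0" for b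
      by (metis frechet_derivative_const)
    then show ?thesis by (simp add: N_def)
  next
    case (2 i x')
    \<comment> \<open>An open neighbourhood of the box on which the self-similarity holds, so that
      it may be differentiated at \<open>x'\<close>.\<close>
    define W where "W = {x. (\<forall>b\<in>Basis - {e}. \<bar>x \<bullet> b\<bar> < 3/2 * (real n + 1)) \<and> \<bar>x \<bullet> e\<bar> < 5/2 * (real n + 1)}"
    have W: "open W" unfolding W_def
      by (intro open_Collect_conj open_Collect_ball_finite open_Collect_less continuous_intros) simp
    have "x' \<in> stage 0" using 2 by (auto simp: K_def simp del: stage.simps)
    then have x': "x' \<in> W" unfolding mem_stage_0 W_def by force
    have "((\<lambda>x. S i x) has_derivative (\<lambda>v. (1 / X) *\<^sub>R v)) (at x')"
      unfolding S_def by (auto intro!: derivative_eq_intros)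
    have d1: "((\<lambda>x. F (S i x)) has_derivative (\<lambda>v. frechet_derivative F (at x0) ((1 / X) *\<^sub>R v))) (at x')"
      using has_derivative_compose[OF \<open>((\<lambda>x. S i x) has_derivative (\<lambda>v. (1 / X) *\<^sub>R v)) (at x')\<close> der] 2 by simp
    have "((\<lambda>x. base i + sg i * F x) has_derivative (\<lambda>v. sg i * frechet_derivative F (at x') v)) (at x')"
      by (auto intro!: derivative_eq_intros der)
    then have d2: "((\<lambda>x. F (S i x)) has_derivative (\<lambda>v. sg i * frechet_derivative F (at x') v)) (at x')"
      by (rule has_derivative_transform_within_open[OF _ W x'])
        (use F_self_similar[OF 2(1)] in \<open>simp add: S_def W_def\<close>)
    have eq: "frechet_derivative F (at x0) ((1 / X) *\<^sub>R v) = sg i * frechet_derivative F (at x') v" for v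
      using has_derivative_unique[OF d1 d2] by metis
    have "frechet_derivative F (at x0) v = (X * sg i) * frechet_derivative F (at x') v" for v
    proof -
      have "frechet_derivative F (at x0) v = frechet_derivative F (at x0) ((1 / X) *\<^sub>R (X *\<^sub>R v))"
        using X_pos by simp
      also have "\<dots> = sg i * frechet_derivative F (at x') (X *\<^sub>R v)" by (rule eq)
      also have "\<dots> = (X * sg i) * frechet_derivative F (at x') v"
        using linear_cmul[OF has_derivative_linear[OF der[of x']], of X v] by simp
      finally show ?thesis .
    qed
    then have "N x0 = (\<epsilon> * X) * N x'"
      using X_pos by (simp add: N_def abs_mult abs_sg sum_distrib_left mult_ac)
    also have "\<dots> \<le> (\<epsilon> * X) * N x0" using x0(2)[OF 2(2)] \<epsilon>_pos X_pos by (intro mult_left_mono) auto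
    finally have "N x0 * (1 - \<epsilon> * X) \<le> 0" by (simp add: algebra_simps)
    then show ?thesis using \<epsilon>_X by (simp add: mult_le_0_iff)
  qed
  then have "N x = 0" using x0(2)[OF assms(1)] N_nonneg[of x] by linarith
  then show ?thesis using assms(2) by (simp add: N_def sum_nonneg_eq_0_iff)
qed

lemma ex_compactly_supported:
  "\<exists>(f :: 'e \<Rightarrow> real) K r. Ck_holder_on k s UNIV f \<and> compact K \<and> connected K \<and>
    (\<forall>x\<in>K. \<forall>b\<in>Basis. frechet_derivative f (at x) b = 0) \<and> \<not> f constant_on K \<and>
    (\<forall>x. norm x > r \<longrightarrow> f x = 0)"
proof -
  \<comment> \<open>\<open>F\<close> is \<open>1\<close> far to the right and has to be cut off. The
    cutoff is \<open>1\<close> where all coordinates are below \<open>c - 1/8\<close> in absolute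
    value, hence around \<open>K\<close>, whose coordinates are at most
    \<open>2 * (n + 1)\<close>.\<close>
  define c where "c = 3 * (real n + 1)"
  define \<zeta> where "\<zeta> x = (\<Prod>b\<in>Basis. \<sigma> (x \<bullet> b + c) - \<sigma> (x \<bullet> b - c))" for x :: 'e
  define f where "f x = F x * \<zeta> x" for x
  have "Ck_holder_on (Suc k) 0 UNIV \<zeta>" unfolding \<zeta>_def by (intro Ck_intros) auto
  then have "Ck_holder_on k s UNIV \<zeta>" by (rule Ck_holder_on_Suc_imp_Ck_holder_on[OF open_UNIV s])
  then have 1: "Ck_holder_on k s UNIV f"
    unfolding f_def by (intro Ck_holder_on_mult[OF open_UNIV s] Ck_holder_F)
  define V where "V = {x::'e. \<forall>b\<in>Basis. \<bar>x \<bullet> b\<bar> < c - 1/8}"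
  have V: "open V" unfolding V_def
    by (intro open_Collect_ball_finite open_Collect_less continuous_intros) simp
  have "\<zeta> x = 1" if "x \<in> V" for x
    unfolding \<zeta>_def
  proof (rule prod.neutral, intro ballI)
    fix b :: 'e assume "b \<in> Basis"
    then have "\<bar>x \<bullet> b\<bar> < c - 1/8" using that by (simp add: V_def)
    then have "\<sigma> (x \<bullet> b + c) = 1" "\<sigma> (x \<bullet> b - c) = 0" by (auto intro!: \<sigma>_1 \<sigma>_0 simp: abs_less_iff)
    then show "\<sigma> (x \<bullet> b + c) - \<sigma> (x \<bullet> b - c) = 1" by simp
  qed
  then have fF: "f x = F x" if "x \<in> V" for x using that by (simp add: f_def)
  have KV: "K \<subseteq> V"
  proof
    fix x assume "x \<in> K"
    then have "x \<in> stage 0" by (auto simp: K_def simp del: stage.simps)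
    then have "\<bar>x \<bullet> b\<bar> \<le> 2 * (real n + 1)" if "b \<in> Basis" for b
      using that unfolding mem_stage_0 by (cases "b = e") force+
    then show "x \<in> V" unfolding V_def c_def by force
  qed
  have 2: "frechet_derivative f (at x) b = 0" if "x \<in> K" "b \<in> Basis" for x b
  proof -
    have "frechet_derivative F (at x) = frechet_derivative f (at x)"
      by (rule frechet_derivative_transform_within_open[OF F_differentiable V])
        (use that KV fF in auto)
    then show ?thesis using critical_K[OF that] by simp
  qed
  have "F end_pt = 1" "F (- end_pt) = 0"
    using e by (auto intro!: F_right F_left simp: end_pt_def)
  then have "f end_pt = 1" "f (- end_pt) = 0" using fF KV end_pt_in_K by auto
  then have 3: "\<not> f constant_on K" using end_pt_in_K unfolding constant_on_def by (metis zero_neq_one)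
  have 4: "f x = 0" if x: "norm x > real DIM('e) * (c + 1)" for x
  proof -
    have "\<exists>b\<in>Basis. \<bar>x \<bullet> b\<bar> > c + 1"
    proof (rule ccontr)
      assume "\<not> ?thesis"
      then have "(\<Sum>b\<in>Basis. \<bar>x \<bullet> b\<bar>) \<le> (\<Sum>b\<in>(Basis::'e set). c + 1)" by (intro sum_mono) (auto simp: not_less)
      then show False using x norm_le_l1[of x] by simp
    qed
    then obtain b where b: "b \<in> Basis" "\<bar>x \<bullet> b\<bar> > c + 1" by auto
    have "c > 0" by (simp add: c_def)
    then have "\<sigma> (x \<bullet> b + c) - \<sigma> (x \<bullet> b - c) = 0"
      using b(2) by (cases "x \<bullet> b \<ge> 0") (simp_all add: \<sigma>_1 \<sigma>_0)
    then have "\<zeta> x = 0" unfolding \<zeta>_def using b(1) by (intro prod_zero) auto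
    then show ?thesis by (simp add: f_def)
  qed
  show ?thesis
    using 1 2 3 4 compact_K connected_K
    by (intro exI[of _ f] exI[of _ K] exI[of _ "real DIM('e) * (c + 1)"] conjI) auto
qed

end

section \<open>Choice of the parameters\<close>

lemma whitney_function:
  fixes s :: real
  assumes dim: "DIM('e::euclidean_space) \<ge> 2" and s: "0 \<le> s" "s < 1"
  shows "\<exists>(f :: 'e \<Rightarrow> real) K r. Ck_holder_on (DIM('e) - 1) s UNIV f \<and> compact K \<and> connected K \<and>
    (\<forall>x\<in>K. \<forall>b\<in>Basis. frechet_derivative f (at x) b = 0) \<and> \<not> f constant_on K \<and>
    (\<forall>x. norm x > r \<longrightarrow> f x = 0)"
proof -
  define k where "k = DIM('e) - 1"
  have k: "1 \<le> k" using dim by (simp add: k_def)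
  obtain e :: 'e where e: "e \<in> Basis" using nonempty_Basis by blast
  obtain \<sigma> :: "real \<Rightarrow> real" where \<sigma>: "Ck_on (Suc k) UNIV \<sigma>" "\<forall>t\<le>- (1/8). \<sigma> t = 0" "\<forall>t\<ge>1/8. \<sigma> t = 1"
    using ex_Ck_step[of "1/8" "Suc k"] by auto
  \<comment> \<open>The locale asks for \<open>c powr (k + s) < (2 n + 1) ^ Suc k\<close> with
    \<open>c = 4 (n + 1)\<close>. As \<open>c \<le> 4 (2 n + 1)\<close>, it is enough that
    \<open>B < c powr (1 - s)\<close>, and this determines \<open>n\<close>.\<close>
  define B where "B = (4::real) ^ Suc k"
  obtain n :: nat where n: "real n > B powr (1 / (1 - s))" using reals_Archimedean2 by blast
  define c where "c = 4 * (real n + 1)"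
  have c: "c > 0" by (simp add: c_def)
  define R where "R = (2*n+1) ^ k"
  have "B powr (1 / (1 - s)) < c" using n by (simp add: c_def)
  then have "(B powr (1 / (1 - s))) powr (1 - s) < c powr (1 - s)"
    using s by (intro powr_less_mono2) auto
  moreover have "(B powr (1 / (1 - s))) powr (1 - s) = B"
    using s by (simp add: powr_powr B_def)
  ultimately have Bc: "B < c powr (1 - s)" by simp
  have "c powr (real k + s) * B < c powr (real k + s) * c powr (1 - s)"
    using Bc c by (intro mult_strict_left_mono) auto
  also have "\<dots> = c powr (real (Suc k))" by (simp add: powr_add[symmetric] add_ac)
  also have "\<dots> = c ^ Suc k" using c by (simp only: powr_realpow)
  also have "\<dots> \<le> (4 * (2 * real n + 1)) ^ Suc k" by (intro power_mono) (auto simp: c_def)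
  also have "\<dots> = (2 * real n + 1) ^ Suc k * B" by (simp only: power_mult_distrib B_def mult.commute)
  also have "(2 * real n + 1) ^ Suc k = real R * (2 * real n + 1)" by (simp add: R_def add.commute)
  finally have size: "c powr (real k + s) < real R * (2 * real n + 1)"
    by (simp add: B_def del: power_Suc)
  have card: "card (Basis - {e}) = k" using e by (simp add: k_def)
  obtain y :: "nat \<Rightarrow> 'e" where
    y: "\<forall>r<R. (\<forall>b\<in>Basis-{e}. y r \<bullet> b \<in> \<int> \<and> \<bar>y r \<bullet> b\<bar> \<le> real n) \<and> (\<forall>b\<in>Basis-(Basis-{e}). y r \<bullet> b = 0)"
    and inj: "inj_on y {..<R}"
    and adj: "\<forall>r. Suc r < R \<longrightarrow> (\<exists>b\<in>Basis-{e}. y (Suc r) = y r + b \<or> y (Suc r) = y r - b)"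
    using ex_grid_path[of "Basis - {e}" n] unfolding card R_def[symmetric] by auto
  have ye: "y r \<bullet> e = 0" if "r < R" for r using y that e by auto
  interpret whitney e n k R s \<sigma> y
  proof
    show "y r \<bullet> b \<in> \<int>" if "r < R" "b \<in> Basis" for r b
      using y ye that by (cases "b = e") auto
    show "\<bar>y r \<bullet> b\<bar> \<le> real n" if "r < R" "b \<in> Basis" for r b
      using y ye that by (cases "b = e") auto
    show "odd R" by (simp add: R_def)
    show "(4 * (real n + 1)) powr (real k + s) < real R * (2 * real n + 1)"
      using size by (simp add: c_def)
  qed (use e \<sigma> ye inj adj s k in auto)
  show ?thesis using ex_compactly_supported unfolding k_def by blast
qed

section \<open>Charts and covectors\<close>

lemma whitney_function_Ck_holder:
  fixes d' :: nat and s :: real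
  assumes dim: "DIM('e::euclidean_space) \<ge> 2"
    and ds: "(d' < DIM('e) - 1 \<and> 0 \<le> s \<and> s \<le> 1) \<or> (d' = DIM('e) - 1 \<and> 0 \<le> s \<and> s < 1)"
  shows "\<exists>(f :: 'e \<Rightarrow> real) K r. Ck_holder_on d' s UNIV f \<and> Ck_on 1 UNIV f \<and> compact K \<and> connected K \<and>
    (\<forall>x\<in>K. \<forall>b\<in>Basis. frechet_derivative f (at x) b = 0) \<and> \<not> f constant_on K \<and>
    (\<forall>x. norm x > r \<longrightarrow> f x = 0)"
proof -
  \<comment> \<open>Below the top order a function of class \<open>d - 1\<close> has a derivative to
    spare, which yields every exponent up to \<open>1\<close>. Taking \<open>s' = 0\<close> there
    keeps \<open>s' < 1\<close> even for \<open>s = 1\<close>.\<close>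
  define s' where "s' = (if d' = DIM('e) - 1 then s else 0)"
  have "0 \<le> s'" "s' < 1" using ds by (auto simp: s'_def)
  then obtain f :: "'e \<Rightarrow> real" and K r where f: "Ck_holder_on (DIM('e) - 1) s' UNIV f"
    and K: "compact K" "connected K" "\<forall>x\<in>K. \<forall>b\<in>Basis. frechet_derivative f (at x) b = 0" "\<not> f constant_on K"
    and r: "\<forall>x. norm x > r \<longrightarrow> f x = 0"
    using whitney_function[OF dim] by metis
  have Ck: "Ck_on (DIM('e) - 1) UNIV f" using f by (rule Ck_holder_on_imp_Ck_on)
  have "Ck_on 1 UNIV f" by (rule Ck_on_mono[OF _ Ck]) (use dim in simp)
  moreover have "Ck_holder_on d' s UNIV f"
  proof (cases "d' = DIM('e) - 1")
    case True
    then show ?thesis using f by (simp add: s'_def)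
  next
    case False
    then have "Ck_on (Suc d') UNIV f" by (intro Ck_on_mono[OF _ Ck]) (use ds in simp)
    then show ?thesis using False ds by (intro Ck_on_Suc_imp_Ck_holder_on open_UNIV) auto
  qed
  ultimately show ?thesis using K r by (intro exI[of _ f] exI[of _ K] exI[of _ r]) simp
qed

lemma whitney_function_in_open_set:
  fixes d' :: nat and s :: real and U :: "'e::euclidean_space set"
  assumes dim: "DIM('e) \<ge> 2"
    and ds: "(d' < DIM('e) - 1 \<and> 0 \<le> s \<and> s \<le> 1) \<or> (d' = DIM('e) - 1 \<and> 0 \<le> s \<and> s < 1)"
    and U: "open U" "U \<noteq> {}"
  shows "\<exists>(f :: 'e \<Rightarrow> real) K C. Ck_holder_on d' s UNIV f \<and> Ck_on 1 UNIV f \<and> compact K \<and> connected K \<and>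
    K \<subseteq> U \<and> (\<forall>x\<in>K. (f has_derivative (\<lambda>_. 0)) (at x)) \<and> \<not> f constant_on K \<and>
    compact C \<and> C \<subseteq> U \<and> (\<forall>x. x \<notin> C \<longrightarrow> f x = 0)"
proof -
  obtain x0 \<rho> where \<rho>: "\<rho> > 0" "cball x0 \<rho> \<subseteq> U" using U open_contains_cball by blast
  obtain f :: "'e \<Rightarrow> real" and K r where f: "Ck_holder_on d' s UNIV f" "Ck_on 1 UNIV f"
    and K: "compact K" "connected K" "\<forall>x\<in>K. \<forall>b\<in>Basis. frechet_derivative f (at x) b = 0" "\<not> f constant_on K"
    and r: "\<forall>x. norm x > r \<longrightarrow> f x = 0"
    using whitney_function_Ck_holder[OF dim ds] by metis
  obtain B where B: "B > 0" "\<forall>x\<in>K. norm x \<le> B"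
    using compact_imp_bounded[OF K(1)] bounded_pos by metis
  \<comment> \<open>Rescales the ball of radius \<open>max r B\<close>, which contains
    \<open>K\<close> and outside which \<open>f\<close> vanishes, to the ball of radius
    \<open>\<rho>\<close> inside \<open>U\<close>; \<open>B > 0\<close> keeps \<open>a\<close>
    positive.\<close>
  define a where "a = max r B / \<rho>"
  have a: "a > 0" using B \<rho> by (simp add: a_def)
  define \<phi> where "\<phi> x = a *\<^sub>R x + (- a) *\<^sub>R x0" for x :: 'e
  define \<phi>' where "\<phi>' x = x0 + (1 / a) *\<^sub>R x" for x :: 'e
  have \<phi>\<phi>': "\<phi> (\<phi>' x) = x" for x using a by (simp add: \<phi>_def \<phi>'_def algebra_simps)
  have "bounded_linear (\<lambda>x::'e. a *\<^sub>R x)" by (rule bounded_linear_scaleR_right)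
  then have "Ck_holder_on (Suc k) 0 UNIV \<phi>" for k
    unfolding \<phi>_def by (intro Ck_holder_on_add[OF open_UNIV] bounded_linear_Ck_holder_on Ck_holder_on_const)
  then have Ck\<phi>: "Ck_on (Suc k) UNIV \<phi>" for k by (rule Ck_holder_on_imp_Ck_on)
  define h where "h x = f (\<phi> x)" for x
  have s: "0 \<le> s" "s \<le> 1" using ds by auto
  have 1: "Ck_holder_on d' s UNIV h"
    unfolding h_def by (rule Ck_holder_on_compose[OF open_UNIV open_UNIV s subset_UNIV f(1) Ck\<phi>])
  have "Ck_holder_on 1 0 UNIV f" using f(2) by (simp only: Ck_on_iff_Ck_holder_on_0)
  then have "Ck_holder_on 1 0 UNIV h"
    unfolding h_def by (rule Ck_holder_on_compose[OF open_UNIV open_UNIV order_refl zero_le_one subset_UNIV _ Ck\<phi>])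
  then have 2: "Ck_on 1 UNIV h" by (rule Ck_holder_on_imp_Ck_on)
  have 3: "(h has_derivative (\<lambda>_. 0)) (at x)" if x: "x \<in> \<phi>' ` K" for x
  proof -
    have \<phi>x: "\<phi> x \<in> K" using x \<phi>\<phi>' by auto
    have d: "(f has_derivative frechet_derivative f (at (\<phi> x))) (at (\<phi> x))"
      using f(2) by (simp add: frechet_derivative_works[symmetric])
    have 0: "frechet_derivative f (at (\<phi> x)) v = 0" for v
      using norm_linear_le_Basis[OF has_derivative_bounded_linear[OF d], of 0 v] K(3) \<phi>x by simp
    have "(\<phi> has_derivative (\<lambda>v. a *\<^sub>R v)) (at x)"
      unfolding \<phi>_def by (auto intro!: derivative_eq_intros)
    from has_derivative_compose[OF this d] show ?thesis by (simp add: h_def[abs_def] 0)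
  qed
  have "\<not> h constant_on \<phi>' ` K" using K(4) \<phi>\<phi>' by (auto simp: constant_on_def h_def)
  moreover have "\<phi>' ` K \<subseteq> U"
  proof
    fix x assume "x \<in> \<phi>' ` K"
    then obtain z where z: "z \<in> K" "x = \<phi>' z" by blast
    have "norm z \<le> max r B" using B z by (simp add: le_max_iff_disj)
    then have "dist x0 x \<le> \<rho>" using a \<rho> B z by (simp add: \<phi>'_def dist_norm a_def divide_le_eq mult.commute)
    then show "x \<in> U" using \<rho> by auto
  qed
  moreover have "compact (\<phi>' ` K)" "connected (\<phi>' ` K)"
    unfolding \<phi>'_def using K
    by (auto intro!: compact_continuous_image connected_continuous_image continuous_intros)
  moreover have "h x = 0" if "x \<notin> cball x0 \<rho>" for x
  proof -
    have "a * norm (x - x0) > a * \<rho>" using that a by (simp add: dist_norm norm_minus_commute)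
    moreover have "a * \<rho> \<ge> r" using \<rho> by (simp add: a_def)
    moreover have "norm (\<phi> x) = a * norm (x - x0)"
      using a norm_scaleR[of a "x - x0"] by (simp add: \<phi>_def algebra_simps)
    ultimately show ?thesis using r by (simp add: h_def)
  qed
  ultimately show ?thesis using 1 2 3 \<rho>
    by (intro exI[of _ h] exI[of _ "\<phi>' ` K"] exI[of _ "cball x0 \<rho>"]) simp
qed

section \<open>Charts, transition maps and covectors\<close>

locale manifold =
  fixes M :: "'a topology" and A :: "('a, 'e::euclidean_space) chart set"
  assumes smooth_manifold: "smooth_manifold M A"
begin

lemma Hausdorff: "Hausdorff_space M"
  using smooth_manifold by (simp add: smooth_manifold_def)

lemma atlas: "smooth_atlas M A"
  using smooth_manifold by (simp add: smooth_manifold_def)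

lemma chart:
  assumes "c \<in> A"
  shows "openin M (chart_dom c)" "open (chart_img c)"
    "homeomorphic_map (subtopology M (chart_dom c)) (top_of_set (chart_img c)) (chart_map c)"
  using atlas assms by (auto simp: smooth_atlas_def is_chart_def)

lemma chart_dom_subset: "c \<in> A \<Longrightarrow> chart_dom c \<subseteq> topspace M"
  using chart(1) openin_subset by blast

lemma ex_chart: "q \<in> topspace M \<Longrightarrow> \<exists>c\<in>A. q \<in> chart_dom c"
  using atlas by (auto simp: smooth_atlas_def)

lemma inj_chart: "c \<in> A \<Longrightarrow> inj_on (chart_map c) (chart_dom c)"
  using homeomorphic_imp_injective_map[OF chart(3)] chart_dom_subset
  by (simp add: topspace_subtopology inf_absorb2)

lemma chart_map_in: "q \<in> chart_dom c \<Longrightarrow> chart_map c q \<in> chart_img c"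
  by (simp add: chart_img_def)

lemma chart_inv_map: "c \<in> A \<Longrightarrow> q \<in> chart_dom c \<Longrightarrow> chart_inv c (chart_map c q) = q"
  unfolding chart_inv_def by (rule the_inv_into_f_f[OF inj_chart])

lemma chart_map_inv: "c \<in> A \<Longrightarrow> x \<in> chart_img c \<Longrightarrow> chart_map c (chart_inv c x) = x"
  unfolding chart_inv_def chart_img_def by (rule f_the_inv_into_f[OF inj_chart])

lemma chart_inv_in: "c \<in> A \<Longrightarrow> x \<in> chart_img c \<Longrightarrow> chart_inv c x \<in> chart_dom c"
  unfolding chart_img_def using chart_inv_map by (metis imageE)

lemma chart_inv_topspace: "c \<in> A \<Longrightarrow> x \<in> chart_img c \<Longrightarrow> chart_inv c x \<in> topspace M"
  using chart_inv_in chart_dom_subset by blast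

lemma mem_image_chart:
  assumes "c \<in> A"
  shows "x \<in> chart_map c ` (chart_dom c \<inter> W) \<longleftrightarrow> x \<in> chart_img c \<and> chart_inv c x \<in> W"
proof
  assume "x \<in> chart_map c ` (chart_dom c \<inter> W)"
  then obtain q where "q \<in> chart_dom c" "q \<in> W" "x = chart_map c q" by blast
  then show "x \<in> chart_img c \<and> chart_inv c x \<in> W"
    using chart_map_in[of q c] chart_inv_map[OF assms, of q] by simp
next
  assume x: "x \<in> chart_img c \<and> chart_inv c x \<in> W"
  then have "x = chart_map c (chart_inv c x)" "chart_inv c x \<in> chart_dom c \<inter> W"
    using chart_map_inv[OF assms, of x] chart_inv_in[OF assms, of x] by simp_all
  then show "x \<in> chart_map c ` (chart_dom c \<inter> W)" by (rule image_eqI)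
qed

lemma open_image_chart:
  assumes "c \<in> A" "openin M W"
  shows "open (chart_map c ` (chart_dom c \<inter> W))"
proof -
  have "openin (subtopology M (chart_dom c)) (chart_dom c \<inter> W)"
    using assms(2) by (simp add: openin_subtopology_Int2)
  then have "openin (top_of_set (chart_img c)) (chart_map c ` (chart_dom c \<inter> W))"
    using homeomorphic_imp_open_map[OF chart(3)[OF assms(1)]] by (simp add: open_map_def)
  then show ?thesis using chart(2)[OF assms(1)] by (simp add: openin_open_eq)
qed

lemma openin_chart_preimage:
  assumes "c \<in> A" "open V"
  shows "openin M {q \<in> chart_dom c. chart_map c q \<in> V}"
proof -
  have "continuous_map (subtopology M (chart_dom c)) (top_of_set (chart_img c)) (chart_map c)"
    using chart(3)[OF assms(1)] by (rule homeomorphic_imp_continuous_map)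
  moreover have "openin (top_of_set (chart_img c)) (chart_img c \<inter> V)"
    using assms(2) by (simp add: openin_open_Int)
  ultimately have "openin (subtopology M (chart_dom c))
      {q \<in> topspace (subtopology M (chart_dom c)). chart_map c q \<in> chart_img c \<inter> V}"
    by (rule openin_continuous_map_preimage)
  moreover have "{q \<in> topspace (subtopology M (chart_dom c)). chart_map c q \<in> chart_img c \<inter> V}
      = {q \<in> chart_dom c. chart_map c q \<in> V}"
    using chart_dom_subset[OF assms(1)] chart_map_in[of _ c] by auto
  ultimately show ?thesis
    using chart(1)[OF assms(1)] by (simp add: openin_open_subtopology)
qed

lemma continuous_chart_inv:
  assumes "c \<in> A"
  shows "continuous_map (top_of_set (chart_img c)) M (chart_inv c)"
  unfolding continuous_map_def
proof (intro conjI allI impI)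
  show "chart_inv c \<in> topspace (top_of_set (chart_img c)) \<rightarrow> topspace M"
    using chart_inv_topspace[OF assms] by auto
  fix W assume "openin M W"
  then have "open (chart_map c ` (chart_dom c \<inter> W))" by (rule open_image_chart[OF assms])
  moreover have "{x \<in> topspace (top_of_set (chart_img c)). chart_inv c x \<in> W} = chart_map c ` (chart_dom c \<inter> W)"
    using mem_image_chart[OF assms] by auto
  moreover have "chart_map c ` (chart_dom c \<inter> W) \<subseteq> chart_img c"
    unfolding chart_img_def by (rule image_mono) simp
  ultimately show "openin (top_of_set (chart_img c)) {x \<in> topspace (top_of_set (chart_img c)). chart_inv c x \<in> W}"
    using openin_open_eq[OF chart(2)[OF assms]] by (simp only: simp_thms)
qed

abbreviation overlap :: "('a, 'e) chart \<Rightarrow> ('a, 'e) chart \<Rightarrow> 'e set" where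
  "overlap c c' \<equiv> chart_map c ` (chart_dom c \<inter> chart_dom c')"

abbreviation D :: "('a, 'e) chart \<Rightarrow> ('a, 'e) chart \<Rightarrow> 'a \<Rightarrow> 'e \<Rightarrow> 'e" where
  "D c c' q \<equiv> frechet_derivative (transition c c') (at (chart_map c q))"

lemma open_overlap: "c \<in> A \<Longrightarrow> c' \<in> A \<Longrightarrow> open (overlap c c')"
  by (intro open_image_chart chart)

lemma Ck_transition: "c \<in> A \<Longrightarrow> c' \<in> A \<Longrightarrow> Ck_on k (overlap c c') (transition c c')"
  using atlas by (auto simp: smooth_atlas_def smooth_on_def)

lemma transition_has_derivative:
  assumes "c \<in> A" "c' \<in> A" "q \<in> chart_dom c" "q \<in> chart_dom c'"
  shows "(transition c c' has_derivative D c c' q) (at (chart_map c q))"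
  using Ck_transition[OF assms(1,2), of 1] assms by (auto simp: frechet_derivative_works[symmetric])

lemma transition_map: "c \<in> A \<Longrightarrow> q \<in> chart_dom c \<Longrightarrow> transition c c' (chart_map c q) = chart_map c' q"
  by (simp add: transition_def chart_inv_map)

text \<open>For \<open>h = chart_map c''\<close> this is the cocycle rule for transition maps, and for real-valued \<open>h\<close>
  the transformation law of the differential of \<open>h\<close>.\<close>

lemma has_derivative_change_chart:
  fixes h :: "'a \<Rightarrow> 'w::real_normed_vector"
  assumes c: "c \<in> A" "c' \<in> A" "q \<in> chart_dom c" "q \<in> chart_dom c'"
    and g: "(h \<circ> chart_inv c' has_derivative g') (at (chart_map c' q))"
  shows "(h \<circ> chart_inv c has_derivative (\<lambda>v. g' (D c c' q v))) (at (chart_map c q))"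
proof (rule has_derivative_transform_within_open[OF _ open_overlap[OF c(1,2)]])
  show "((\<lambda>x. (h \<circ> chart_inv c') (transition c c' x)) has_derivative (\<lambda>v. g' (D c c' q v))) (at (chart_map c q))"
    using has_derivative_compose[OF transition_has_derivative[OF c], of "h \<circ> chart_inv c'" g'] g
    by (simp add: transition_map c)
  show "chart_map c q \<in> overlap c c'" using c by auto
  show "(h \<circ> chart_inv c') (transition c c' x) = (h \<circ> chart_inv c) x" if "x \<in> overlap c c'" for x
    using that c by (auto simp: transition_def chart_inv_map)
qed

lemma D_cocycle:
  assumes "c1 \<in> A" "c2 \<in> A" "c3 \<in> A" "q \<in> chart_dom c1" "q \<in> chart_dom c2" "q \<in> chart_dom c3"
  shows "D c1 c3 q v = D c2 c3 q (D c1 c2 q v)"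
proof -
  have "(chart_map c3 \<circ> chart_inv c2 has_derivative D c2 c3 q) (at (chart_map c2 q))"
    using transition_has_derivative[of c2 c3 q] assms by (simp add: transition_def)
  from has_derivative_change_chart[OF assms(1,2,4,5) this]
  have "(transition c1 c3 has_derivative (\<lambda>v. D c2 c3 q (D c1 c2 q v))) (at (chart_map c1 q))"
    by (simp add: transition_def)
  from frechet_derivative_at[OF this] show ?thesis by metis
qed

lemma D_same:
  assumes "c \<in> A" "q \<in> chart_dom c"
  shows "D c c q v = v"
proof -
  have "(transition c c has_derivative (\<lambda>v. v)) (at (chart_map c q))"
    by (rule has_derivative_transform_within_open[OF has_derivative_ident chart(2)[OF assms(1)]])
      (use assms chart_map_in[of q c] chart_map_inv[OF assms(1)] in \<open>simp_all add: transition_def\<close>)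
  from frechet_derivative_at[OF this] show ?thesis by metis
qed

lemma zero_covector: "(\<lambda>_. 0) \<in> covectors_at A q"
  by (simp add: covectors_at_def)

lemma covector_law:
  "\<xi> \<in> covectors_at A q \<Longrightarrow> c \<in> A \<Longrightarrow> c' \<in> A \<Longrightarrow> q \<in> chart_dom c \<Longrightarrow> q \<in> chart_dom c' \<Longrightarrow>
    \<xi> c \<bullet> v = \<xi> c' \<bullet> D c c' q v"
  unfolding covectors_at_def mem_Collect_eq by blast

lemma covector_0: "\<xi> \<in> covectors_at A q \<Longrightarrow> \<not> (c \<in> A \<and> q \<in> chart_dom c) \<Longrightarrow> \<xi> c = 0"
  unfolding covectors_at_def mem_Collect_eq by blast

text \<open>The transformation law determines the components in all charts around \<open>q\<close>
  from those in one, and elsewhere they are normalised to \<open>0\<close>.\<close>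

lemma covector_eqI:
  assumes "\<xi> \<in> covectors_at A q" "\<xi>' \<in> covectors_at A q" "c \<in> A" "q \<in> chart_dom c" "\<xi> c = \<xi>' c"
  shows "\<xi> = \<xi>'"
proof
  fix c'
  show "\<xi> c' = \<xi>' c'"
  proof (cases "c' \<in> A \<and> q \<in> chart_dom c'")
    case True
    then have "\<xi> c' \<bullet> v = \<xi>' c' \<bullet> v" for v
      using covector_law[OF assms(1), of c' c] covector_law[OF assms(2), of c' c] assms by simp
    then show ?thesis by (metis vector_eq_rdot)
  qed (use covector_0 assms in metis)
qed

lemma covector_diff_scale:
  assumes "\<xi> \<in> covectors_at A q" "\<xi>' \<in> covectors_at A q"
  shows "(\<lambda>c. \<xi> c - t *\<^sub>R \<xi>' c) \<in> covectors_at A q"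
  unfolding covectors_at_def mem_Collect_eq
proof (intro conjI ballI allI impI)
  fix c c' v assume c: "c \<in> A" "c' \<in> A" "q \<in> chart_dom c \<inter> chart_dom c'"
  then have q: "q \<in> chart_dom c" "q \<in> chart_dom c'" by simp_all
  show "(\<xi> c - t *\<^sub>R \<xi>' c) \<bullet> v = (\<xi> c' - t *\<^sub>R \<xi>' c') \<bullet> D c c' q v"
    using covector_law[OF assms(1) c(1,2) q, of v] covector_law[OF assms(2) c(1,2) q, of v]
    by (simp add: inner_diff_left)
next
  fix c assume "\<not> (c \<in> A \<and> q \<in> chart_dom c)"
  then show "\<xi> c - t *\<^sub>R \<xi>' c = 0" using covector_0[OF assms(1)] covector_0[OF assms(2)] by simp
qed

text \<open>The Riesz representation of linear forms, in the encoding that is used for covectors and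
  for the Hamiltonian field.\<close>

lemma inner_gradient:
  fixes L :: "'e \<Rightarrow> real"
  assumes "bounded_linear L"
  shows "(\<Sum>b\<in>Basis. L b *\<^sub>R b) \<bullet> v = L v"
proof -
  interpret bounded_linear L by fact
  have "L v = (\<Sum>b\<in>Basis. (v \<bullet> b) * L b)"
    using arg_cong[OF euclidean_representation[of v], of L] by (simp add: sum scale)
  also have "\<dots> = (\<Sum>b\<in>Basis. L b * (b \<bullet> v))"
    by (intro sum.cong refl) (simp only: inner_commute[of v] mult.commute)
  finally show ?thesis by (simp add: inner_sum_left)
qed

text \<open>The form \<open>p\<close> is pulled back to every chart around \<open>q\<close>, and the
  cocycle rule for \<open>D\<close> is the required transformation law. So canonical coordinates
  attain every momentum.\<close>

lemma ex_covector:
  assumes c: "c \<in> A" "q \<in> chart_dom c"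
  shows "\<exists>\<xi>\<in>covectors_at A q. \<xi> c = p"
proof -
  define \<xi> where "\<xi> c' = (if c' \<in> A \<and> q \<in> chart_dom c' then (\<Sum>b\<in>Basis. (p \<bullet> D c' c q b) *\<^sub>R b) else 0)" for c'
  have \<xi>: "\<xi> c' \<bullet> v = p \<bullet> D c' c q v" if "c' \<in> A" "q \<in> chart_dom c'" for c' v
  proof -
    have "bounded_linear (\<lambda>v. p \<bullet> D c' c q v)"
      using that c
      by (intro bounded_linear_compose[OF bounded_linear_inner_right
            has_derivative_bounded_linear[OF transition_has_derivative]])
    from inner_gradient[OF this] show ?thesis using that by (simp add: \<xi>_def)
  qed
  have "\<xi> \<in> covectors_at A q"
    unfolding covectors_at_def mem_Collect_eq
  proof (intro conjI ballI allI impI)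
    fix c1 c2 v assume "c1 \<in> A" "c2 \<in> A" "q \<in> chart_dom c1 \<inter> chart_dom c2"
    then show "\<xi> c1 \<bullet> v = \<xi> c2 \<bullet> D c1 c2 q v"
      using \<xi>[of c1] \<xi>[of c2] D_cocycle[of c1 c2 c q v] c by simp
  next
    fix c' assume "\<not> (c' \<in> A \<and> q \<in> chart_dom c')"
    then show "\<xi> c' = 0" unfolding \<xi>_def by (rule if_not_P)
  qed
  moreover have "\<xi> c \<bullet> v = p \<bullet> v" for v using \<xi> c by (simp add: D_same)
  then have "\<xi> c = p" by (metis vector_eq_rdot)
  ultimately show ?thesis by blast
qed

section \<open>Canonical coordinates and topology of the cotangent bundle\<close>

lemma mem_cotangent_bundle:
  "z \<in> cotangent_bundle M A \<longleftrightarrow> fst z \<in> topspace M \<and> snd z \<in> covectors_at A (fst z)"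
  by (cases z) (simp add: cotangent_bundle_def)

lemma inj_canonical_coords:
  assumes c: "c \<in> A"
  shows "inj_on (canonical_coords c) (cotangent_dom M A c)"
proof (rule inj_onI)
  fix z z' assume z: "z \<in> cotangent_dom M A c" "z' \<in> cotangent_dom M A c"
    and eq: "canonical_coords c z = canonical_coords c z'"
  have "fst z = fst z'"
    using z eq inj_chart[OF c] by (simp add: cotangent_dom_def canonical_coords_def inj_on_def)
  moreover from this have "snd z = snd z'"
    using z eq covector_eqI[of "snd z" "fst z" "snd z'", OF _ _ c]
    by (simp add: cotangent_dom_def mem_cotangent_bundle canonical_coords_def)
  ultimately show "z = z'" by (simp add: prod_eq_iff)
qed

text \<open>\<open>the_inv_into\<close> is meaningful only at attained values;
  \<open>ex_covector\<close> provides a point with the coordinates \<open>(x, p)\<close>.\<close>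

lemma fst_canonical_coords_inv:
  assumes c: "c \<in> A" and x: "x \<in> chart_img c"
  shows "fst (canonical_coords_inv M A c (x, p)) = chart_inv c x"
proof -
  define q where "q = chart_inv c x"
  have q: "q \<in> chart_dom c" "chart_map c q = x" using chart_inv_in[OF c x] chart_map_inv[OF c x] by (simp_all add: q_def)
  obtain \<xi> where \<xi>: "\<xi> \<in> covectors_at A q" "\<xi> c = p" using ex_covector[OF c q(1)] by blast
  have "(q, \<xi>) \<in> cotangent_dom M A c"
    using \<xi> q subsetD[OF chart_dom_subset[OF c] q(1)] by (simp add: cotangent_dom_def mem_cotangent_bundle)
  from the_inv_into_f_f[OF inj_canonical_coords[OF c] this] show ?thesis
    using q \<xi> by (simp add: canonical_coords_inv_def canonical_coords_def q_def)
qed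

lemma continuous_map_cotangentI:
  assumes "\<And>x. x \<in> topspace T \<Longrightarrow> \<gamma> x \<in> cotangent_bundle M A"
    and "\<And>c V. c \<in> A \<Longrightarrow> open V \<Longrightarrow>
      openin T {x \<in> topspace T. fst (\<gamma> x) \<in> chart_dom c \<and> canonical_coords c (\<gamma> x) \<in> V}"
  shows "continuous_map T (cotangent_topology M A) \<gamma>"
  unfolding cotangent_topology_def
proof (rule continuous_on_generated_topo)
  fix U assume "U \<in> {{z \<in> cotangent_dom M A c. canonical_coords c z \<in> V} |c V. c \<in> A \<and> open V}"
  then obtain c V where U: "U = {z \<in> cotangent_dom M A c. canonical_coords c z \<in> V}" "c \<in> A" "open V"
    by (elim CollectE exE conjE) (rule that)
  have "\<gamma> -` U \<inter> topspace T = {x \<in> topspace T. fst (\<gamma> x) \<in> chart_dom c \<and> canonical_coords c (\<gamma> x) \<in> V}"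
    using assms(1) unfolding U(1) cotangent_dom_def by blast
  then show "openin T (\<gamma> -` U \<inter> topspace T)" using assms(2)[OF U(2,3)] by simp
next
  show "\<gamma> ` topspace T \<subseteq> \<Union> {{z \<in> cotangent_dom M A c. canonical_coords c z \<in> V} |c V. c \<in> A \<and> open V}"
  proof
    fix z assume "z \<in> \<gamma> ` topspace T"
    then have z: "z \<in> cotangent_bundle M A" using assms(1) by auto
    then obtain c where c: "c \<in> A" "fst z \<in> chart_dom c"
      using ex_chart[of "fst z"] by (meson mem_cotangent_bundle)
    then have "z \<in> {z \<in> cotangent_dom M A c. canonical_coords c z \<in> UNIV}"
      using z by (simp add: cotangent_dom_def)
    then show "z \<in> \<Union> {{z \<in> cotangent_dom M A c. canonical_coords c z \<in> V} |c V. c \<in> A \<and> open V}"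
      using c(1) open_UNIV by blast
  qed
qed

lemma openin_cotangent_dom: "c \<in> A \<Longrightarrow> openin (cotangent_topology M A) (cotangent_dom M A c)"
  unfolding cotangent_topology_def
  by (rule topology_generated_by_Basis, unfold mem_Collect_eq, intro exI[of _ c] exI[of _ UNIV]) simp

lemma topspace_cotangent: "topspace (cotangent_topology M A) \<subseteq> cotangent_bundle M A"
  unfolding cotangent_topology_def topology_generated_by_topspace cotangent_dom_def by blast

lemma zero_section_C1_lagrangian_graph:
  "C1_lagrangian_graph M A ((\<lambda>q. (q, \<lambda>_. 0)) ` topspace M)"
proof -
  have Ck: "Ck_on k U (\<lambda>x::'e. 0::'w::real_normed_vector)" for k U
    by (rule Ck_holder_on_imp_Ck_on[OF Ck_holder_on_const])
  then have "C1_one_form M A (\<lambda>q _. 0)"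
    unfolding C1_one_form_def using zero_covector by blast
  moreover have "closed_one_form M A (\<lambda>q _. 0)"
    unfolding closed_one_form_def o_def
    by (intro ballI exI[of _ "topspace M"] exI[of _ "\<lambda>_. 0"] conjI allI openin_topspace Ck) simp_all
  ultimately show ?thesis unfolding C1_lagrangian_graph_def by blast
qed

end

section \<open>Hamiltonians constant on the fibres\<close>

context manifold
begin

lemma local_rep_fst:
  "c \<in> A \<Longrightarrow> x \<in> chart_img c \<Longrightarrow> local_rep M A (\<lambda>z. h (fst z)) c (x, p) = (h \<circ> chart_inv c) x"
  by (simp add: local_rep_def fst_canonical_coords_inv)

lemma Ck_holder_on_local_rep:
  assumes c: "c \<in> A" and s: "0 \<le> s" "s \<le> 1" and h: "Ck_holder_on k s (chart_img c) (h \<circ> chart_inv c)"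
  shows "Ck_holder_on k s (chart_img c \<times> UNIV) (local_rep M A (\<lambda>z. h (fst z)) c)"
proof -
  have U: "open (chart_img c \<times> (UNIV :: 'e set))" by (intro open_Times chart(2)[OF c] open_UNIV)
  have fst: "Ck_on (Suc k) (chart_img c \<times> UNIV) (fst :: 'e \<times> 'e \<Rightarrow> 'e)"
    by (rule Ck_holder_on_imp_Ck_on[OF bounded_linear_Ck_holder_on[OF bounded_linear_fst]])
  have "Ck_holder_on k s (chart_img c \<times> UNIV) (\<lambda>z::'e \<times> 'e. (h \<circ> chart_inv c) (fst z))"
    by (rule Ck_holder_on_compose[OF chart(2)[OF c] U s _ h fst]) auto
  then show ?thesis
    by (rule Ck_holder_on_cong[OF U]) (use local_rep_fst[OF c] in auto)
qed

definition differential :: "('a \<Rightarrow> real) \<Rightarrow> 'a \<Rightarrow> ('a, 'e) covec" where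
  "differential h q c = (if c \<in> A \<and> q \<in> chart_dom c
     then (\<Sum>b\<in>Basis. frechet_derivative (h \<circ> chart_inv c) (at (chart_map c q)) b *\<^sub>R b) else 0)"

definition C1_function :: "('a \<Rightarrow> real) \<Rightarrow> bool" where
  "C1_function h \<longleftrightarrow> (\<forall>c\<in>A. Ck_on 1 (chart_img c) (h \<circ> chart_inv c))"

lemma C1_function_has_derivative:
  assumes "C1_function h" "c \<in> A" "q \<in> chart_dom c"
  shows "(h \<circ> chart_inv c has_derivative frechet_derivative (h \<circ> chart_inv c) (at (chart_map c q)))
    (at (chart_map c q))"
proof -
  have "Ck_on 1 (chart_img c) (h \<circ> chart_inv c)" using assms by (simp add: C1_function_def del: Ck_on.simps)
  then show ?thesis using chart_map_in[OF assms(3)] by (simp add: frechet_derivative_works[symmetric])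
qed

lemma inner_differential:
  assumes "C1_function h" "c \<in> A" "q \<in> chart_dom c"
  shows "differential h q c \<bullet> v = frechet_derivative (h \<circ> chart_inv c) (at (chart_map c q)) v"
  using inner_gradient[OF has_derivative_bounded_linear[OF C1_function_has_derivative[OF assms]], of v] assms(2,3)
  by (simp add: differential_def)

lemma differential_covector:
  assumes h: "C1_function h"
  shows "differential h q \<in> covectors_at A q"
  unfolding covectors_at_def mem_Collect_eq
proof (intro conjI ballI allI impI)
  fix c c' v assume c: "c \<in> A" "c' \<in> A" "q \<in> chart_dom c \<inter> chart_dom c'"
  then have q: "q \<in> chart_dom c" "q \<in> chart_dom c'" by simp_all
  have "frechet_derivative (h \<circ> chart_inv c) (at (chart_map c q))
      = (\<lambda>v. frechet_derivative (h \<circ> chart_inv c') (at (chart_map c' q)) (D c c' q v))"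
    by (rule frechet_derivative_at[symmetric,
          OF has_derivative_change_chart[OF c(1,2) q C1_function_has_derivative[OF h c(2) q(2)]]])
  then show "differential h q c \<bullet> v = differential h q c' \<bullet> D c c' q v"
    using inner_differential[OF h c(1) q(1), of v] inner_differential[OF h c(2) q(2), of "D c c' q v"] by simp
next
  fix c assume "\<not> (c \<in> A \<and> q \<in> chart_dom c)"
  then show "differential h q c = 0" unfolding differential_def by (rule if_not_P)
qed

section \<open>The Hamiltonian field and its flow\<close>

lemma hamiltonian_field_fst:
  assumes h: "C1_function h" and c: "c \<in> A" and q: "fst z \<in> chart_dom c"
  shows "hamiltonian_field M A (\<lambda>z. h (fst z)) c z = (0, - differential h (fst z) c)"
proof -
  define h' where "h' = frechet_derivative (h \<circ> chart_inv c) (at (chart_map c (fst z)))"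
  have h': "(h \<circ> chart_inv c has_derivative h') (at (chart_map c (fst z)))"
    unfolding h'_def by (rule C1_function_has_derivative[OF h c q])
  have "((\<lambda>w::'e \<times> 'e. (h \<circ> chart_inv c) (fst w)) has_derivative (\<lambda>v. h' (fst v))) (at (canonical_coords c z))"
    by (rule has_derivative_compose[OF bounded_linear_imp_has_derivative[OF bounded_linear_fst]])
      (use h' in \<open>simp add: canonical_coords_def o_def\<close>)
  then have "(local_rep M A (\<lambda>z. h (fst z)) c has_derivative (\<lambda>v. h' (fst v))) (at (canonical_coords c z))"
    by (rule has_derivative_transform_within_open[where s = "chart_img c \<times> UNIV"])
      (use chart(2)[OF c] chart_map_in[OF q] local_rep_fst[OF c] in
        \<open>auto simp: canonical_coords_def intro!: open_Times\<close>)
  then have "frechet_derivative (local_rep M A (\<lambda>z. h (fst z)) c) (at (canonical_coords c z)) = (\<lambda>v. h' (fst v))"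
    by (rule frechet_derivative_at[symmetric])
  moreover have "h' 0 = 0" using h' by (auto dest: has_derivative_linear linear_0)
  ultimately show ?thesis
    using c q by (simp add: hamiltonian_field_def differential_def h'_def)
qed

definition fibre_flow :: "('a \<Rightarrow> real) \<Rightarrow> real \<Rightarrow> 'a \<times> ('a, 'e) covec \<Rightarrow> 'a \<times> ('a, 'e) covec" where
  "fibre_flow h t z = (fst z, \<lambda>c. snd z c - t *\<^sub>R differential h (fst z) c)"

lemma fibre_flow_in_bundle:
  assumes "C1_function h" "z \<in> cotangent_bundle M A"
  shows "fibre_flow h t z \<in> cotangent_bundle M A"
  using assms covector_diff_scale differential_covector
  by (simp add: mem_cotangent_bundle fibre_flow_def)

lemma integral_curve_fibre_flow:
  assumes h: "C1_function h" and z: "z \<in> cotangent_bundle M A"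
  shows "integral_curve_on M A (\<lambda>z. h (fst z)) UNIV (\<lambda>t. fibre_flow h t z)"
  unfolding integral_curve_on_def
proof (intro conjI ballI impI)
  show "continuous_map (top_of_set UNIV) (cotangent_topology M A) (\<lambda>t. fibre_flow h t z)"
  proof (rule continuous_map_cotangentI)
    fix c :: "('a, 'e) chart" and V :: "('e \<times> 'e) set" assume V: "open V"
    have "open ((\<lambda>t. (chart_map c (fst z), snd z c - t *\<^sub>R differential h (fst z) c)) -` V)"
      by (rule open_vimage[OF V]) (intro continuous_intros)
    then show "openin (top_of_set UNIV) {t \<in> topspace (top_of_set UNIV).
        fst (fibre_flow h t z) \<in> chart_dom c \<and> canonical_coords c (fibre_flow h t z) \<in> V}"
      by (cases "fst z \<in> chart_dom c") (simp_all add: fibre_flow_def canonical_coords_def vimage_def)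
  qed (use fibre_flow_in_bundle[OF h z] in simp)
next
  fix t :: real and c assume c: "c \<in> A" and "fst (fibre_flow h t z) \<in> chart_dom c"
  then have q: "fst z \<in> chart_dom c" by (simp add: fibre_flow_def)
  have "hamiltonian_field M A (\<lambda>z. h (fst z)) c (fibre_flow h t z) = (0, - differential h (fst z) c)"
    using hamiltonian_field_fst[OF h c, of "fibre_flow h t z"] q by (simp add: fibre_flow_def)
  moreover have "((\<lambda>u. (chart_map c (fst z), snd z c - u *\<^sub>R differential h (fst z) c)) has_vector_derivative
      (0, - differential h (fst z) c)) (at t)"
    by (intro has_vector_derivative_Pair) (auto intro!: derivative_eq_intros)
  ultimately show "((\<lambda>u. canonical_coords c (fibre_flow h u z)) has_vector_derivative
      hamiltonian_field M A (\<lambda>z. h (fst z)) c (fibre_flow h t z)) (at t)"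
    by (simp add: canonical_coords_def fibre_flow_def)
qed

text \<open>The field is merely continuous, so its triangular shape has to replace a Lipschitz
  argument: the base point has zero derivative in every chart, hence is locally constant and, as
  \<open>I\<close> is connected, constant; then each component of the covector has a constant
  derivative.\<close>

lemma integral_curve_unique:
  assumes h: "C1_function h" and I: "open I" "is_interval I" "0 \<in> I"
    and \<gamma>: "integral_curve_on M A (\<lambda>z. h (fst z)) I \<gamma>" and t: "t \<in> I"
  shows "\<gamma> t = fibre_flow h t (\<gamma> 0)"
proof -
  have cont: "continuous_map (top_of_set I) (cotangent_topology M A) \<gamma>"
    using \<gamma> by (simp add: integral_curve_on_def)
  have in_bundle: "\<gamma> u \<in> cotangent_bundle M A" if "u \<in> I" for u
    using cont that topspace_cotangent by (auto simp: continuous_map_def)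
  have der: "((\<lambda>u. canonical_coords c (\<gamma> u)) has_vector_derivative (0, - differential h (fst (\<gamma> u)) c)) (at u)"
    if "u \<in> I" "c \<in> A" "fst (\<gamma> u) \<in> chart_dom c" for u c
    using \<gamma> that hamiltonian_field_fst[OF h that(2,3)] unfolding integral_curve_on_def by metis
  have der_fst: "((\<lambda>u. chart_map c (fst (\<gamma> u))) has_vector_derivative 0) (at u)"
    and der_snd: "((\<lambda>u. snd (\<gamma> u) c) has_vector_derivative - differential h (fst (\<gamma> u)) c) (at u)"
    if "u \<in> I" "c \<in> A" "fst (\<gamma> u) \<in> chart_dom c" for u c
    using bounded_linear.has_vector_derivative[OF bounded_linear_fst der[OF that]]
      bounded_linear.has_vector_derivative[OF bounded_linear_snd der[OF that]]
    by (simp_all add: canonical_coords_def)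
  have "connected I" using I(2) by (simp add: is_interval_connected)
  have const: "fst (\<gamma> u) = fst (\<gamma> 0)" if u: "u \<in> I" for u
  proof (rule connected_local_const[OF \<open>connected I\<close> u I(3)], intro ballI)
    fix w assume w: "w \<in> I"
    obtain c where c: "c \<in> A" "fst (\<gamma> w) \<in> chart_dom c"
      using in_bundle[OF w] ex_chart[of "fst (\<gamma> w)"] unfolding mem_cotangent_bundle by blast
    \<comment> \<open>Times at which the curve is over the chart; open because
      \<open>\<gamma>\<close> is continuous for the cotangent topology.\<close>
    define J where "J = {u \<in> I. \<gamma> u \<in> cotangent_dom M A c}"
    have "openin (top_of_set I) {u \<in> topspace (top_of_set I). \<gamma> u \<in> cotangent_dom M A c}"
      by (rule openin_continuous_map_preimage[OF cont openin_cotangent_dom[OF c(1)]])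
    then have "open J" using I(1) by (simp add: J_def openin_open_eq)
    moreover have "w \<in> J" using w c in_bundle[OF w] by (simp add: J_def cotangent_dom_def)
    ultimately obtain r where r: "r > 0" "ball w r \<subseteq> J" using open_contains_ball by blast
    have J: "u \<in> I" "fst (\<gamma> u) \<in> chart_dom c" if "u \<in> ball w r" for u
      using subsetD[OF r(2) that] by (simp_all add: J_def cotangent_dom_def)
    have "((\<lambda>u. chart_map c (fst (\<gamma> u))) has_derivative (\<lambda>_. 0)) (at u within ball w r)"
      if "u \<in> ball w r" for u
      using der_fst[OF J(1)[OF that] c(1) J(2)[OF that]]
      by (simp add: has_vector_derivative_def has_derivative_at_withinI)
    from has_derivative_zero_constant[OF convex_ball this]
    obtain k where k: "\<And>u. u \<in> ball w r \<Longrightarrow> chart_map c (fst (\<gamma> u)) = k" by blast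
    have "w \<in> ball w r" using r(1) by simp
    then have eq: "fst (\<gamma> u) = fst (\<gamma> w)" if "u \<in> ball w r" for u
      using that J(2) k by (intro inj_onD[OF inj_chart[OF c(1)]]) simp_all
    show "\<forall>\<^sub>F u in at w within I. fst (\<gamma> w) = fst (\<gamma> u)"
      unfolding eventually_at
      by (intro exI[of _ r] conjI ballI impI r(1)) (rule eq[symmetric], simp add: dist_commute)
  qed
  have "snd (\<gamma> t) c = snd (\<gamma> 0) c - t *\<^sub>R differential h (fst (\<gamma> 0)) c" for c
  proof (cases "c \<in> A \<and> fst (\<gamma> 0) \<in> chart_dom c")
    case True
    define d where "d = differential h (fst (\<gamma> 0)) c"
    have "((\<lambda>u. snd (\<gamma> u) c + u *\<^sub>R d) has_vector_derivative 0) (at u)" if u: "u \<in> I" for u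
    proof -
      have "((\<lambda>u. snd (\<gamma> u) c) has_vector_derivative - d) (at u)"
        using der_snd[OF u, of c] True const[OF u] by (simp add: d_def)
      moreover have "((\<lambda>u. u *\<^sub>R d) has_vector_derivative d) (at u)"
        by (auto intro!: derivative_eq_intros)
      ultimately have "((\<lambda>u. snd (\<gamma> u) c + u *\<^sub>R d) has_vector_derivative - d + d) (at u)"
        by (rule has_vector_derivative_add)
      then show ?thesis by simp
    qed
    then have "((\<lambda>u. snd (\<gamma> u) c + u *\<^sub>R d) has_derivative (\<lambda>_. 0)) (at u within I)" if "u \<in> I" for u
      using that by (simp add: has_vector_derivative_def has_derivative_at_withinI)
    from has_derivative_zero_constant[OF is_interval_convex[OF I(2)] this]
    have "\<exists>k. \<forall>u\<in>I. snd (\<gamma> u) c + u *\<^sub>R d = k" .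
    then have "snd (\<gamma> t) c + t *\<^sub>R d = snd (\<gamma> 0) c + 0 *\<^sub>R d" using t I(3) by metis
    then show ?thesis by (simp add: d_def algebra_simps)
  next
    \<comment> \<open>At indices that are not charts around the base point all covector components
      have the default value \<open>0\<close>, so both sides vanish.\<close>
    case False
    then have "snd (\<gamma> u) c = 0" if "u \<in> I" for u
      using covector_0[of "snd (\<gamma> u)" "fst (\<gamma> u)" c] in_bundle[OF that] const[OF that] False
      by (simp add: mem_cotangent_bundle)
    moreover have "differential h (fst (\<gamma> 0)) c = 0" unfolding differential_def using False by (rule if_not_P)
    ultimately show ?thesis using t I(3) by simp
  qed
  then show ?thesis using const[OF t] by (simp add: fibre_flow_def prod_eq_iff fun_eq_iff)
qed

lemma hamiltonian_flow_fibre_flow: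
  assumes h: "C1_function h"
  shows "hamiltonian_flow M A (\<lambda>z. h (fst z)) (fibre_flow h)"
  unfolding hamiltonian_flow_def
proof (intro ballI conjI allI impI)
  fix z assume z: "z \<in> cotangent_bundle M A"
  show "fibre_flow h 0 z = z" by (simp add: fibre_flow_def)
  show "integral_curve_on M A (\<lambda>z. h (fst z)) UNIV (\<lambda>t. fibre_flow h t z)"
    by (rule integral_curve_fibre_flow[OF h z])
  fix I \<gamma> t
  assume "open I \<and> is_interval I \<and> 0 \<in> I \<and> integral_curve_on M A (\<lambda>z. h (fst z)) I \<gamma> \<and> \<gamma> 0 = z" "t \<in> I"
  then show "\<gamma> t = fibre_flow h t z" using integral_curve_unique[OF h] by blast
qed

section \<open>Transfer from a chart to the manifold\<close>

lemma continuous_zero_section: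
  assumes c: "c \<in> A"
  shows "continuous_map (top_of_set (chart_img c)) (cotangent_topology M A) (\<lambda>x. (chart_inv c x, \<lambda>_. 0))"
proof (rule continuous_map_cotangentI)
  show "(chart_inv c x, \<lambda>_. 0) \<in> cotangent_bundle M A" if "x \<in> topspace (top_of_set (chart_img c))" for x
    using that chart_inv_topspace[OF c] zero_covector by (simp add: mem_cotangent_bundle)
  fix c' :: "('a, 'e) chart" and V :: "('e \<times> 'e) set" assume c': "c' \<in> A" and V: "open V"
  have "open ((\<lambda>y. (y, 0)) -` V)" by (rule open_vimage[OF V]) (intro continuous_intros)
  from openin_continuous_map_preimage[OF continuous_chart_inv[OF c] openin_chart_preimage[OF c' this]]
  show "openin (top_of_set (chart_img c)) {x \<in> topspace (top_of_set (chart_img c)).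
      fst (chart_inv c x, \<lambda>_. 0) \<in> chart_dom c' \<and> canonical_coords c' (chart_inv c x, \<lambda>_. 0) \<in> V}"
    by (simp add: canonical_coords_def)
qed

definition extend :: "('a, 'e) chart \<Rightarrow> ('e \<Rightarrow> real) \<Rightarrow> 'a \<Rightarrow> real" where
  "extend c f q = (if q \<in> chart_dom c then f (chart_map c q) else 0)"

text \<open>Two open pieces cover the manifold: the domain of \<open>c\<close>, where the function
  is \<open>f\<close> after a transition map, and the complement of the compact image of
  \<open>C\<close>, where it is \<open>0\<close>. That image is closed because the manifold is
  Hausdorff.\<close>

lemma Ck_holder_on_extend:
  assumes c: "c \<in> A" and s: "0 \<le> s" "s \<le> 1" and f: "Ck_holder_on k s UNIV f"
    and C: "compact C" "C \<subseteq> chart_img c" "\<And>x. x \<notin> C \<Longrightarrow> f x = 0" and c': "c' \<in> A"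
  shows "Ck_holder_on k s (chart_img c') (extend c f \<circ> chart_inv c')"
proof (rule Ck_holder_on_locally)
  fix x assume x: "x \<in> chart_img c'"
  define q where "q = chart_inv c' x"
  show "\<exists>V. open V \<and> x \<in> V \<and> Ck_holder_on k s V (extend c f \<circ> chart_inv c')"
  proof (cases "q \<in> chart_dom c")
    case True
    have V: "open (overlap c' c)" by (rule open_overlap[OF c' c])
    have "Ck_holder_on k s (overlap c' c) (\<lambda>x. f (transition c' c x))"
      by (rule Ck_holder_on_compose[OF open_UNIV V s subset_UNIV f Ck_transition[OF c' c]])
    then have "Ck_holder_on k s (overlap c' c) (extend c f \<circ> chart_inv c')"
      by (rule Ck_holder_on_cong[OF V])
        (use mem_image_chart[OF c'] in \<open>simp add: extend_def transition_def\<close>)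
    moreover have "x \<in> overlap c' c" using x True mem_image_chart[OF c'] by (simp add: q_def)
    ultimately show ?thesis using V by blast
  next
    case False
    have "compactin M (chart_inv c ` C)"
      by (rule image_compactin[OF _ continuous_chart_inv[OF c]]) (simp add: compactin_subtopology C)
    then have "closedin M (chart_inv c ` C)" by (rule compactin_imp_closedin[OF Hausdorff])
    then have "openin M (topspace M - chart_inv c ` C)" by blast
    then have V: "open (chart_map c' ` (chart_dom c' \<inter> (topspace M - chart_inv c ` C)))" (is "open ?V")
      by (rule open_image_chart[OF c'])
    have "Ck_holder_on k s ?V (extend c f \<circ> chart_inv c')"
    proof (rule Ck_holder_on_cong[OF V Ck_holder_on_const[of _ _ _ 0]])
      fix x' assume "x' \<in> ?V"
      then have q': "chart_inv c' x' \<notin> chart_inv c ` C"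
        unfolding mem_image_chart[OF c'] by blast
      have "chart_map c (chart_inv c' x') \<notin> C" if "chart_inv c' x' \<in> chart_dom c"
        using q' chart_inv_map[OF c that] by (metis image_eqI)
      then show "0 = (extend c f \<circ> chart_inv c') x'" using C(3) by (simp add: extend_def)
    qed
    moreover have "q \<notin> chart_inv c ` C"
      using False chart_inv_in[OF c] C(2) by blast
    then have "x \<in> ?V"
      unfolding mem_image_chart[OF c'] using x chart_inv_topspace[OF c' x] by (simp add: q_def)
    ultimately show ?thesis using V by blast
  qed
qed

text \<open>By the change of charts, a derivative that vanishes in one chart vanishes in all of
  them.\<close>

lemma differential_extend:
  assumes c: "c \<in> A" and x: "x \<in> chart_img c" and f: "(f has_derivative (\<lambda>_. 0)) (at x)"
  shows "differential (extend c f) (chart_inv c x) = (\<lambda>_. 0)"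
proof
  fix c'
  define q where "q = chart_inv c x"
  have q: "q \<in> chart_dom c" "chart_map c q = x" using chart_inv_in[OF c x] chart_map_inv[OF c x] by (simp_all add: q_def)
  have "(extend c f \<circ> chart_inv c has_derivative (\<lambda>_. 0)) (at (chart_map c q))"
    unfolding q(2)
    by (rule has_derivative_transform_within_open[OF f chart(2)[OF c] x])
      (use chart_inv_in[OF c] chart_map_inv[OF c] in \<open>simp add: extend_def\<close>)
  from has_derivative_change_chart[OF _ c _ q(1) this, of c']
  have "frechet_derivative (extend c f \<circ> chart_inv c') (at (chart_map c' q)) = (\<lambda>_. 0)"
    if "c' \<in> A" "q \<in> chart_dom c'"
    using that by (intro frechet_derivative_at[symmetric]) simp
  then show "differential (extend c f) (chart_inv c x) c' = 0"
    by (simp add: differential_def flip: q_def)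
qed

end

theorem theorem3:
  fixes M :: "'a topology" and A :: "('a, 'e::euclidean_space) chart set"
    and d' :: nat and s :: real
  assumes "closed_connected_manifold M A"
    and "DIM('e) \<ge> 2"
    and "(d' < DIM('e) - 1 \<and> 0 \<le> s \<and> s \<le> 1) \<or> (d' = DIM('e) - 1 \<and> 0 \<le> s \<and> s < 1)"
  shows "\<exists>(H :: 'a \<times> ('a, 'e) covec \<Rightarrow> real) \<Gamma> \<Lambda>.
           Ck_holder_hamiltonian d' s M A H \<and> Ck_hamiltonian 1 M A H \<and>
           C1_lagrangian_graph M A \<Gamma> \<and>
           \<Lambda> \<subseteq> \<Gamma> \<and>
           compactin (cotangent_topology M A) \<Lambda> \<and> connectedin (cotangent_topology M A) \<Lambda> \<and>
           flow_invariant M A H \<Lambda> \<and>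
           \<not> H constant_on \<Lambda>"
proof -
  interpret manifold M A
    using assms(1) by unfold_locales (simp add: closed_connected_manifold_def)
  have "topspace M \<noteq> {}" using smooth_manifold by (simp add: smooth_manifold_def)
  then obtain q0 c where c: "c \<in> A" "q0 \<in> chart_dom c" using ex_chart by blast
  have s: "0 \<le> s" "s \<le> 1" using assms(3) by auto
  have "chart_img c \<noteq> {}" using chart_map_in[OF c(2)] by blast
  then obtain f :: "'e \<Rightarrow> real" and K C where f: "Ck_holder_on d' s UNIV f" "Ck_on 1 UNIV f"
    and K: "compact K" "connected K" "K \<subseteq> chart_img c" "\<forall>x\<in>K. (f has_derivative (\<lambda>_. 0)) (at x)"
      "\<not> f constant_on K"
    and C: "compact C" "C \<subseteq> chart_img c" "\<forall>x. x \<notin> C \<longrightarrow> f x = 0"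
    using whitney_function_in_open_set[OF assms(2,3) chart(2)[OF c(1)]] by metis
  define h where "h = extend c f"
  define H :: "'a \<times> ('a, 'e) covec \<Rightarrow> real" where "H = (\<lambda>z. h (fst z))"
  define \<Lambda> where "\<Lambda> = (\<lambda>x. (chart_inv c x, (\<lambda>_. 0) :: ('a, 'e) covec)) ` K"
  define \<Gamma> where "\<Gamma> = (\<lambda>q. (q, (\<lambda>_. 0) :: ('a, 'e) covec)) ` topspace M"
  have holder: "Ck_holder_on d' s (chart_img c') (h \<circ> chart_inv c')" if "c' \<in> A" for c'
    unfolding h_def by (rule Ck_holder_on_extend[OF c(1) s f(1) C(1,2) _ that]) (use C(3) in blast)
  \<comment> \<open>Shown separately since \<open>d'\<close> may be \<open>0\<close>, in which case
    \<open>holder\<close> does not give a differentiable \<open>h\<close>.\<close>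
  have C1: "Ck_holder_on 1 0 (chart_img c') (h \<circ> chart_inv c')" if "c' \<in> A" for c'
    unfolding h_def
    by (rule Ck_holder_on_extend[OF c(1) order_refl zero_le_one _ C(1,2) _ that])
      (use C(3) f(2) in \<open>simp_all only: Ck_on_iff_Ck_holder_on_0\<close>, blast)
  have "C1_function h" unfolding C1_function_def using C1 Ck_holder_on_imp_Ck_on by blast
  then have flow: "hamiltonian_flow M A H (fibre_flow h)"
    unfolding H_def by (rule hamiltonian_flow_fibre_flow)
  have "Ck_holder_hamiltonian d' s M A H"
    unfolding Ck_holder_hamiltonian_def H_def using Ck_holder_on_local_rep[OF _ s holder] by blast
  moreover have "Ck_hamiltonian 1 M A H"
    unfolding Ck_hamiltonian_def H_def
    using Ck_holder_on_imp_Ck_on[OF Ck_holder_on_local_rep[OF _ order_refl zero_le_one C1]] by blast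
  moreover have "C1_lagrangian_graph M A \<Gamma>" unfolding \<Gamma>_def by (rule zero_section_C1_lagrangian_graph)
  moreover have "\<Lambda> \<subseteq> \<Gamma>"
    unfolding \<Lambda>_def \<Gamma>_def using K(3) chart_inv_topspace[OF c(1)] by blast
  moreover have "compactin (cotangent_topology M A) \<Lambda>"
    unfolding \<Lambda>_def by (rule image_compactin[OF _ continuous_zero_section[OF c(1)]])
      (simp add: compactin_subtopology K)
  moreover have "connectedin (cotangent_topology M A) \<Lambda>"
    unfolding \<Lambda>_def by (rule connectedin_continuous_map_image[OF continuous_zero_section[OF c(1)]])
      (simp add: connectedin_subtopology K)
  moreover have "fibre_flow h t z = z" if z: "z \<in> \<Lambda>" for t z
  proof -
    obtain x where x: "x \<in> K" "z = (chart_inv c x, \<lambda>_. 0)" using z unfolding \<Lambda>_def by blast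
    have "differential h (chart_inv c x) = (\<lambda>_. 0)"
      unfolding h_def by (rule differential_extend[OF c(1) subsetD[OF K(3) x(1)] bspec[OF K(4) x(1)]])
    then show ?thesis by (simp add: fibre_flow_def x)
  qed
  then have "fibre_flow h t ` \<Lambda> = \<Lambda>" for t by (simp add: image_def)
  then have "flow_invariant M A H \<Lambda>" unfolding flow_invariant_def using flow by blast
  moreover have "\<not> H constant_on \<Lambda>"
  proof
    assume "H constant_on \<Lambda>"
    then obtain k where k: "\<forall>z\<in>\<Lambda>. H z = k" unfolding constant_on_def by blast
    have "f x = k" if x: "x \<in> K" for x
    proof -
      have xc: "x \<in> chart_img c" using x K(3) by blast
      have "(chart_inv c x, \<lambda>_. 0) \<in> \<Lambda>" unfolding \<Lambda>_def using x by blast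
      then have "h (chart_inv c x) = k" using k by (auto simp: H_def)
      then show ?thesis
        using chart_inv_in[OF c(1) xc] chart_map_inv[OF c(1) xc] by (simp add: h_def extend_def)
    qed
    then show False using K(5) unfolding constant_on_def by blast
  qed
  ultimately show ?thesis by blast
qed

end
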